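(* Let $R$ be a noetherian ring, $I$ an ideal of $R$, $M$ a finitely generated $R$-module, and $f\in I^s\setminus I^{s+1}$. Then $f$ is superficial for $M$ with respect to $I$ if and only if, on the blowup $S_I$ of $\operatorname{Spec} R$ along $I$, $$\operatorname{Supp}((f)^\#)\cap \operatorname{Ass}(\mathcal{G}(M))=\emptyset .$$ In the special case $M=R$ this condition reads $$\operatorname{Supp}((f)^\#)\cap \operatorname{Ass}(\mathcal{E}_I)=\emptyset .$$
   Context: $G(R)=\bigoplus_{n\ge 0} I^n/I^{n+1}$ and $G(M)=\bigoplus_{n\ge 0} I^nM/I^{n+1}M$. For $f\in I^s\setminus I^{s+1}$, $\bar f$ is the class of $f$ in $I^s/I^{s+1}=G(R)_s$. The element $f$ is superficial (of degree $s$) for $M$ with respect to $I$ if there is an integer $n_0$ such that multiplication by $\bar f$ from $G(M)_{n-s}$ to $G(M)_n$ is injective for all $n\ge n_0$. $B(R)=R[It]=\bigoplus_{n\ge 0} I^nt^n$ (with $I^0=R$), graded by powers of $t$, and $S_I=\operatorname{Proj} B(R)$. The exceptional divisor $\mathcal{E}_I\subset S_I$ is the closed subscheme defined by the homogeneous ideal $I\cdot B(R)$; as a scheme $\mathcal{E}_I=\operatorname{Proj} G(R)$. $\mathcal{G}(M)=\widetilde{G(M)}$ is the sheaf on $\mathcal{E}_I$ associated to the graded $G(R)$-module $G(M)$. The weak transform $(f)^\#$ of $f\in I^s\setminus I^{s+1}$ is the closed subscheme of $S_I$ defined by the homogeneous ideal $ft^s B(R)$ (equivalently, if $h_0,\dots,h_r$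 generate $I$, it is defined by $f/h_i^s$ in the chart $D_+(h_it)\cong\operatorname{Spec} R[I/h_i]$). $\operatorname{Supp}((f)^\#)$ is the underlying closed subset of $(f)^\#$. $\operatorname{Ass}(\mathcal{G}(M))$ is the (finite) set of associated points of $\mathcal{G}(M)$, contained in $\mathcal{E}_I\subset S_I$; $\operatorname{Ass}(\mathcal{E}_I)$ is the set of associated points of $\mathcal{O}_{\mathcal{E}_I}$. *)

theory Defs
  imports
    "HOL-Algebra.Module"
    "HOL-Algebra.UnivPoly"
    "HOL-Algebra.Ideal_Product"
    "HOL-Algebra.Ring_Divisibility"
begin

section \<open>Modules and adic filtrations\<close>

definition regular_module :: "('a, 'c) ring_scheme \<Rightarrow> ('a, 'a) module" where
  "regular_module R =
    \<lparr>carrier = carrier R, monoid.mult = monoid.mult R, one = one R, zero = zero R, add = add R,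
     smult = monoid.mult R\<rparr>"

definition module_span ::
    "('a, 'c) ring_scheme \<Rightarrow> ('a, 'b, 'd) module_scheme \<Rightarrow> 'b set \<Rightarrow> 'b set" where
  "module_span R M A = \<Inter>{N. submodule N R M \<and> A \<subseteq> N}"

definition finitely_generated_module ::
    "('a, 'c) ring_scheme \<Rightarrow> ('a, 'b, 'd) module_scheme \<Rightarrow> bool" where
  "finitely_generated_module R M \<longleftrightarrow>
    (\<exists>A. finite A \<and> A \<subseteq> carrier M \<and> module_span R M A = carrier M)"

text \<open>The monoid \<^const>\<open>ideals_set\<close> has \<^term>\<open>carrier R\<close> as its unit, so the zeroth power is
  the whole ring.\<close>

definition ideal_power :: "('a, 'c) ring_scheme \<Rightarrow> 'a set \<Rightarrow> nat \<Rightarrow> 'a set" where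
  "ideal_power R I n = I [^]\<^bsub>ideals_set R\<^esub> n"

definition adic_submodule ::
    "('a, 'c) ring_scheme \<Rightarrow> 'a set \<Rightarrow> ('a, 'b, 'd) module_scheme \<Rightarrow> nat \<Rightarrow> 'b set" where
  "adic_submodule R I M n =
    module_span R M {a \<odot>\<^bsub>M\<^esub> x | a x. a \<in> ideal_power R I n \<and> x \<in> carrier M}"


section \<open>Associated graded objects\<close>

text \<open>For a descending filtration \<open>F\<close> of \<open>M\<close>, an element of the direct sum of the groups
  \<open>F n / F (n + 1)\<close> is a family of cosets, almost all of which are zero.\<close>

definition gr_piece :: "('a, 'b, 'd) module_scheme \<Rightarrow> (nat \<Rightarrow> 'b set) \<Rightarrow> nat \<Rightarrow> 'b set monoid" where
  "gr_piece M F n = (M\<lparr>carrier := F n\<rparr>) A_Mod (F (Suc n))"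

definition gr_class ::
    "('a, 'b, 'd) module_scheme \<Rightarrow> (nat \<Rightarrow> 'b set) \<Rightarrow> nat \<Rightarrow> 'b \<Rightarrow> nat \<Rightarrow> 'b set" where
  "gr_class M F d x = (\<lambda>n. if n = d then F (Suc n) +>\<^bsub>M\<^esub> x else \<one>\<^bsub>gr_piece M F n\<^esub>)"

text \<open>The product on graded objects induced by an operation \<open>b\<close>: a coset in degree \<open>i\<close> and a
  coset in degree \<open>n - i\<close> are multiplied through representatives. \<^const>\<open>gr_piece\<close> is written
  multiplicatively, so \<^const>\<open>finprod\<close> is the sum in the quotient.\<close>

definition gr_prod ::
    "('a, 'b, 'd) module_scheme \<Rightarrow> (nat \<Rightarrow> 'b set) \<Rightarrow> ('e \<Rightarrow> 'b \<Rightarrow> 'b) \<Rightarrow>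
      (nat \<Rightarrow> 'e set) \<Rightarrow> (nat \<Rightarrow> 'b set) \<Rightarrow> nat \<Rightarrow> 'b set" where
  "gr_prod M F b u v = (\<lambda>n. finprod (gr_piece M F n)
      (\<lambda>i. \<Union>x\<in>u i. \<Union>y\<in>v (n - i). F (Suc n) +>\<^bsub>M\<^esub> b x y) {..n})"

text \<open>For a module only the fields \<open>carrier\<close>, \<open>zero\<close>, \<open>add\<close> and \<open>smult\<close> of the result are
  meaningful (as for the argument \<open>M\<close> itself); for \<open>M = regular_module R\<close> the fields \<open>mult\<close> and
  \<open>one\<close> make it a ring. The constructions of \<open>hloc\<close>, \<open>proj_sheaf\<close> and \<open>stalk\<close> below follow the
  same convention.\<close>

definition gr ::
    "('a, 'b, 'd) module_scheme \<Rightarrow> (nat \<Rightarrow> 'b set) \<Rightarrow> (nat \<Rightarrow> 'a set, nat \<Rightarrow> 'b set) module" where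
  "gr M F =
    \<lparr>carrier = {u. (\<forall>n. u n \<in> carrier (gr_piece M F n)) \<and> finite {n. u n \<noteq> \<one>\<^bsub>gr_piece M F n\<^esub>}},
     monoid.mult = gr_prod M F (monoid.mult M),
     one = gr_class M F 0 \<one>\<^bsub>M\<^esub>,
     zero = (\<lambda>n. \<one>\<^bsub>gr_piece M F n\<^esub>),
     add = (\<lambda>u v n. u n \<otimes>\<^bsub>gr_piece M F n\<^esub> v n),
     smult = gr_prod M F (smult M)\<rparr>"

definition gr_degree ::
    "('a, 'b, 'd) module_scheme \<Rightarrow> (nat \<Rightarrow> 'b set) \<Rightarrow> nat \<Rightarrow> (nat \<Rightarrow> 'b set) set" where
  "gr_degree M F d = {u \<in> carrier (gr M F). \<forall>n. n \<noteq> d \<longrightarrow> u n = \<one>\<^bsub>gr_piece M F n\<^esub>}"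

abbreviation gr_ring :: "('a, 'c) ring_scheme \<Rightarrow> 'a set \<Rightarrow> (nat \<Rightarrow> 'a set, nat \<Rightarrow> 'a set) module" where
  "gr_ring R I \<equiv> gr (regular_module R) (ideal_power R I)"

abbreviation gr_ring_degree :: "('a, 'c) ring_scheme \<Rightarrow> 'a set \<Rightarrow> nat \<Rightarrow> (nat \<Rightarrow> 'a set) set" where
  "gr_ring_degree R I \<equiv> gr_degree (regular_module R) (ideal_power R I)"

abbreviation gr_module ::
    "('a, 'c) ring_scheme \<Rightarrow> 'a set \<Rightarrow> ('a, 'b, 'd) module_scheme \<Rightarrow>
      (nat \<Rightarrow> 'a set, nat \<Rightarrow> 'b set) module" where
  "gr_module R I M \<equiv> gr M (adic_submodule R I M)"

abbreviation gr_module_degree ::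
    "('a, 'c) ring_scheme \<Rightarrow> 'a set \<Rightarrow> ('a, 'b, 'd) module_scheme \<Rightarrow> nat \<Rightarrow> (nat \<Rightarrow> 'b set) set" where
  "gr_module_degree R I M \<equiv> gr_degree M (adic_submodule R I M)"

definition initial_form :: "('a, 'c) ring_scheme \<Rightarrow> 'a set \<Rightarrow> nat \<Rightarrow> 'a \<Rightarrow> nat \<Rightarrow> 'a set" where
  "initial_form R I s f = gr_class (regular_module R) (ideal_power R I) s f"

text \<open>Meant for \<open>f\<close> in the \<open>s\<close>-th but not in the \<open>(s + 1)\<close>-st power of \<open>I\<close>. The components of
  negative degree are zero, so degrees \<open>n < s\<close> impose no condition.\<close>

definition superficial ::
    "('a, 'c) ring_scheme \<Rightarrow> 'a set \<Rightarrow> ('a, 'b, 'd) module_scheme \<Rightarrow> nat \<Rightarrow> 'a \<Rightarrow> bool" where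
  "superficial R I M s f \<longleftrightarrow>
    (\<exists>n0. \<forall>n\<ge>n0. s \<le> n \<longrightarrow>
      inj_on (\<lambda>u. initial_form R I s f \<odot>\<^bsub>gr_module R I M\<^esub> u) (gr_module_degree R I M (n - s)))"


section \<open>The topological space Proj\<close>

text \<open>A graded ring is given by a ring \<open>S\<close> and its homogeneous components \<open>D n\<close>.\<close>

definition homogeneous_ideal :: "('a, 'c) ring_scheme \<Rightarrow> (nat \<Rightarrow> 'a set) \<Rightarrow> 'a set \<Rightarrow> bool" where
  "homogeneous_ideal S D J \<longleftrightarrow> ideal J S \<and> J = Idl\<^bsub>S\<^esub> (J \<inter> (\<Union>n. D n))"

definition irrelevant_ideal :: "('a, 'c) ring_scheme \<Rightarrow> (nat \<Rightarrow> 'a set) \<Rightarrow> 'a set" where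
  "irrelevant_ideal S D = Idl\<^bsub>S\<^esub> (\<Union>n\<in>{1..}. D n)"

definition Proj :: "('a, 'c) ring_scheme \<Rightarrow> (nat \<Rightarrow> 'a set) \<Rightarrow> 'a set set" where
  "Proj S D = {p. primeideal p S \<and> homogeneous_ideal S D p \<and> \<not> irrelevant_ideal S D \<subseteq> p}"

definition Proj_zeros :: "('a, 'c) ring_scheme \<Rightarrow> (nat \<Rightarrow> 'a set) \<Rightarrow> 'a set \<Rightarrow> 'a set set" where
  "Proj_zeros S D J = {p \<in> Proj S D. J \<subseteq> p}"

definition Proj_opens :: "('a, 'c) ring_scheme \<Rightarrow> (nat \<Rightarrow> 'a set) \<Rightarrow> 'a set set set" where
  "Proj_opens S D = {Proj S D - Proj_zeros S D J | J. homogeneous_ideal S D J}"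


section \<open>The sheaf associated to a graded module\<close>

text \<open>\<open>N\<close> is a graded \<open>S\<close>-module with components \<open>E n\<close>. The fraction \<open>m / g\<close> of elements of
  equal degree at the homogeneous prime \<open>p\<close> is the class of all pairs equivalent to \<open>(m, g)\<close>.\<close>

definition hfrac ::
    "('a, 'c) ring_scheme \<Rightarrow> (nat \<Rightarrow> 'a set) \<Rightarrow> ('a, 'b, 'd) module_scheme \<Rightarrow> (nat \<Rightarrow> 'b set) \<Rightarrow>
      'a set \<Rightarrow> 'b \<Rightarrow> 'a \<Rightarrow> ('b \<times> 'a) set" where
  "hfrac S D N E p m g =
    {(m', g'). (\<exists>d. m' \<in> E d \<and> g' \<in> D d - p) \<and>
      (\<exists>h \<in> (\<Union>n. D n) - p. h \<odot>\<^bsub>N\<^esub> (g' \<odot>\<^bsub>N\<^esub> m) = h \<odot>\<^bsub>N\<^esub> (g \<odot>\<^bsub>N\<^esub> m'))}"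

text \<open>The degree zero part of the localization of \<open>N\<close> at the homogeneous elements outside \<open>p\<close>.
  As with \<^const>\<open>rcoset_mult\<close>, operations on classes are unions over all representatives.\<close>

definition hloc ::
    "('a, 'c) ring_scheme \<Rightarrow> (nat \<Rightarrow> 'a set) \<Rightarrow> ('a, 'b, 'd) module_scheme \<Rightarrow> (nat \<Rightarrow> 'b set) \<Rightarrow>
      'a set \<Rightarrow> (('a \<times> 'a) set, ('b \<times> 'a) set) module" where
  "hloc S D N E p =
    \<lparr>carrier = {hfrac S D N E p m g | m g. \<exists>d. m \<in> E d \<and> g \<in> D d - p},
     monoid.mult = (\<lambda>X Y. \<Union>(m, g)\<in>X. \<Union>(n, h)\<in>Y. hfrac S D N E p (m \<otimes>\<^bsub>N\<^esub> n) (g \<otimes>\<^bsub>S\<^esub> h)),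
     one = hfrac S D N E p \<one>\<^bsub>N\<^esub> \<one>\<^bsub>S\<^esub>,
     zero = hfrac S D N E p \<zero>\<^bsub>N\<^esub> \<one>\<^bsub>S\<^esub>,
     add = (\<lambda>X Y. \<Union>(m, g)\<in>X. \<Union>(n, h)\<in>Y.
              hfrac S D N E p ((h \<odot>\<^bsub>N\<^esub> m) \<oplus>\<^bsub>N\<^esub> (g \<odot>\<^bsub>N\<^esub> n)) (g \<otimes>\<^bsub>S\<^esub> h)),
     smult = (\<lambda>A X. \<Union>(a, h)\<in>A. \<Union>(m, g)\<in>X. hfrac S D N E p (a \<odot>\<^bsub>N\<^esub> m) (h \<otimes>\<^bsub>S\<^esub> g))\<rparr>"

text \<open>Sections over \<open>U\<close> are functions into the local modules that are locally given by a single
  fraction; restriction of sections is \<^const>\<open>restrict\<close>.\<close>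

definition proj_sheaf ::
    "('a, 'c) ring_scheme \<Rightarrow> (nat \<Rightarrow> 'a set) \<Rightarrow> ('a, 'b, 'd) module_scheme \<Rightarrow> (nat \<Rightarrow> 'b set) \<Rightarrow>
      'a set set \<Rightarrow> ('a set \<Rightarrow> ('a \<times> 'a) set, 'a set \<Rightarrow> ('b \<times> 'a) set) module" where
  "proj_sheaf S D N E U =
    \<lparr>carrier = {\<sigma> \<in> (\<Pi>\<^sub>E p\<in>U. carrier (hloc S D N E p)).
        \<forall>p\<in>U. \<exists>V \<in> Proj_opens S D. p \<in> V \<and> V \<subseteq> U \<and>
          (\<exists>d. \<exists>m \<in> E d. \<exists>g \<in> D d. \<forall>q\<in>V. g \<notin> q \<and> \<sigma> q = hfrac S D N E q m g)},
     monoid.mult = (\<lambda>\<sigma> \<tau>. \<lambda>p\<in>U. \<sigma> p \<otimes>\<^bsub>hloc S D N E p\<^esub> \<tau> p),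
     one = (\<lambda>p\<in>U. \<one>\<^bsub>hloc S D N E p\<^esub>),
     zero = (\<lambda>p\<in>U. \<zero>\<^bsub>hloc S D N E p\<^esub>),
     add = (\<lambda>\<sigma> \<tau>. \<lambda>p\<in>U. \<sigma> p \<oplus>\<^bsub>hloc S D N E p\<^esub> \<tau> p),
     smult = (\<lambda>\<alpha> \<sigma>. \<lambda>p\<in>U. \<alpha> p \<odot>\<^bsub>hloc S D N E p\<^esub> \<sigma> p)\<rparr>"

abbreviation proj_structure_sheaf ::
    "('a, 'c) ring_scheme \<Rightarrow> (nat \<Rightarrow> 'a set) \<Rightarrow>
      'a set set \<Rightarrow> ('a set \<Rightarrow> ('a \<times> 'a) set, 'a set \<Rightarrow> ('a \<times> 'a) set) module" where
  "proj_structure_sheaf S D \<equiv> proj_sheaf S D (regular_module S) D"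


section \<open>Stalks and associated points\<close>

text \<open>Stalks of a sheaf \<open>F\<close> of functions on a space with open sets \<open>T\<close>.\<close>

definition germ ::
    "'x set set \<Rightarrow> ('x set \<Rightarrow> ('e, 'x \<Rightarrow> 'v) module) \<Rightarrow> 'x \<Rightarrow> 'x set \<Rightarrow> ('x \<Rightarrow> 'v) \<Rightarrow>
      ('x set \<times> ('x \<Rightarrow> 'v)) set" where
  "germ T F x U \<sigma> =
    {(V, \<tau>). V \<in> T \<and> x \<in> V \<and> \<tau> \<in> carrier (F V) \<and>
      (\<exists>W \<in> T. x \<in> W \<and> W \<subseteq> U \<inter> V \<and> restrict \<sigma> W = restrict \<tau> W)}"

definition stalk ::
    "'x set set \<Rightarrow> ('x set \<Rightarrow> ('x \<Rightarrow> 'u, 'x \<Rightarrow> 'v) module) \<Rightarrow> 'x \<Rightarrow>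
      (('x set \<times> ('x \<Rightarrow> 'u)) set, ('x set \<times> ('x \<Rightarrow> 'v)) set) module" where
  "stalk T F x =
    \<lparr>carrier = {germ T F x U \<sigma> | U \<sigma>. U \<in> T \<and> x \<in> U \<and> \<sigma> \<in> carrier (F U)},
     monoid.mult = (\<lambda>X Y. \<Union>(U, \<sigma>)\<in>X. \<Union>(V, \<tau>)\<in>Y. germ T F x (U \<inter> V)
               (restrict \<sigma> (U \<inter> V) \<otimes>\<^bsub>F (U \<inter> V)\<^esub> restrict \<tau> (U \<inter> V))),
     one = \<Union>{germ T F x U \<one>\<^bsub>F U\<^esub> | U. U \<in> T \<and> x \<in> U},
     zero = \<Union>{germ T F x U \<zero>\<^bsub>F U\<^esub> | U. U \<in> T \<and> x \<in> U},
     add = (\<lambda>X Y. \<Union>(U, \<sigma>)\<in>X. \<Union>(V, \<tau>)\<in>Y. germ T F x (U \<inter> V)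
               (restrict \<sigma> (U \<inter> V) \<oplus>\<^bsub>F (U \<inter> V)\<^esub> restrict \<tau> (U \<inter> V))),
     smult = (\<lambda>A X. \<Union>(U, \<alpha>)\<in>A. \<Union>(V, \<tau>)\<in>X. germ T F x (U \<inter> V)
               (restrict \<alpha> (U \<inter> V) \<odot>\<^bsub>F (U \<inter> V)\<^esub> restrict \<tau> (U \<inter> V)))\<rparr>"

text \<open>A point \<open>x\<close> is associated to an \<open>O\<close>-module \<open>F\<close> if the maximal ideal of the local ring of
  \<open>O\<close> at \<open>x\<close>, i.e. the set of its nonunits, is the annihilator of an element of the stalk of
  \<open>F\<close> at \<open>x\<close>.\<close>

definition annihilator :: "('a, 'c) ring_scheme \<Rightarrow> ('a, 'b, 'd) module_scheme \<Rightarrow> 'b \<Rightarrow> 'a set" where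
  "annihilator A N \<xi> = {a \<in> carrier A. a \<odot>\<^bsub>N\<^esub> \<xi> = \<zero>\<^bsub>N\<^esub>}"

definition associated_points ::
    "'x set \<Rightarrow> 'x set set \<Rightarrow> ('x set \<Rightarrow> ('x \<Rightarrow> 'u, 'x \<Rightarrow> 'u) module) \<Rightarrow>
      ('x set \<Rightarrow> ('x \<Rightarrow> 'u, 'x \<Rightarrow> 'v) module) \<Rightarrow> 'x set" where
  "associated_points X T \<O> F =
    {x \<in> X. \<exists>\<xi> \<in> carrier (stalk T F x).
      annihilator (stalk T \<O> x) (stalk T F x) \<xi> = carrier (stalk T \<O> x) - Units (stalk T \<O> x)}"


section \<open>The blowup and its exceptional divisor\<close>

definition rees :: "('a, 'c) ring_scheme \<Rightarrow> 'a set \<Rightarrow> ('a, nat \<Rightarrow> 'a) up_ring" where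
  "rees R I = (UP R)\<lparr>carrier :=
     {b \<in> carrier (UP R). \<forall>n. coeff (UP R) b n \<in> ideal_power R I n}\<rparr>"

definition rees_degree :: "('a, 'c) ring_scheme \<Rightarrow> 'a set \<Rightarrow> nat \<Rightarrow> (nat \<Rightarrow> 'a) set" where
  "rees_degree R I n = {monom (UP R) a n | a. a \<in> ideal_power R I n}"

text \<open>The blowup is \<open>Proj\<close> of the Rees algebra.\<close>

definition weak_transform_supp ::
    "('a, 'c) ring_scheme \<Rightarrow> 'a set \<Rightarrow> nat \<Rightarrow> 'a \<Rightarrow> (nat \<Rightarrow> 'a) set set" where
  "weak_transform_supp R I s f =
    Proj_zeros (rees R I) (rees_degree R I) (PIdl\<^bsub>rees R I\<^esub> (monom (UP R) f s))"

text \<open>The closed immersion of \<open>Proj G(R)\<close> into the blowup, on points: inverse image of primes along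
  the reduction map from the Rees algebra to \<open>G(R)\<close>, whose kernel is \<open>I\<close> times the Rees algebra.\<close>

definition rees_to_gr :: "('a, 'c) ring_scheme \<Rightarrow> 'a set \<Rightarrow> (nat \<Rightarrow> 'a) \<Rightarrow> nat \<Rightarrow> 'a set" where
  "rees_to_gr R I b = (\<lambda>n. ideal_power R I (Suc n) +>\<^bsub>R\<^esub> coeff (UP R) b n)"

definition exc_embedding ::
    "('a, 'c) ring_scheme \<Rightarrow> 'a set \<Rightarrow> (nat \<Rightarrow> 'a set) set \<Rightarrow> (nat \<Rightarrow> 'a) set" where
  "exc_embedding R I p = {b \<in> carrier (rees R I). rees_to_gr R I b \<in> p}"

definition exc_associated_points ::
    "('a, 'c) ring_scheme \<Rightarrow> 'a set \<Rightarrow>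
      ((nat \<Rightarrow> 'a set) set set \<Rightarrow>
        ((nat \<Rightarrow> 'a set) set \<Rightarrow> ((nat \<Rightarrow> 'a set) \<times> (nat \<Rightarrow> 'a set)) set,
         (nat \<Rightarrow> 'a set) set \<Rightarrow> 'v) module) \<Rightarrow> (nat \<Rightarrow> 'a) set set" where
  "exc_associated_points R I F =
    exc_embedding R I `
      associated_points
        (Proj (gr_ring R I) (gr_ring_degree R I))
        (Proj_opens (gr_ring R I) (gr_ring_degree R I))
        (proj_structure_sheaf (gr_ring R I) (gr_ring_degree R I))
        F"

definition Ass_gr_sheaf ::
    "('a, 'c) ring_scheme \<Rightarrow> 'a set \<Rightarrow> ('a, 'b, 'd) module_scheme \<Rightarrow> (nat \<Rightarrow> 'a) set set" where
  "Ass_gr_sheaf R I M = exc_associated_points R I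
    (proj_sheaf (gr_ring R I) (gr_ring_degree R I) (gr_module R I M) (gr_module_degree R I M))"

definition Ass_exc_divisor :: "('a, 'c) ring_scheme \<Rightarrow> 'a set \<Rightarrow> (nat \<Rightarrow> 'a) set set" where
  "Ass_exc_divisor R I = exc_associated_points R I
    (proj_structure_sheaf (gr_ring R I) (gr_ring_degree R I))"

end

theory Submission
  imports Defs "HOL-Algebra.Subrings"
begin

text \<open>
  Let \<open>G\<close> and \<open>N\<close> be the associated graded ring and module, and let \<open>f'\<close> be the initial form of \<open>f\<close>.
  The inverse image in the Rees algebra of a homogeneous prime \<open>p\<close> of \<open>G\<close> contains \<open>f t^s\<close> exactly
  when \<open>p\<close> contains \<open>f'\<close> (\<open>exc_embedding_weak_transform_iff\<close>). So the claim is that \<open>f'\<close> acts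
  injectively on \<open>N\<close> in large degrees if and only if no associated point of the sheaf of \<open>N\<close>
  contains \<open>f'\<close>. The stalk of this sheaf at \<open>p\<close> is the homogeneous localization of \<open>N\<close>, so \<open>p\<close> is
  associated when some homogeneous \<open>x\<close> in \<open>N\<close> has, locally at \<open>p\<close>, the annihilator \<open>p\<close>
  (\<open>associated_points_iff\<close>).

  If \<open>f'\<close> lies in such a \<open>p\<close>, some power of \<open>f'\<close> kills \<open>h x\<close> for a homogeneous \<open>h\<close> outside \<open>p\<close>. As
  \<open>p\<close> does not contain the irrelevant ideal, \<open>h\<close> can be taken of any large degree, where \<open>f'\<close> acts
  injectively if \<open>f\<close> is superficial; then \<open>h x = 0\<close>, which makes \<open>x\<close> zero at \<open>p\<close>
  (\<open>superficial_imp_not_mem\<close>).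

  Conversely, suppose that \<open>f'\<close> is not injective in large degrees. Torsion with respect to the
  irrelevant ideal lives in finitely many degrees (\<open>uniform_torsion\<close>), so the kernel of \<open>f'\<close> contains
  homogeneous elements \<open>x\<close> that are not torsion. Among the ideals of all \<open>a\<close> such that \<open>a x\<close> is
  torsion, for such \<open>x\<close>, a maximal one is prime, does not contain the irrelevant ideal, and is an
  associated point containing \<open>f'\<close> (\<open>ex_Ass_point\<close>).

  The finiteness used here is the ascending chain condition for graded submodules of the Rees
  module \<open>\<Oplus>\<^sub>n I\<^sup>n M\<close> (\<open>rees_acc\<close>). It is Hilbert's basis theorem, proved for families of submodules
  of \<open>M\<close>, one generator of \<open>I\<close> at a time. Graded submodules of \<open>N\<close> correspond to families whose \<open>n\<close>-th
  member contains \<open>I^(n + 1) M\<close>, so the condition holds for them as well.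
\<close>

section \<open>Stalks of the sheaf of a graded module\<close>

lemma regular_module_simps [simp]:
  "carrier (regular_module R) = carrier R"
  "monoid.mult (regular_module R) = monoid.mult R"
  "one (regular_module R) = one R"
  "zero (regular_module R) = zero R"
  "add (regular_module R) = add R"
  "smult (regular_module R) = monoid.mult R"
  by (simp_all add: regular_module_def)

lemma (in cring) regular_module_is_module: "module R (regular_module R)"
proof (rule moduleI)
  show "cring R" ..
  show "abelian_group (regular_module R)"
    by (rule abelian_groupI) (auto simp: a_ac intro: l_neg)
qed (auto simp: l_distr r_distr m_assoc)

text \<open>The computation of stalks multiplies homogeneous elements and compares the products, but never
  decomposes an element into components; hence this form of the grading.\<close>

locale graded_scalars = cring S for S :: "('a, 'c) ring_scheme" (structure) +
  fixes D :: "nat \<Rightarrow> 'a set"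
  assumes D_carrier: "a \<in> D i \<Longrightarrow> a \<in> carrier S"
    and D_mult: "\<lbrakk>a \<in> D i; b \<in> D j\<rbrakk> \<Longrightarrow> a \<otimes> b \<in> D (i + j)"
    and D_one: "\<one> \<in> D 0"
    and D_zero: "\<zero> \<in> D i"
begin

abbreviation "Hom \<equiv> (\<Union>n. D n)"
abbreviation "opens \<equiv> Proj_opens S D"

lemma Hom_carrier: "a \<in> Hom \<Longrightarrow> a \<in> carrier S"
  using D_carrier by blast

lemma Hom_mult: "\<lbrakk>a \<in> Hom; b \<in> Hom\<rbrakk> \<Longrightarrow> a \<otimes> b \<in> Hom"
  using D_mult by blast

lemma prime_mult: "\<lbrakk>primeideal p S; a \<in> Hom - p; b \<in> Hom - p\<rbrakk> \<Longrightarrow> a \<otimes> b \<in> Hom - p"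
  using primeideal.I_prime[of p S a b] Hom_carrier Hom_mult by blast

lemma prime_pow: "\<lbrakk>primeideal p S; a \<in> carrier S; a \<notin> p\<rbrakk> \<Longrightarrow> a [^] (k::nat) \<notin> p"
proof (induction k)
  case 0
  then show ?case
    using ideal.one_imp_carrier primeideal.I_notcarr primeideal.axioms(1) by fastforce
next
  case (Suc k)
  then show ?case using primeideal.I_prime[of p S "a [^] k" a] by auto
qed

lemma prime_one: "primeideal p S \<Longrightarrow> \<one> \<in> Hom - p"
  using prime_pow[of p \<one> 0] prime_pow[of p \<one> 0] D_one
  by (metis DiffI UN_I UNIV_I ideal.one_imp_carrier primeideal.I_notcarr primeideal.axioms(1))

lemma homogeneous_ideal_Idl:
  assumes "A \<subseteq> Hom" shows "homogeneous_ideal S D (Idl A)"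
proof -
  have A: "A \<subseteq> carrier S" using assms Hom_carrier by blast
  then have id: "ideal (Idl A) S" by (rule genideal_ideal)
  have "Idl A \<subseteq> Idl (Idl A \<inter> Hom)"
    by (rule subset_Idl_subset)
      (use id assms genideal_self[OF A] ideal.Icarr[OF id] in auto)
  moreover have "Idl (Idl A \<inter> Hom) \<subseteq> Idl A"
    by (rule genideal_minimal[OF id]) auto
  ultimately show ?thesis using id by (auto simp: homogeneous_ideal_def)
qed

lemma homogeneous_ideal_not_subset:
  assumes "homogeneous_ideal S D J" "ideal p S" "\<not> J \<subseteq> p"
  obtains a where "a \<in> J" "a \<in> Hom - p"
proof -
  have "\<not> J \<inter> Hom \<subseteq> p"
    using assms genideal_minimal[OF assms(2), of "J \<inter> Hom"]
    unfolding homogeneous_ideal_def by blast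
  then show thesis using that by blast
qed

lemma basic_open: "g \<in> Hom \<Longrightarrow> {q \<in> Proj S D. g \<notin> q} \<in> opens"
proof -
  assume g: "g \<in> Hom"
  have "{q \<in> Proj S D. g \<notin> q} = Proj S D - Proj_zeros S D (Idl {g})"
  proof -
    have "Idl {g} \<subseteq> q \<longleftrightarrow> g \<in> q" if "q \<in> Proj S D" for q
    proof -
      have "ideal q S" using that by (simp add: Proj_def primeideal.axioms)
      then show ?thesis using g Hom_carrier
        by (simp add: Idl_subset_ideal)
    qed
    then show ?thesis by (auto simp: Proj_zeros_def)
  qed
  moreover have "homogeneous_ideal S D (Idl {g})" using g by (intro homogeneous_ideal_Idl) auto
  ultimately show ?thesis by (auto simp: Proj_opens_def)
qed

lemma Proj_open: "Proj S D \<in> opens"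
proof -
  have "Proj S D = {q \<in> Proj S D. \<one> \<notin> q}"
    using prime_one by (auto simp: Proj_def)
  then show ?thesis using basic_open[of \<one>] D_one by auto
qed

lemma Proj_opens_subset: "U \<in> opens \<Longrightarrow> U \<subseteq> Proj S D"
  by (auto simp: Proj_opens_def)

text \<open>A homogeneous prime contains all products of homogeneous elements of two ideals exactly when it
  contains one of the two ideals, so these products cut out the union of the two zero sets.\<close>

lemma Proj_opens_Int:
  assumes "U \<in> opens" "V \<in> opens"
  shows "U \<inter> V \<in> opens"
proof -
  obtain J K where J: "homogeneous_ideal S D J" "U = Proj S D - Proj_zeros S D J"
    and K: "homogeneous_ideal S D K" "V = Proj S D - Proj_zeros S D K"
    using assms unfolding Proj_opens_def by blast
  define A where "A = {a \<otimes> b | a b. a \<in> J \<inter> Hom \<and> b \<in> K \<inter> Hom}"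
  have A: "A \<subseteq> Hom" using Hom_mult unfolding A_def by blast
  have "Idl A \<subseteq> q \<longleftrightarrow> J \<subseteq> q \<or> K \<subseteq> q" if q: "q \<in> Proj S D" for q
  proof -
    have pr: "primeideal q S" and id: "ideal q S"
      using q by (auto simp: Proj_def primeideal.axioms)
    have "Idl A \<subseteq> q \<longleftrightarrow> A \<subseteq> q"
      using Idl_subset_ideal[OF id] A Hom_carrier by blast
    moreover have "A \<subseteq> q" if "J \<subseteq> q"
      using that ideal.I_r_closed[OF id] Hom_carrier unfolding A_def by blast
    moreover have "A \<subseteq> q" if "K \<subseteq> q"
      using that ideal.I_l_closed[OF id] Hom_carrier unfolding A_def by blast
    moreover have "\<not> A \<subseteq> q" if "\<not> J \<subseteq> q" "\<not> K \<subseteq> q"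
    proof -
      obtain a where a: "a \<in> J" "a \<in> Hom - q"
        using homogeneous_ideal_not_subset[OF J(1) id \<open>\<not> J \<subseteq> q\<close>] .
      obtain b where b: "b \<in> K" "b \<in> Hom - q"
        using homogeneous_ideal_not_subset[OF K(1) id \<open>\<not> K \<subseteq> q\<close>] .
      have "a \<otimes> b \<in> A" using a b unfolding A_def by blast
      moreover have "a \<otimes> b \<notin> q" using prime_mult[OF pr a(2) b(2)] by blast
      ultimately show ?thesis by blast
    qed
    ultimately show ?thesis by blast
  qed
  then have "U \<inter> V = Proj S D - Proj_zeros S D (Idl A)"
    using J(2) K(2) by (auto simp: Proj_zeros_def)
  then show ?thesis
    using homogeneous_ideal_Idl[OF A] by (auto simp: Proj_opens_def)
qed

end

locale graded_pair = graded_scalars S D + module S N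
  for S :: "('a, 'c) ring_scheme" (structure) and D
    and N :: "('a, 'b, 'd) module_scheme" (structure) +
  fixes E :: "nat \<Rightarrow> 'b set"
  assumes E_carrier: "m \<in> E i \<Longrightarrow> m \<in> carrier N"
    and E_smult: "\<lbrakk>a \<in> D i; m \<in> E j\<rbrakk> \<Longrightarrow> a \<odot>\<^bsub>N\<^esub> m \<in> E (i + j)"
    and E_zero: "\<zero>\<^bsub>N\<^esub> \<in> E i"

lemma (in graded_scalars) graded_pair_regular: "graded_pair S D (regular_module S) D"
proof -
  interpret R: module S "regular_module S" by (rule regular_module_is_module)
  show ?thesis
    by unfold_locales (auto simp: D_carrier D_mult D_zero)
qed

context graded_pair
begin

abbreviation scale :: "'a \<Rightarrow> 'b \<Rightarrow> 'b" (infixl \<open>\<star>\<close> 70) where "a \<star> m \<equiv> a \<odot>\<^bsub>N\<^esub> m"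

text \<open>The prefix \<open>r\<close> marks the fractions and the localization of the ring itself.\<close>

abbreviation "fr \<equiv> hfrac S D N E"
abbreviation "loc \<equiv> hloc S D N E"
abbreviation "rfr \<equiv> hfrac S D (regular_module S) D"
abbreviation "rloc \<equiv> hloc S D (regular_module S) D"

lemma hfrac_iff:
  "(m', g') \<in> fr p m g \<longleftrightarrow>
    (\<exists>d. m' \<in> E d \<and> g' \<in> D d - p) \<and>
    (\<exists>h \<in> Hom - p. h \<star> (g' \<star> m) = h \<star> (g \<star> m'))"
  by (simp add: hfrac_def)

text \<open>If \<open>h\<close> and \<open>k\<close> witness two consecutive equalities of fractions, then \<open>h k g'\<close> witnesses the
  composite, \<open>g'\<close> being the middle denominator.\<close>

lemma hfrac_trans:
  assumes p: "primeideal p S"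
    and c: "m \<in> carrier N" "m' \<in> carrier N" "m'' \<in> carrier N"
           "g \<in> Hom - p" "g' \<in> Hom - p" "g'' \<in> Hom - p"
    and 1: "\<exists>h \<in> Hom - p. h \<star> (g' \<star> m) = h \<star> (g \<star> m')"
    and 2: "\<exists>h \<in> Hom - p. h \<star> (g'' \<star> m') = h \<star> (g' \<star> m'')"
  shows "\<exists>h \<in> Hom - p. h \<star> (g'' \<star> m) = h \<star> (g \<star> m'')"
proof -
  obtain h where h: "h \<in> Hom - p" "h \<star> (g' \<star> m) = h \<star> (g \<star> m')"
    using 1 by blast
  obtain k where k: "k \<in> Hom - p" "k \<star> (g'' \<star> m') = k \<star> (g' \<star> m'')"
    using 2 by blast
  have car: "h \<in> carrier S" "k \<in> carrier S" "g \<in> carrier S" "g' \<in> carrier S" "g'' \<in> carrier S"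
    using h k c Hom_carrier by blast+
  have "(h \<otimes> k \<otimes> g') \<star> (g'' \<star> m) = (k \<otimes> g'') \<star> (h \<star> (g' \<star> m))"
    using car c by (simp add: smult_assoc1[symmetric] m_ac)
  also have "\<dots> = (h \<otimes> g) \<star> (k \<star> (g'' \<star> m'))"
    unfolding h(2) using car c by (simp add: smult_assoc1[symmetric] m_ac)
  also have "\<dots> = (h \<otimes> k \<otimes> g') \<star> (g \<star> m'')"
    unfolding k(2) using car c by (simp add: smult_assoc1[symmetric] m_ac)
  finally show ?thesis
    using prime_mult[OF p prime_mult[OF p h(1) k(1)] c(5)] by blast
qed

lemma hfrac_sym:
  "(\<exists>h \<in> Hom - p. h \<star> (g' \<star> m) = h \<star> (g \<star> m')) \<Longrightarrow>
   (\<exists>h \<in> Hom - p. h \<star> (g \<star> m') = h \<star> (g' \<star> m))"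
  by metis

lemma hfrac_self:
  "\<lbrakk>primeideal p S; m \<in> E d; g \<in> D d - p\<rbrakk> \<Longrightarrow> (m, g) \<in> fr p m g"
  using prime_one by (auto simp: hfrac_iff)

lemma hfrac_eq_iff:
  assumes p: "primeideal p S"
    and m: "m \<in> E d" "g \<in> D d - p" and m': "m' \<in> E d'" "g' \<in> D d' - p"
  shows "fr p m g = fr p m' g' \<longleftrightarrow>
    (\<exists>h \<in> Hom - p. h \<star> (g' \<star> m) = h \<star> (g \<star> m'))" (is "_ \<longleftrightarrow> ?R")
proof
  assume "fr p m g = fr p m' g'"
  then have "(m', g') \<in> fr p m g" using hfrac_self[OF p m'] by simp
  then show ?R by (simp add: hfrac_iff)
next
  assume R: ?R
  have c: "m \<in> carrier N" "m' \<in> carrier N" "g \<in> Hom - p" "g' \<in> Hom - p"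
    using m m' E_carrier by auto
  show "fr p m g = fr p m' g'"
  proof (intro equalityI subrelI)
    fix n k assume "(n, k) \<in> fr p m g"
    then obtain e where nk: "n \<in> E e" "k \<in> D e - p"
      and w: "\<exists>h \<in> Hom - p. h \<star> (k \<star> m) = h \<star> (g \<star> n)"
      by (auto simp only: hfrac_iff)
    have "\<exists>h \<in> Hom - p. h \<star> (k \<star> m') = h \<star> (g' \<star> n)"
      by (rule hfrac_trans[OF p c(2,1) _ c(4,3) _ hfrac_sym[OF R] w])
        (use nk E_carrier in auto)
    then show "(n, k) \<in> fr p m' g'" using nk by (auto simp only: hfrac_iff)
  next
    fix n k assume "(n, k) \<in> fr p m' g'"
    then obtain e where nk: "n \<in> E e" "k \<in> D e - p"
      and w: "\<exists>h \<in> Hom - p. h \<star> (k \<star> m') = h \<star> (g' \<star> n)"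
      by (auto simp only: hfrac_iff)
    have "\<exists>h \<in> Hom - p. h \<star> (k \<star> m) = h \<star> (g \<star> n)"
      by (rule hfrac_trans[OF p c(1,2) _ c(3,4) _ R w])
        (use nk E_carrier in auto)
    then show "(n, k) \<in> fr p m g" using nk by (auto simp only: hfrac_iff)
  qed
qed

lemma hloc_carrierI:
  "\<lbrakk>m \<in> E d; g \<in> D d - p\<rbrakk> \<Longrightarrow> fr p m g \<in> carrier (loc p)"
  by (auto simp: hloc_def)

lemma hloc_carrierE:
  assumes "X \<in> carrier (loc p)"
  obtains m g d where "m \<in> E d" "g \<in> D d - p" "X = fr p m g"
  using assms by (auto simp: hloc_def)

text \<open>The scalar multiplication of \<^const>\<open>hloc\<close> is a union over all representatives; all of
  them give the same fraction.\<close>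

lemma hloc_smult:
  assumes p: "primeideal p S"
    and a: "a \<in> D e" "b \<in> D e - p" and m: "m \<in> E d" "g \<in> D d - p"
  shows "rfr p a b \<odot>\<^bsub>loc p\<^esub> fr p m g =
    fr p (a \<star> m) (b \<otimes> g)"
proof -
  interpret reg: graded_pair S D "regular_module S" D by (rule graded_pair_regular)
  have bg: "b \<otimes> g \<in> D (e + d) - p"
    using a m D_mult prime_mult[OF p, of b g] by blast
  have am: "a \<star> m \<in> E (e + d)" using a m E_smult by blast
  have eq: "fr p (a' \<star> m') (b' \<otimes> g') = fr p (a \<star> m) (b \<otimes> g)"
    if A: "(a', b') \<in> rfr p a b"
      and M: "(m', g') \<in> fr p m g" for a' b' m' g'
  proof -
    obtain e' h where a': "a' \<in> D e'" "b' \<in> D e' - p" "h \<in> Hom - p"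
      and h: "h \<otimes> (b' \<otimes> a) = h \<otimes> (b \<otimes> a')"
      using A by (auto simp: reg.hfrac_iff)
    obtain d' k where m': "m' \<in> E d'" "g' \<in> D d' - p" "k \<in> Hom - p"
      and k: "k \<star> (g' \<star> m) = k \<star> (g \<star> m')"
      using M by (auto simp: hfrac_iff)
    have car: "a \<in> carrier S" "b \<in> carrier S" "g \<in> carrier S" "m \<in> carrier N"
      "a' \<in> carrier S" "b' \<in> carrier S" "g' \<in> carrier S" "m' \<in> carrier N"
      "h \<in> carrier S" "k \<in> carrier S"
      using a m a' m' D_carrier E_carrier by blast+
    have "(h \<otimes> k) \<star> ((b' \<otimes> g') \<star> (a \<star> m)) =
        (h \<otimes> (b' \<otimes> a)) \<star> (k \<star> (g' \<star> m))"
      using car by (simp add: smult_assoc1[symmetric] m_ac)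
    also have "\<dots> = (h \<otimes> k) \<star> ((b \<otimes> g) \<star> (a' \<star> m'))"
      unfolding h k using car by (simp add: smult_assoc1[symmetric] m_ac)
    finally have w: "\<exists>h\<in>Hom - p. h \<star> ((b' \<otimes> g') \<star> (a \<star> m)) =
        h \<star> ((b \<otimes> g) \<star> (a' \<star> m'))"
      using prime_mult[OF p a'(3) m'(3)] by blast
    have "b' \<otimes> g' \<in> D (e' + d') - p" "a' \<star> m' \<in> E (e' + d')"
      using a' m' D_mult E_smult prime_mult[OF p, of b' g'] by blast+
    then show ?thesis using hfrac_eq_iff[OF p am bg] w by metis
  qed
  have "rfr p a b \<odot>\<^bsub>loc p\<^esub> fr p m g =
    (\<Union>(a', b')\<in>rfr p a b.
       \<Union>(m', g')\<in>fr p m g. fr p (a' \<star> m') (b' \<otimes> g'))"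
    by (simp add: hloc_def)
  also have "\<dots> = (\<Union>_\<in>rfr p a b.
       \<Union>_\<in>fr p m g. fr p (a \<star> m) (b \<otimes> g))"
    using eq by (intro SUP_cong refl) auto
  also have "\<dots> = fr p (a \<star> m) (b \<otimes> g)"
    using reg.hfrac_self[OF p a] hfrac_self[OF p m] by auto
  finally show ?thesis .
qed

lemma hloc_zero: "\<zero>\<^bsub>loc p\<^esub> = fr p \<zero>\<^bsub>N\<^esub> \<one>"
  by (simp add: hloc_def)

lemma hfrac_zero_iff:
  assumes p: "primeideal p S" and m: "m \<in> E d" "g \<in> D d - p"
  shows "fr p m g = \<zero>\<^bsub>loc p\<^esub> \<longleftrightarrow> (\<exists>h \<in> Hom - p. h \<star> m = \<zero>\<^bsub>N\<^esub>)"
proof -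
  have o: "\<one> \<in> D 0 - p" using D_one prime_one[OF p] by blast
  have "g \<in> carrier S" "m \<in> carrier N" using m D_carrier E_carrier by auto
  then show ?thesis
    unfolding hloc_zero hfrac_eq_iff[OF p m E_zero o]
    by (intro bex_cong refl) (use Hom_carrier in auto)
qed

abbreviation "PS \<equiv> proj_sheaf S D N E"

lemma proj_sheaf_carrier_iff:
  "\<sigma> \<in> carrier (PS U) \<longleftrightarrow> \<sigma> \<in> (\<Pi>\<^sub>E p\<in>U. carrier (loc p)) \<and>
     (\<forall>p\<in>U. \<exists>V \<in> opens. p \<in> V \<and> V \<subseteq> U \<and>
          (\<exists>d. \<exists>m \<in> E d. \<exists>g \<in> D d. \<forall>q\<in>V. g \<notin> q \<and> \<sigma> q = fr q m g))"
  by (simp add: proj_sheaf_def)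

lemma proj_sheaf_carrierI:
  assumes ext: "\<sigma> \<in> extensional U"
    and loc: "\<And>p. p \<in> U \<Longrightarrow> \<exists>V \<in> opens. p \<in> V \<and> V \<subseteq> U \<and>
          (\<exists>d. \<exists>m \<in> E d. \<exists>g \<in> D d. \<forall>q\<in>V. g \<notin> q \<and> \<sigma> q = fr q m g)"
  shows "\<sigma> \<in> carrier (PS U)"
proof -
  have "\<sigma> p \<in> carrier (loc p)" if pU: "p \<in> U" for p
  proof -
    obtain m d g where "m \<in> E d" "g \<in> D d" "g \<notin> p" "\<sigma> p = fr p m g"
      using loc[OF pU] by blast
    then show ?thesis by (auto intro: hloc_carrierI)
  qed
  then show ?thesis using assms unfolding proj_sheaf_carrier_iff PiE_def by blast
qed

lemma section_local:
  assumes "\<sigma> \<in> carrier (PS U)" "p \<in> U"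
  shows "\<exists>V d m g. V \<in> opens \<and> p \<in> V \<and> V \<subseteq> U \<and> m \<in> E d \<and> g \<in> D d \<and>
    (\<forall>q\<in>V. g \<notin> q \<and> \<sigma> q = fr q m g)"
  using conjunct2[OF assms(1)[unfolded proj_sheaf_carrier_iff], rule_format, OF assms(2)]
  by (elim bexE conjE exE) (intro exI conjI; assumption)

lemma Proj_prime: "p \<in> Proj S D \<Longrightarrow> primeideal p S"
  by (simp add: Proj_def)

lemma basic_section:
  assumes m: "m \<in> E d" "g \<in> D d"
  shows "(\<lambda>q\<in>{q \<in> Proj S D. g \<notin> q}. fr q m g) \<in> carrier (PS {q \<in> Proj S D. g \<notin> q})"
proof (rule proj_sheaf_carrierI)
  fix p assume p: "p \<in> {q \<in> Proj S D. g \<notin> q}"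
  have "{q \<in> Proj S D. g \<notin> q} \<in> opens" using m by (intro basic_open) auto
  then show "\<exists>V \<in> opens. p \<in> V \<and> V \<subseteq> {q \<in> Proj S D. g \<notin> q} \<and>
     (\<exists>d. \<exists>m' \<in> E d. \<exists>g' \<in> D d. \<forall>q\<in>V. g' \<notin> q \<and>
        (\<lambda>q\<in>{q \<in> Proj S D. g \<notin> q}. fr q m g) q = fr q m' g')"
    using p m
    by (intro bexI[of _ "{q \<in> Proj S D. g \<notin> q}"] conjI exI[of _ d] bexI[of _ m] bexI[of _ g]) auto
qed simp

text \<open>All pairs of an open neighbourhood of \<open>p\<close> and a section over it with value \<open>\<xi>\<close> at \<open>p\<close>.
  The germs at \<open>p\<close> turn out to be exactly these sets, which identifies the stalk with
  \<^const>\<open>hloc\<close>.\<close>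

definition value_germ :: "'a set \<Rightarrow> ('b \<times> 'a) set \<Rightarrow>
    ('a set set \<times> ('a set \<Rightarrow> ('b \<times> 'a) set)) set" where
  "value_germ p \<xi> = {(V, \<tau>). V \<in> opens \<and> p \<in> V \<and> \<tau> \<in> carrier (PS V) \<and> \<tau> p = \<xi>}"

text \<open>Two sections with the same value at \<open>p\<close> agree near \<open>p\<close>: locally both are fractions, and the
  equality of these fractions at \<open>p\<close> is witnessed by some \<open>h\<close>, hence persists on the open set
  where \<open>h\<close> does not vanish.\<close>

lemma germ_eq_value_germ:
  assumes U: "U \<in> opens" "p \<in> U" and \<sigma>: "\<sigma> \<in> carrier (PS U)"
  shows "germ opens PS p U \<sigma> = value_germ p (\<sigma> p)"
proof (intro equalityI subrelI)
  fix V \<tau> assume "(V, \<tau>) \<in> germ opens PS p U \<sigma>"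
  then obtain W where "V \<in> opens" "p \<in> V" "\<tau> \<in> carrier (PS V)"
     and W: "p \<in> W" "restrict \<sigma> W = restrict \<tau> W"
    by (auto simp: germ_def)
  moreover have "\<sigma> p = \<tau> p" using W by (metis restrict_apply')
  ultimately show "(V, \<tau>) \<in> value_germ p (\<sigma> p)" by (simp add: value_germ_def)
next
  fix V \<tau> assume "(V, \<tau>) \<in> value_germ p (\<sigma> p)"
  then have V: "V \<in> opens" "p \<in> V" "\<tau> \<in> carrier (PS V)" and eq: "\<tau> p = \<sigma> p"
    by (auto simp: value_germ_def)
  have pp: "primeideal p S" using U Proj_opens_subset Proj_prime by blast
  obtain A d m g where A: "A \<in> opens" "p \<in> A" "A \<subseteq> U" "m \<in> E d" "g \<in> D d"
    "\<forall>q\<in>A. g \<notin> q \<and> \<sigma> q = fr q m g"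
    using section_local[OF \<sigma> U(2)] by blast
  obtain B d' m' g' where B: "B \<in> opens" "p \<in> B" "B \<subseteq> V" "m' \<in> E d'" "g' \<in> D d'"
    "\<forall>q\<in>B. g' \<notin> q \<and> \<tau> q = fr q m' g'"
    using section_local[OF V(3,2)] by blast
  have "fr p m g = fr p m' g'" using A B eq by metis
  then obtain h where h: "h \<in> Hom - p" "h \<star> (g' \<star> m) = h \<star> (g \<star> m')"
    using hfrac_eq_iff[OF pp, of m d g m' d' g'] A B by blast
  define W where "W = A \<inter> B \<inter> {q \<in> Proj S D. h \<notin> q}"
  have "W \<in> opens"
    unfolding W_def using A B h by (intro Proj_opens_Int basic_open) auto
  moreover have "p \<in> W" using A B h U Proj_opens_subset unfolding W_def by blast
  moreover have "W \<subseteq> U \<inter> V" using A B unfolding W_def by blast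
  moreover have "\<sigma> q = \<tau> q" if q: "q \<in> W" for q
  proof -
    have "primeideal q S" using q Proj_prime unfolding W_def by blast
    then have "fr q m g = fr q m' g'"
      using hfrac_eq_iff[of q m d g m' d' g'] q A B h unfolding W_def by blast
    then show ?thesis using q A(6) B(6) unfolding W_def by simp
  qed
  ultimately show "(V, \<tau>) \<in> germ opens PS p U \<sigma>"
    using V restrict_ext[of W \<sigma> \<tau>] unfolding germ_def by blast
qed

lemma section_through:
  assumes p: "p \<in> Proj S D" and \<xi>: "\<xi> \<in> carrier (loc p)"
  obtains U \<sigma> where "U \<in> opens" "p \<in> U" "\<sigma> \<in> carrier (PS U)" "\<sigma> p = \<xi>"
proof -
  obtain m g d where m: "m \<in> E d" "g \<in> D d - p" "\<xi> = fr p m g"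
    using hloc_carrierE[OF \<xi>] .
  show thesis
    by (rule that[of "{q \<in> Proj S D. g \<notin> q}" "\<lambda>q\<in>{q \<in> Proj S D. g \<notin> q}. fr q m g"])
      (use m p basic_section[of m d g] in \<open>auto intro!: basic_open\<close>)
qed

lemma section_value:
  "\<lbrakk>\<sigma> \<in> carrier (PS U); p \<in> U\<rbrakk> \<Longrightarrow> \<sigma> p \<in> carrier (loc p)"
  by (auto simp: proj_sheaf_carrier_iff)

lemma stalk_carrier:
  assumes p: "p \<in> Proj S D"
  shows "carrier (stalk opens PS p) = value_germ p ` carrier (loc p)"
proof -
  have "carrier (stalk opens PS p) =
    {germ opens PS p U \<sigma> | U \<sigma>. U \<in> opens \<and> p \<in> U \<and> \<sigma> \<in> carrier (PS U)}"
    by (simp add: stalk_def)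
  also have "\<dots> = value_germ p ` carrier (loc p)"
  proof (intro subset_antisym subsetI)
    fix x assume "x \<in> value_germ p ` carrier (loc p)"
    then obtain \<xi> where \<xi>: "\<xi> \<in> carrier (loc p)" "x = value_germ p \<xi>" by blast
    obtain U \<sigma> where "U \<in> opens" "p \<in> U" "\<sigma> \<in> carrier (PS U)" "\<sigma> p = \<xi>"
      using section_through[OF p \<xi>(1)] .
    then show "x \<in> {germ opens PS p U \<sigma> | U \<sigma>.
        U \<in> opens \<and> p \<in> U \<and> \<sigma> \<in> carrier (PS U)}"
      using germ_eq_value_germ \<xi>(2) by blast
  qed (auto simp: germ_eq_value_germ section_value)
  finally show ?thesis .
qed

lemma value_germ_nonempty:
  assumes "p \<in> Proj S D" "\<xi> \<in> carrier (loc p)" shows "value_germ p \<xi> \<noteq> {}"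
proof -
  obtain U \<sigma> where "U \<in> opens" "p \<in> U" "\<sigma> \<in> carrier (PS U)" "\<sigma> p = \<xi>"
    using section_through[OF assms] .
  then show ?thesis by (auto simp: value_germ_def)
qed

lemma value_germ_inj:
  assumes "p \<in> Proj S D" "\<xi> \<in> carrier (loc p)" "value_germ p \<xi> = value_germ p \<eta>"
  shows "\<xi> = \<eta>"
  using value_germ_nonempty[OF assms(1,2)] assms(3) unfolding value_germ_def by auto

lemma const_section:
  assumes U: "U \<in> opens" and m: "m \<in> E 0"
  shows "(\<lambda>q\<in>U. fr q m \<one>) \<in> carrier (PS U)"
proof (rule proj_sheaf_carrierI)
  fix p assume p: "p \<in> U"
  have "\<one> \<notin> q" if "q \<in> U" for q
    using that U Proj_opens_subset Proj_prime prime_one by blast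
  then show "\<exists>V \<in> opens. p \<in> V \<and> V \<subseteq> U \<and>
     (\<exists>d. \<exists>m' \<in> E d. \<exists>g' \<in> D d. \<forall>q\<in>V. g' \<notin> q \<and>
        (\<lambda>q\<in>U. fr q m \<one>) q = fr q m' g')"
    using p m U D_one
    by (intro bexI[of _ U] conjI exI[of _ 0] bexI[of _ m] bexI[of _ \<one>]) auto
qed simp

lemma stalk_const:
  assumes p: "p \<in> Proj S D" and m: "m \<in> E 0"
    and c: "\<And>U. c U = (\<lambda>q\<in>U. fr q m \<one>)"
  shows "\<Union>{germ opens PS p U (c U) | U. U \<in> opens \<and> p \<in> U} =
    value_germ p (fr p m \<one>)"
proof -
  have "{germ opens PS p U (c U) | U. U \<in> opens \<and> p \<in> U} =
      {value_germ p (fr p m \<one>)}"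
  proof -
    have "germ opens PS p U (c U) = value_germ p (fr p m \<one>)"
      if "U \<in> opens" "p \<in> U" for U
      using germ_eq_value_germ[OF that const_section[OF that(1) m]] that unfolding c by simp
    then show ?thesis using Proj_open p by blast
  qed
  then show ?thesis by simp
qed

lemma stalk_zero:
  assumes "p \<in> Proj S D"
  shows "\<zero>\<^bsub>stalk opens PS p\<^esub> = value_germ p \<zero>\<^bsub>loc p\<^esub>"
proof -
  have "\<zero>\<^bsub>stalk opens PS p\<^esub> =
      \<Union>{germ opens PS p U \<zero>\<^bsub>PS U\<^esub> | U. U \<in> opens \<and> p \<in> U}"
    by (simp add: stalk_def)
  also have "\<dots> = value_germ p (fr p \<zero>\<^bsub>N\<^esub> \<one>)"
    by (rule stalk_const[OF assms E_zero]) (simp add: proj_sheaf_def hloc_def)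
  finally show ?thesis by (simp add: hloc_def)
qed

text \<open>A product of sections is again locally a fraction, so products of germs are computed on
  values.\<close>

lemma sheaf_smult_closed:
  assumes U: "U \<in> opens" and \<alpha>: "\<alpha> \<in> carrier (proj_structure_sheaf S D U)"
    and V: "V \<in> opens" and \<tau>: "\<tau> \<in> carrier (PS V)"
  shows "(\<lambda>q\<in>U \<inter> V. \<alpha> q \<odot>\<^bsub>loc q\<^esub> \<tau> q) \<in> carrier (PS (U \<inter> V))"
proof (rule proj_sheaf_carrierI)
  interpret reg: graded_pair S D "regular_module S" D by (rule graded_pair_regular)
  fix p assume p: "p \<in> U \<inter> V"
  then have pU: "p \<in> U" and pV: "p \<in> V" by auto
  obtain A e a b where A: "A \<in> opens" "p \<in> A" "A \<subseteq> U" "a \<in> D e" "b \<in> D e"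
    "\<forall>q\<in>A. b \<notin> q \<and> \<alpha> q = rfr q a b"
    using reg.section_local[OF \<alpha> pU] by blast
  obtain B d m g where B: "B \<in> opens" "p \<in> B" "B \<subseteq> V" "m \<in> E d" "g \<in> D d"
    "\<forall>q\<in>B. g \<notin> q \<and> \<tau> q = fr q m g"
    using section_local[OF \<tau> pV] by blast
  have "b \<otimes> g \<notin> q \<and> \<alpha> q \<odot>\<^bsub>loc q\<^esub> \<tau> q = fr q (a \<star> m) (b \<otimes> g)"
    if q: "q \<in> A \<inter> B" for q
  proof -
    have "primeideal q S" using q A Proj_opens_subset Proj_prime by blast
    then show ?thesis
      using q A B hloc_smult[of q a e b m d g] prime_mult[of q b g] by auto
  qed
  then show "\<exists>W \<in> opens. p \<in> W \<and> W \<subseteq> U \<inter> V \<and>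
      (\<exists>d. \<exists>m \<in> E d. \<exists>g \<in> D d. \<forall>q\<in>W. g \<notin> q \<and>
        (\<lambda>q\<in>U \<inter> V. \<alpha> q \<odot>\<^bsub>loc q\<^esub> \<tau> q) q = fr q m g)"
    using A B p D_mult[of b e g d] E_smult[of a e m d] Proj_opens_Int[of A B]
    by (intro bexI[of _ "A \<inter> B"] conjI exI[of _ "e + d"] bexI[of _ "a \<star> m"]
        bexI[of _ "b \<otimes> g"]) auto
qed simp

lemma germ_smult:
  assumes p: "p \<in> Proj S D"
    and \<alpha>: "\<alpha> \<in> carrier (rloc p)" and \<xi>: "\<xi> \<in> carrier (loc p)"
    and b: "\<And>U \<alpha> \<tau>. b U \<alpha> \<tau> = (\<lambda>q\<in>U. \<alpha> q \<odot>\<^bsub>loc q\<^esub> \<tau> q)"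
  shows "(\<Union>(U, \<alpha>)\<in>graded_pair.value_germ S D (regular_module S) D p \<alpha>. \<Union>(V, \<tau>)\<in>value_germ p \<xi>.
      germ opens PS p (U \<inter> V) (b (U \<inter> V) (restrict \<alpha> (U \<inter> V)) (restrict \<tau> (U \<inter> V)))) =
    value_germ p (\<alpha> \<odot>\<^bsub>loc p\<^esub> \<xi>)"
proof -
  interpret reg: graded_pair S D "regular_module S" D by (rule graded_pair_regular)
  have eq: "germ opens PS p (U \<inter> V)
      (b (U \<inter> V) (restrict \<alpha>' (U \<inter> V)) (restrict \<tau> (U \<inter> V))) =
      value_germ p (\<alpha> \<odot>\<^bsub>loc p\<^esub> \<xi>)"
    if "(U, \<alpha>') \<in> reg.value_germ p \<alpha>" "(V, \<tau>) \<in> value_germ p \<xi>" for U \<alpha>' V \<tau>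
  proof -
    have U: "U \<in> opens" "p \<in> U" "\<alpha>' \<in> carrier (proj_structure_sheaf S D U)" "\<alpha>' p = \<alpha>"
      and V: "V \<in> opens" "p \<in> V" "\<tau> \<in> carrier (PS V)" "\<tau> p = \<xi>"
      using that by (auto simp: value_germ_def reg.value_germ_def)
    have r: "b (U \<inter> V) (restrict \<alpha>' (U \<inter> V)) (restrict \<tau> (U \<inter> V)) =
        (\<lambda>q\<in>U \<inter> V. \<alpha>' q \<odot>\<^bsub>loc q\<^esub> \<tau> q)"
      unfolding b by (rule restrict_ext) simp
    show ?thesis unfolding r
      using germ_eq_value_germ[OF Proj_opens_Int[OF U(1) V(1)] _ sheaf_smult_closed[OF U(1,3) V(1,3)]]
        U V by simp
  qed
  have "(\<Union>(U, \<alpha>)\<in>reg.value_germ p \<alpha>. \<Union>(V, \<tau>)\<in>value_germ p \<xi>.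
      germ opens PS p (U \<inter> V) (b (U \<inter> V) (restrict \<alpha> (U \<inter> V)) (restrict \<tau> (U \<inter> V)))) =
    (\<Union>_\<in>reg.value_germ p \<alpha>. \<Union>_\<in>value_germ p \<xi>. value_germ p (\<alpha> \<odot>\<^bsub>loc p\<^esub> \<xi>))"
    using eq by (intro SUP_cong refl) auto
  then show ?thesis
    using reg.value_germ_nonempty[OF p \<alpha>] value_germ_nonempty[OF p \<xi>] by simp
qed

text \<open>Germs multiply like fractions, so the question is about numerators: a fraction \<open>a / b\<close> is a unit
  of the local ring when \<open>a\<close> lies outside \<open>p\<close>, the inverse being \<open>b / a\<close>, and it kills
  \<open>m / g\<close> when some homogeneous \<open>h\<close> outside \<open>p\<close> kills \<open>a m\<close>.\<close>

lemma stalk_annihilator_iff: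
  assumes p: "p \<in> Proj S D" and m: "m \<in> E d" "g \<in> D d - p"
  shows "annihilator (stalk opens (proj_structure_sheaf S D) p)
      (stalk opens PS p) (value_germ p (fr p m g)) =
      carrier (stalk opens (proj_structure_sheaf S D) p) -
      Units (stalk opens (proj_structure_sheaf S D) p) \<longleftrightarrow>
    (\<forall>e. \<forall>a\<in>D e. D e - p \<noteq> {} \<longrightarrow> ((\<exists>h\<in>Hom - p. h \<star> (a \<star> m) = \<zero>\<^bsub>N\<^esub>) \<longleftrightarrow> a \<in> p))"
proof -
  interpret reg: graded_pair S D "regular_module S" D by (rule graded_pair_regular)
  let ?O = "stalk opens (proj_structure_sheaf S D) p"
  let ?A = "stalk opens PS p"
  let ?c = "\<lambda>a b. reg.value_germ p (rfr p a b)"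
  have pp: "primeideal p S" using Proj_prime[OF p] .
  have id: "ideal p S" using pp by (rule primeideal.axioms)
  have Om: "reg.value_germ p \<alpha> \<otimes>\<^bsub>?O\<^esub> reg.value_germ p \<beta> =
      reg.value_germ p (\<alpha> \<odot>\<^bsub>rloc p\<^esub> \<beta>)"
    if "\<alpha> \<in> carrier (rloc p)"
       "\<beta> \<in> carrier (rloc p)" for \<alpha> \<beta>
  proof -
    have "monoid.mult (proj_structure_sheaf S D U) \<alpha> \<tau> =
      (\<lambda>q\<in>U. \<alpha> q \<odot>\<^bsub>rloc q\<^esub> \<tau> q)" for U \<alpha> \<tau>
      by (simp add: proj_sheaf_def hloc_def)
    from reg.germ_smult[OF p that this] show ?thesis unfolding stalk_def module.simps ring.simps monoid.simps .
  qed
  have As: "reg.value_germ p \<alpha> \<odot>\<^bsub>?A\<^esub> value_germ p \<xi> =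
      value_germ p (\<alpha> \<odot>\<^bsub>loc p\<^esub> \<xi>)"
    if "\<alpha> \<in> carrier (rloc p)" "\<xi> \<in> carrier (loc p)" for \<alpha> \<xi>
  proof -
    have "smult (PS U) \<alpha> \<tau> = (\<lambda>q\<in>U. \<alpha> q \<odot>\<^bsub>loc q\<^esub> \<tau> q)" for U \<alpha> \<tau>
      by (simp add: proj_sheaf_def)
    from germ_smult[OF p that this] show ?thesis unfolding stalk_def module.simps .
  qed
  have Oone: "\<one>\<^bsub>?O\<^esub> = ?c \<one> \<one>"
  proof -
    have "\<one>\<^bsub>?O\<^esub> = \<Union>{germ opens (proj_structure_sheaf S D) p U \<one>\<^bsub>proj_structure_sheaf S D U\<^esub> | U.
        U \<in> opens \<and> p \<in> U}"
      by (simp add: stalk_def)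
    also have "\<dots> = ?c \<one> \<one>"
      by (rule reg.stalk_const[OF p D_one]) (simp add: proj_sheaf_def hloc_def)
    finally show ?thesis .
  qed
  have Ocar: "X \<in> carrier ?O \<longleftrightarrow> (\<exists>e a b. a \<in> D e \<and> b \<in> D e - p \<and> X = ?c a b)" for X
    unfolding reg.stalk_carrier[OF p] by (force simp: hloc_def)
  have Omult: "?c a b \<otimes>\<^bsub>?O\<^esub> ?c a' b' = ?c (a \<otimes> a') (b \<otimes> b')"
    if "a \<in> D e" "b \<in> D e - p" "a' \<in> D e'" "b' \<in> D e' - p" for a b a' b' e e'
    using Om[OF reg.hloc_carrierI[OF that(1,2)] reg.hloc_carrierI[OF that(3,4)]]
      reg.hloc_smult[OF pp that] by simp
  have Oeq: "?c a b = \<one>\<^bsub>?O\<^esub> \<longleftrightarrow> (\<exists>h\<in>Hom - p. h \<otimes> (\<one> \<otimes> a) = h \<otimes> (b \<otimes> \<one>))"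
    if "a \<in> D e" "b \<in> D e - p" for a b e
  proof -
    have o: "\<one> \<in> D 0 - p" using prime_one[OF pp] D_one by blast
    have "?c a b = ?c \<one> \<one> \<longleftrightarrow> rfr p a b = rfr p \<one> \<one>"
      using reg.value_germ_inj[OF p reg.hloc_carrierI[OF that]] by metis
    then show ?thesis unfolding Oone using reg.hfrac_eq_iff[OF pp that D_one o] by simp
  qed
  have Ounit: "?c a b \<in> Units ?O \<longleftrightarrow> a \<notin> p" if ab: "a \<in> D e" "b \<in> D e - p" for a b e
  proof
    have c: "a \<in> carrier S" "b \<in> carrier S" using ab D_carrier by auto
    {
      assume a: "a \<notin> p"
      then have ba: "b \<in> D e" "a \<in> D e - p" using ab by auto
      have pr: "a \<otimes> b \<in> D (e + e) - p" "b \<otimes> a \<in> D (e + e) - p"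
        using ab ba D_mult prime_mult[OF pp, of a b] prime_mult[OF pp, of b a] by blast+
      have "?c a b \<otimes>\<^bsub>?O\<^esub> ?c b a = \<one>\<^bsub>?O\<^esub>"
        unfolding Omult[OF ab ba] Oeq[OF DiffD1[OF pr(1)] pr(2)]
        using prime_one[OF pp] c by (intro bexI[of _ \<one>]) (auto simp: m_comm)
      moreover have "?c b a \<otimes>\<^bsub>?O\<^esub> ?c a b = \<one>\<^bsub>?O\<^esub>"
        unfolding Omult[OF ba ab] Oeq[OF DiffD1[OF pr(2)] pr(1)]
        using prime_one[OF pp] c by (intro bexI[of _ \<one>]) (auto simp: m_comm)
      moreover have "?c a b \<in> carrier ?O" "?c b a \<in> carrier ?O"
        using Ocar ab ba by blast+
      ultimately show "?c a b \<in> Units ?O" unfolding Units_def by blast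
    }
    assume "?c a b \<in> Units ?O"
    then obtain X where Xc: "X \<in> carrier ?O" and X1: "?c a b \<otimes>\<^bsub>?O\<^esub> X = \<one>\<^bsub>?O\<^esub>"
      unfolding Units_def by blast
    obtain e' a' b' where X: "a' \<in> D e'" "b' \<in> D e' - p" "X = ?c a' b'"
      using iffD1[OF Ocar Xc] by blast
    have aa: "a \<otimes> a' \<in> D (e + e')" "b \<otimes> b' \<in> D (e + e') - p"
      using ab X D_mult prime_mult[OF pp, of b b'] by blast+
    obtain h where h: "h \<in> Hom - p" "h \<otimes> (\<one> \<otimes> (a \<otimes> a')) = h \<otimes> ((b \<otimes> b') \<otimes> \<one>)"
      using X1 unfolding X(3) Omult[OF ab X(1,2)] Oeq[OF aa] by blast
    have "h \<otimes> (b \<otimes> b') \<in> Hom - p" using prime_mult[OF pp h(1)] aa(2) by blast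
    moreover have "b \<otimes> b' \<in> carrier S" "a \<otimes> a' \<in> carrier S" "a' \<in> carrier S" "h \<in> carrier S"
      using aa X h D_carrier by blast+
    ultimately have "h \<otimes> (a \<otimes> a') \<notin> p" using h(2) by simp
    then show "a \<notin> p"
      using ideal.I_r_closed[OF id] ideal.I_l_closed[OF id] \<open>a' \<in> carrier S\<close> \<open>h \<in> carrier S\<close> by blast
  qed
  have Azero: "?c a b \<odot>\<^bsub>?A\<^esub> value_germ p (fr p m g) = \<zero>\<^bsub>?A\<^esub> \<longleftrightarrow>
      (\<exists>h\<in>Hom - p. h \<star> (a \<star> m) = \<zero>\<^bsub>N\<^esub>)" if ab: "a \<in> D e" "b \<in> D e - p" for a b e
  proof -
    have am: "a \<star> m \<in> E (e + d)" "b \<otimes> g \<in> D (e + d) - p"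
      using ab m E_smult D_mult prime_mult[OF pp, of b g] by blast+
    have "?c a b \<odot>\<^bsub>?A\<^esub> value_germ p (fr p m g) =
        value_germ p (fr p (a \<star> m) (b \<otimes> g))"
      using As[OF reg.hloc_carrierI[OF ab] hloc_carrierI[OF m]] hloc_smult[OF pp ab m] by simp
    then show ?thesis
      unfolding stalk_zero[OF p] hfrac_zero_iff[OF pp am, symmetric]
      using value_germ_inj[OF p hloc_carrierI[OF am]] by auto
  qed
  have "annihilator ?O ?A (value_germ p (fr p m g)) = carrier ?O - Units ?O \<longleftrightarrow>
    (\<forall>X\<in>carrier ?O. X \<odot>\<^bsub>?A\<^esub> value_germ p (fr p m g) = \<zero>\<^bsub>?A\<^esub> \<longleftrightarrow> X \<notin> Units ?O)"
    unfolding annihilator_def by blast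
  also have "\<dots> \<longleftrightarrow> (\<forall>e a b. a \<in> D e \<longrightarrow> b \<in> D e - p \<longrightarrow>
      (?c a b \<odot>\<^bsub>?A\<^esub> value_germ p (fr p m g) = \<zero>\<^bsub>?A\<^esub> \<longleftrightarrow> ?c a b \<notin> Units ?O))"
    unfolding Ball_def Ocar by blast
  also have "\<dots> \<longleftrightarrow> (\<forall>e a b. a \<in> D e \<longrightarrow> b \<in> D e - p \<longrightarrow>
      ((\<exists>h\<in>Hom - p. h \<star> (a \<star> m) = \<zero>\<^bsub>N\<^esub>) \<longleftrightarrow> a \<in> p))"
    using Azero Ounit by meson
  finally show ?thesis by blast
qed

text \<open>Every germ at \<open>p\<close> comes from a single fraction, whose numerator is the \<open>m\<close> below. The condition
  that degree \<open>e\<close> contain elements outside \<open>p\<close> says that \<open>a\<close> is the numerator of an element of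
  the local ring.\<close>

theorem associated_points_iff:
  "p \<in> associated_points (Proj S D) opens (proj_structure_sheaf S D) PS \<longleftrightarrow>
    p \<in> Proj S D \<and> (\<exists>d. \<exists>m\<in>E d. D d - p \<noteq> {} \<and> (\<forall>e. \<forall>a\<in>D e. D e - p \<noteq> {} \<longrightarrow>
      ((\<exists>h\<in>Hom - p. h \<star> (a \<star> m) = \<zero>\<^bsub>N\<^esub>) \<longleftrightarrow> a \<in> p)))"
proof (cases "p \<in> Proj S D")
  case True
  let ?Q = "\<lambda>m. \<forall>e. \<forall>a\<in>D e. D e - p \<noteq> {} \<longrightarrow>
      ((\<exists>h\<in>Hom - p. h \<star> (a \<star> m) = \<zero>\<^bsub>N\<^esub>) \<longleftrightarrow> a \<in> p)"
  let ?R = "\<lambda>x. annihilator (stalk opens (proj_structure_sheaf S D) p)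
      (stalk opens PS p) x =
      carrier (stalk opens (proj_structure_sheaf S D) p) -
      Units (stalk opens (proj_structure_sheaf S D) p)"
  have "(\<exists>x\<in>carrier (stalk opens PS p). ?R x) \<longleftrightarrow>
      (\<exists>d m g. m \<in> E d \<and> g \<in> D d - p \<and> ?R (value_germ p (fr p m g)))"
    unfolding stalk_carrier[OF True] by (auto simp: hloc_def)
  also have "\<dots> \<longleftrightarrow> (\<exists>d m g. m \<in> E d \<and> g \<in> D d - p \<and> ?Q m)"
    using stalk_annihilator_iff[OF True] by (intro ex_cong1) blast
  also have "\<dots> \<longleftrightarrow> (\<exists>d. \<exists>m\<in>E d. D d - p \<noteq> {} \<and> ?Q m)"
    by blast
  finally show ?thesis using True by (simp add: associated_points_def)
qed (simp add: associated_points_def)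

end

section \<open>Ascending chains of families of submodules\<close>

lemmas ideal_zero = additive_subgroup.zero_closed[OF ideal.axioms(1)]
lemmas ideal_add = additive_subgroup.a_closed[OF ideal.axioms(1)]
lemmas ideal_neg = additive_subgroup.a_inv_closed[OF ideal.axioms(1)]

lemma (in cring) ideal_if_closed:
  assumes "J \<subseteq> carrier R" "J \<noteq> {}" "\<And>a b. \<lbrakk>a \<in> J; b \<in> J\<rbrakk> \<Longrightarrow> a \<oplus> b \<in> J"
    and l: "\<And>a r. \<lbrakk>a \<in> J; r \<in> carrier R\<rbrakk> \<Longrightarrow> r \<otimes> a \<in> J"
  shows "ideal J R"
proof (rule idealI)
  show "ring R" ..
  show "subgroup J (add_monoid R)"
  proof (rule add.subgroupI[OF assms(1,2) _ assms(3)])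
    fix a assume a: "a \<in> J"
    then have "\<ominus> a = (\<ominus> \<one>) \<otimes> a" using assms(1) l_minus[of \<one> a] by auto
    then show "\<ominus> a \<in> J" using l[OF a, of "\<ominus> \<one>"] by simp
  qed
  fix a r assume "a \<in> J" "r \<in> carrier R"
  then show "r \<otimes> a \<in> J" "a \<otimes> r \<in> J" using l assms(1) m_comm by (metis, metis subsetD)
qed

context module
begin

abbreviation scalar_mult :: "'a \<Rightarrow> 'c \<Rightarrow> 'c" (infixl \<open>\<star>\<close> 70) where "a \<star> x \<equiv> a \<odot>\<^bsub>M\<^esub> x"
abbreviation vector_add :: "'c \<Rightarrow> 'c \<Rightarrow> 'c" (infixl \<open>\<boxplus>\<close> 65) where "x \<boxplus> y \<equiv> x \<oplus>\<^bsub>M\<^esub> y"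

text \<open>With \<open>K n\<close> contained in \<open>I\<^sup>n M\<close> and \<open>H = I\<close> this is a graded submodule of the Rees module
  \<open>\<Oplus>\<^sub>n I\<^sup>n M\<close>, recorded by its components. A set \<open>H\<close> of generators in place of \<open>I\<close> makes induction
  on the generators possible.\<close>

definition closed_family :: "'a set \<Rightarrow> (nat \<Rightarrow> 'c set) \<Rightarrow> bool" where
  "closed_family H K \<longleftrightarrow>
    (\<forall>n. submodule (K n) R M) \<and> (\<forall>n. \<forall>h\<in>H. \<forall>x\<in>K n. h \<star> x \<in> K (Suc n))"

definition acc_submodules :: "'c set \<Rightarrow> bool" where
  "acc_submodules A \<longleftrightarrow> (\<forall>C::nat \<Rightarrow> 'c set. mono C \<longrightarrow> (\<forall>i. submodule (C i) R M \<and> C i \<subseteq> A) \<longrightarrow>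
     (\<exists>i0. \<forall>i\<ge>i0. C i = C i0))"

definition acc_families :: "'a set \<Rightarrow> (nat \<Rightarrow> 'c set) \<Rightarrow> bool" where
  "acc_families H A \<longleftrightarrow> (\<forall>C::nat \<Rightarrow> nat \<Rightarrow> 'c set. mono C \<longrightarrow>
     (\<forall>i. closed_family H (C i) \<and> C i \<le> A) \<longrightarrow> (\<exists>i0. \<forall>i\<ge>i0. C i = C i0))"

lemma closed_familyD:
  assumes "closed_family H K"
  shows "submodule (K n) R M" "\<lbrakk>h \<in> H; x \<in> K n\<rbrakk> \<Longrightarrow> h \<star> x \<in> K (Suc n)"
  using assms by (auto simp: closed_family_def)

lemma submodule_zero: "submodule H R M \<Longrightarrow> \<zero>\<^bsub>M\<^esub> \<in> H"
  using subgroup.one_closed[of H "add_monoid M"] by (simp add: submodule_def)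

lemma submodule_carrier: "\<lbrakk>submodule H R M; x \<in> H\<rbrakk> \<Longrightarrow> x \<in> carrier M"
  using submoduleE(1) by blast

lemma submodule_minus:
  "\<lbrakk>submodule H R M; x \<in> H; y \<in> H\<rbrakk> \<Longrightarrow> x \<ominus>\<^bsub>M\<^esub> y \<in> H"
  unfolding a_minus_def using submoduleE(3,5) by blast

lemma submodule_Int: "\<lbrakk>submodule H R M; submodule K R M\<rbrakk> \<Longrightarrow> submodule (H \<inter> K) R M"
  by (rule submoduleI) (use submoduleE submodule_zero in auto)

lemma zero_submodule: "submodule {\<zero>\<^bsub>M\<^esub>} R M"
  by (rule submoduleI) auto

lemma sum_submodule:
  assumes K: "submodule K R M" and L: "submodule L R M"
  shows "submodule (K <+>\<^bsub>M\<^esub> L) R M"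
proof (rule submoduleI)
  note KE = submoduleE[OF K] and LE = submoduleE[OF L]
  show "K <+>\<^bsub>M\<^esub> L \<subseteq> carrier M" using KE(1) LE(1) by (auto simp: set_add_def')
  show "\<zero>\<^bsub>M\<^esub> \<in> K <+>\<^bsub>M\<^esub> L"
    using submodule_zero[OF K] submodule_zero[OF L] by (force simp: set_add_def')
  fix x assume "x \<in> K <+>\<^bsub>M\<^esub> L"
  then obtain k l where x: "k \<in> K" "l \<in> L" "x = k \<boxplus> l" by (auto simp: set_add_def')
  have c: "k \<in> carrier M" "l \<in> carrier M" using x KE(1) LE(1) by blast+
  show "\<ominus>\<^bsub>M\<^esub> x \<in> K <+>\<^bsub>M\<^esub> L"
    using KE(3)[OF x(1)] LE(3)[OF x(2)] c by (auto simp: x(3) set_add_def' M.minus_add)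
  show "a \<star> x \<in> K <+>\<^bsub>M\<^esub> L" if "a \<in> carrier R" for a
    using KE(4)[OF that x(1)] LE(4)[OF that x(2)] that c by (auto simp: x(3) set_add_def' smult_r_distr)
  fix y assume "y \<in> K <+>\<^bsub>M\<^esub> L"
  then obtain k' l' where y: "k' \<in> K" "l' \<in> L" "y = k' \<boxplus> l'" by (auto simp: set_add_def')
  have "k' \<in> carrier M" "l' \<in> carrier M" using y KE(1) LE(1) by blast+
  then have "x \<boxplus> y = (k \<boxplus> k') \<boxplus> (l \<boxplus> l')"
    using c by (simp add: x(3) y(3) M.a_ac)
  then show "x \<boxplus> y \<in> K <+>\<^bsub>M\<^esub> L"
    using KE(5)[OF x(1) y(1)] LE(5)[OF x(2) y(2)] by (auto simp: set_add_def')
qed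

lemma smult_vimage_submodule:
  assumes N: "submodule N R M" and a: "a \<in> carrier R"
  shows "submodule {x \<in> carrier M. a \<star> x \<in> N} R M"
proof (rule submoduleI)
  fix b x assume b: "b \<in> carrier R" and x: "x \<in> {x \<in> carrier M. a \<star> x \<in> N}"
  have "a \<star> (b \<star> x) = b \<star> (a \<star> x)"
    using a b x by (simp add: smult_assoc1[symmetric] m_comm)
  then show "b \<star> x \<in> {x \<in> carrier M. a \<star> x \<in> N}"
    using b x submoduleE(4)[OF N] by auto
qed (use a submodule_zero[OF N] submoduleE[OF N] in \<open>auto simp: smult_r_distr smult_r_minus\<close>)

lemma smult_image_submodule:
  assumes N: "submodule N R M" and a: "a \<in> carrier R"
  shows "submodule ((\<lambda>x. a \<star> x) ` N) R M"
proof (rule submoduleI)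
  note NE = submoduleE[OF N]
  have c: "x \<in> N \<Longrightarrow> x \<in> carrier M" for x using NE(1) by blast
  show "(\<lambda>x. a \<star> x) ` N \<subseteq> carrier M" using c a by auto
  show "\<zero>\<^bsub>M\<^esub> \<in> (\<lambda>x. a \<star> x) ` N"
    by (rule image_eqI[OF _ submodule_zero[OF N]]) (simp add: a)
  fix y assume "y \<in> (\<lambda>x. a \<star> x) ` N"
  then obtain x where x: "x \<in> N" "y = a \<star> x" by blast
  show "\<ominus>\<^bsub>M\<^esub> y \<in> (\<lambda>x. a \<star> x) ` N"
    by (rule image_eqI[OF _ NE(3)[OF x(1)]]) (simp add: x c a smult_r_minus)
  show "b \<star> y \<in> (\<lambda>x. a \<star> x) ` N" if "b \<in> carrier R" for b
    by (rule image_eqI[OF _ NE(4)[OF that x(1)]])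
      (simp add: x c a that smult_assoc1[symmetric] m_comm)
  fix y' assume "y' \<in> (\<lambda>x. a \<star> x) ` N"
  then obtain x' where x': "x' \<in> N" "y' = a \<star> x'" by blast
  show "y \<boxplus> y' \<in> (\<lambda>x. a \<star> x) ` N"
    by (rule image_eqI[OF _ NE(5)[OF x(1) x'(1)]]) (simp add: x x' c a smult_r_distr)
qed

lemma principal_submodule:
  assumes m: "m \<in> carrier M"
  shows "submodule ((\<lambda>a. a \<star> m) ` carrier R) R M"
proof (rule submoduleI)
  show "\<zero>\<^bsub>M\<^esub> \<in> (\<lambda>a. a \<star> m) ` carrier R" by (rule image_eqI[of _ _ \<zero>]) (simp_all add: m)
qed (use m in \<open>auto simp flip: smult_l_minus smult_l_distr smult_assoc1\<close>)

lemma smult_into_ideal: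
  assumes N: "submodule N R M" and m: "m \<in> carrier M"
  shows "ideal {a \<in> carrier R. a \<star> m \<in> N} R"
proof (rule R.ideal_if_closed)
  note NE = submoduleE[OF N]
  have "\<zero> \<in> {a \<in> carrier R. a \<star> m \<in> N}" using m submodule_zero[OF N] by simp
  then show "{a \<in> carrier R. a \<star> m \<in> N} \<noteq> {}" by blast
qed (use m submoduleE[OF N] in \<open>auto simp: smult_l_distr smult_assoc1\<close>)

lemma minus_cancel_left:
  assumes "z \<in> carrier M" "w \<in> carrier M" "w' \<in> carrier M"
  shows "(z \<boxplus> w') \<boxplus> w \<ominus>\<^bsub>M\<^esub> z = w' \<boxplus> w"
proof -
  have "(z \<boxplus> w') \<boxplus> w \<ominus>\<^bsub>M\<^esub> z = (w' \<boxplus> w) \<boxplus> (z \<ominus>\<^bsub>M\<^esub> z)"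
    using assms by (simp add: a_minus_def M.a_ac)
  then show ?thesis using assms by (simp add: a_minus_def M.r_neg)
qed

lemma add_minus_cancel:
  assumes "z \<in> carrier M" "y \<in> carrier M"
  shows "z \<boxplus> (y \<ominus>\<^bsub>M\<^esub> z) = y"
proof -
  have "z \<boxplus> (y \<ominus>\<^bsub>M\<^esub> z) = y \<boxplus> (z \<ominus>\<^bsub>M\<^esub> z)"
    using assms by (simp add: a_minus_def M.a_ac)
  then show ?thesis using assms by (simp add: a_minus_def M.r_neg)
qed

text \<open>Within a chain, a submodule \<open>K\<close> of \<open>R m + N\<close> is determined by \<open>K \<inter> N\<close> and by the ideal of all \<open>a\<close>
  with \<open>a m \<in> K + N\<close>, and both become stationary.\<close>

lemma acc_insert_generator:
  assumes noeth: "noetherian_ring R" and m: "m \<in> carrier M"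
    and N: "submodule N R M" and acc: "acc_submodules N"
  obtains N' where "submodule N' R M" "m \<in> N'" "N \<subseteq> N'" "acc_submodules N'"
proof
  let ?N' = "(\<lambda>a. a \<star> m) ` carrier R <+>\<^bsub>M\<^esub> N"
  note NE = submoduleE[OF N] and N0 = submodule_zero[OF N]
  show "submodule ?N' R M" by (rule sum_submodule[OF principal_submodule[OF m] N])
  have "\<one> \<star> m \<boxplus> \<zero>\<^bsub>M\<^esub> \<in> ?N'" using N0 unfolding set_add_def' by blast
  then show "m \<in> ?N'" using m by simp
  have "\<zero> \<star> m \<boxplus> y \<in> ?N'" if "y \<in> N" for y using that unfolding set_add_def' by blast
  moreover have "\<zero> \<star> m \<boxplus> y = y" if "y \<in> N" for y using that m NE(1) by auto
  ultimately show "N \<subseteq> ?N'" by auto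
  show "acc_submodules ?N'"
    unfolding acc_submodules_def
  proof (intro allI impI)
    fix C :: "nat \<Rightarrow> 'c set"
    assume C: "mono C" and CN: "\<forall>i. submodule (C i) R M \<and> C i \<subseteq> ?N'"
    define L where "L i = {a \<in> carrier R. a \<star> m \<in> C i <+>\<^bsub>M\<^esub> N}" for i
    have L: "ideal (L i) R" for i
      unfolding L_def using CN N m by (intro smult_into_ideal sum_submodule) blast+
    have LC: "C i \<subseteq> C j \<Longrightarrow> L i \<subseteq> L j" for i j unfolding L_def set_add_def' by blast
    have "subset.chain {J. ideal J R} (range L)"
      unfolding subset_chain_def
    proof (intro conjI ballI)
      fix X Y assume "X \<in> range L" "Y \<in> range L"
      then obtain i j where "X = L i" "Y = L j" by blast
      then show "X \<subseteq> Y \<or> Y \<subseteq> X"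
        using LC monoD[OF C, of i j] monoD[OF C, of j i] by (metis linear)
    qed (use L in auto)
    then have "\<Union>(range L) \<in> range L"
      by (intro noetherian_ring.ideal_chain_is_trivial[OF noeth]) auto
    then obtain i1 where i1: "\<Union>(range L) = L i1" by blast
    have "mono (\<lambda>i. C i \<inter> N)" using C unfolding mono_def by blast
    moreover have "submodule (C i \<inter> N) R M \<and> C i \<inter> N \<subseteq> N" for i
      using submodule_Int[OF _ N] CN by blast
    ultimately obtain i2 where i2: "\<forall>i\<ge>i2. C i \<inter> N = C i2 \<inter> N"
      using acc[unfolded acc_submodules_def, rule_format, of "\<lambda>i. C i \<inter> N"] by blast
    define i0 where "i0 = max i1 i2"
    have "C i \<subseteq> C i0" if i: "i \<ge> i0" for i
    proof
      fix x assume x: "x \<in> C i"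
      have si: "submodule (C i) R M" and s0: "submodule (C i0) R M" using CN by blast+
      have xc: "x \<in> carrier M" using x submodule_carrier[OF si] by blast
      obtain a y where y: "x = a \<star> m \<boxplus> y" "a \<in> carrier R" "y \<in> N" using x CN unfolding set_add_def' by blast
      have yc: "y \<in> carrier M" using y NE(1) by blast
      have "a \<star> m = x \<boxplus> (\<ominus>\<^bsub>M\<^esub> y)" using y yc m by (simp add: M.a_assoc M.r_neg)
      then have "a \<in> L i" unfolding L_def set_add_def' using x y NE(3) by auto
      then have "a \<in> L i0" using i1 LC[OF monoD[OF C, of i1 i0]] unfolding i0_def by auto
      then obtain z w where z: "z \<in> C i0" "w \<in> N" "a \<star> m = z \<boxplus> w"
        by (auto simp: L_def set_add_def')
      have zc: "z \<in> carrier M" "w \<in> carrier M" using z NE(1) submodule_carrier[OF s0] by blast+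
      have "z \<in> C i" using z(1) monoD[OF C i] by blast
      then have "x \<ominus>\<^bsub>M\<^esub> z \<in> C i" using x submodule_minus[OF si] by blast
      moreover have "x \<ominus>\<^bsub>M\<^esub> z = w \<boxplus> y"
        unfolding y(1) z(3) using zc yc by (intro minus_cancel_left)
      moreover have "w \<boxplus> y \<in> N" using y z NE(5) by blast
      ultimately have "x \<ominus>\<^bsub>M\<^esub> z \<in> C i \<inter> N" by simp
      moreover have "C i \<inter> N = C i0 \<inter> N"
        using i2[rule_format, of i] i2[rule_format, of i0] i unfolding i0_def by simp
      ultimately have "x \<ominus>\<^bsub>M\<^esub> z \<in> C i0" by blast
      then have "z \<boxplus> (x \<ominus>\<^bsub>M\<^esub> z) \<in> C i0" using z(1) submoduleE(5)[OF s0] by blast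
      then show "x \<in> C i0" using add_minus_cancel[OF zc(1) xc] by simp
    qed
    then have "\<forall>i\<ge>i0. C i = C i0" using monoD[OF C] by blast
    then show "\<exists>i0. \<forall>i\<ge>i0. C i = C i0" by blast
  qed
qed

lemma acc_carrier:
  assumes noeth: "noetherian_ring R" and fg: "finitely_generated_module R M"
  shows "acc_submodules (carrier M)"
proof -
  have ex: "\<exists>N. submodule N R M \<and> A \<subseteq> N \<and> acc_submodules N"
    if "finite A" "A \<subseteq> carrier M" for A
    using that
  proof (induction A rule: finite_induct)
    case empty
    have "acc_submodules {\<zero>\<^bsub>M\<^esub>}"
      unfolding acc_submodules_def
    proof (intro allI impI)
      fix C :: "nat \<Rightarrow> 'c set"
      assume "\<forall>i. submodule (C i) R M \<and> C i \<subseteq> {\<zero>\<^bsub>M\<^esub>}"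
      then have "C i = {\<zero>\<^bsub>M\<^esub>}" for i using submodule_zero[of "C i"] by blast
      then show "\<exists>i0. \<forall>i\<ge>i0. C i = C i0" by simp
    qed
    then show ?case using zero_submodule by blast
  next
    case (insert m A)
    then obtain N where N: "submodule N R M" "A \<subseteq> N" "acc_submodules N" by blast
    obtain N' where "submodule N' R M" "m \<in> N'" "N \<subseteq> N'" "acc_submodules N'"
      using acc_insert_generator[OF noeth _ N(1,3), of m] insert.prems by blast
    then show ?case using N(2) by blast
  qed
  obtain A where A: "finite A" "A \<subseteq> carrier M" "module_span R M A = carrier M"
    using fg unfolding finitely_generated_module_def by blast
  obtain N where N: "submodule N R M" "A \<subseteq> N" "acc_submodules N" using ex[OF A(1,2)] by blast
  have "carrier M \<subseteq> N" using A(3) N(1,2) unfolding module_span_def by blast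
  then have "N = carrier M" using submoduleE(1)[OF N(1)] by blast
  then show ?thesis using N(3) by simp
qed

text \<open>The sum of the \<open>h^j N (n - j)\<close> over \<open>j < k\<close>: the elements of degree \<open>n\<close> that are of degree
  less than \<open>k\<close> as polynomials in \<open>h\<close>.\<close>

primrec power_filtration :: "'a \<Rightarrow> (nat \<Rightarrow> 'c set) \<Rightarrow> nat \<Rightarrow> nat \<Rightarrow> 'c set" where
  "power_filtration h N 0 n = {\<zero>\<^bsub>M\<^esub>}"
| "power_filtration h N (Suc k) n =
    {(h [^] k) \<star> x \<boxplus> w | x w. x \<in> N (n - k) \<and> w \<in> power_filtration h N k n}"

context
  fixes h :: 'a and H :: "'a set" and N :: "nat \<Rightarrow> 'c set"
  assumes h: "h \<in> carrier R" and H: "H \<subseteq> carrier R" and N: "closed_family H N"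
begin

lemma N_carrier: "x \<in> N n \<Longrightarrow> x \<in> carrier M"
  using submodule_carrier closed_familyD(1)[OF N] by blast

abbreviation "W \<equiv> power_filtration h N"

lemma power_filtration_submodule: "submodule (W k n) R M"
proof (induction k)
  case 0 show ?case using zero_submodule by simp
next
  case (Suc k)
  have "W (Suc k) n =
      (\<lambda>x. (h [^] k) \<star> x) ` N (n - k) <+>\<^bsub>M\<^esub> W k n"
    by (auto simp: set_add_def')
  then show ?case
    using sum_submodule[OF smult_image_submodule[OF closed_familyD(1)[OF N]] Suc] h by simp
qed

lemma power_filtration_carrier: "x \<in> W k n \<Longrightarrow> x \<in> carrier M"
  using submodule_carrier power_filtration_submodule by blast

lemma power_filtration_Suc_mono: "W k n \<subseteq> W (Suc k) n"
proof
  fix w assume w: "w \<in> W k n"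
  have "w = (h [^] k) \<star> \<zero>\<^bsub>M\<^esub> \<boxplus> w" using h power_filtration_carrier[OF w] by simp
  moreover have "\<zero>\<^bsub>M\<^esub> \<in> N (n - k)"
    using submodule_zero closed_familyD(1)[OF N] by blast
  ultimately show "w \<in> W (Suc k) n" using w by auto
qed

lemma power_filtration_smult:
  assumes g: "g \<in> H"
  shows "\<lbrakk>k \<le> Suc n; x \<in> W k n\<rbrakk> \<Longrightarrow> g \<star> x \<in> W k (Suc n)"
proof (induction k arbitrary: x)
  case 0 then show ?case using g H by auto
next
  case (Suc k)
  have gc: "g \<in> carrier R" using g H by blast
  obtain u w where x: "x = (h [^] k) \<star> u \<boxplus> w" "u \<in> N (n - k)"
    "w \<in> W k n" using Suc.prems by auto
  have "u \<in> carrier M" "w \<in> carrier M" using x N_carrier power_filtration_carrier by blast+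
  then have "g \<star> x = (h [^] k) \<star> (g \<star> u) \<boxplus> (g \<star> w)"
    using x h gc by (simp add: smult_r_distr smult_assoc1[symmetric] m_comm)
  moreover have "g \<star> u \<in> N (Suc n - k)"
    using closed_familyD(2)[OF N g x(2)] Suc.prems(1) by (simp add: Suc_diff_le)
  moreover have "g \<star> w \<in> W k (Suc n)"
    using Suc.IH[of w] Suc.prems(1) x(3) by simp
  ultimately show ?case by auto
qed

lemma power_filtration_shift:
  "\<lbrakk>k \<le> Suc n; x \<in> W k n\<rbrakk> \<Longrightarrow>
    h \<star> x \<in> W (Suc k) (Suc n)"
proof (induction k arbitrary: x)
  case 0
  then have "h \<star> x = \<zero>\<^bsub>M\<^esub>" using h by simp
  then show ?case using submodule_zero[OF power_filtration_submodule] by metis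
next
  case (Suc k)
  obtain u w where x: "x = (h [^] k) \<star> u \<boxplus> w" "u \<in> N (n - k)"
    "w \<in> W k n" using Suc.prems by auto
  have "u \<in> carrier M" "w \<in> carrier M" using x N_carrier power_filtration_carrier by blast+
  then have "h \<star> x = (h [^] Suc k) \<star> u \<boxplus> (h \<star> w)"
    using x h by (simp add: smult_r_distr smult_assoc1[symmetric] m_comm)
  moreover have "u \<in> N (Suc n - Suc k)" using x(2) by simp
  moreover have "h \<star> w \<in> W (Suc k) (Suc n)"
    using Suc.IH[of w] Suc.prems(1) x(3) by simp
  ultimately show ?case by (subst power_filtration.simps(2)) blast
qed

text \<open>The coefficients of \<open>h^k\<close> in those elements of \<open>K\<close> that have degree at most \<open>k\<close> in \<open>h\<close>: the
  leading coefficient modules in Hilbert's proof of the basis theorem.\<close>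

definition leading :: "nat \<Rightarrow> (nat \<Rightarrow> 'c set) \<Rightarrow> nat \<Rightarrow> 'c set" where
  "leading k K n = {x \<in> N n. (h [^] k) \<star> x \<in> K (n + k) <+>\<^bsub>M\<^esub> W k (n + k)}"

lemma leading_iff:
  "x \<in> leading k K n \<longleftrightarrow> x \<in> N n \<and>
    (\<exists>z\<in>K (n + k). \<exists>w\<in>W k (n + k). (h [^] k) \<star> x = z \<boxplus> w)"
  by (auto simp: leading_def set_add_def')

lemma leading_closed_family:
  assumes K: "closed_family (insert h H) K"
  shows "closed_family H (leading k K)"
  unfolding closed_family_def
proof (intro conjI allI ballI)
  have hk: "h [^] k \<in> carrier R" using h by simp
  show "submodule (leading k K n) R M" for n
  proof -
    have "leading k K n = N n \<inter>
        {x \<in> carrier M. (h [^] k) \<star> x \<in> K (n + k) <+>\<^bsub>M\<^esub> W k (n + k)}"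
      using N_carrier by (auto simp: leading_def)
    then show ?thesis
      using submodule_Int[OF closed_familyD(1)[OF N] smult_vimage_submodule[OF
          sum_submodule[OF closed_familyD(1)[OF K] power_filtration_submodule] hk]] by simp
  qed
  fix n g x assume g: "g \<in> H" and "x \<in> leading k K n"
  then obtain z w where x: "x \<in> N n" "z \<in> K (n + k)" "w \<in> W k (n + k)"
    "(h [^] k) \<star> x = z \<boxplus> w" by (auto simp: leading_iff)
  have gc: "g \<in> carrier R" using g H by blast
  have c: "x \<in> carrier M" "z \<in> carrier M" "w \<in> carrier M"
    using x N_carrier power_filtration_carrier submodule_carrier[OF closed_familyD(1)[OF K]]
    by blast+
  have "(h [^] k) \<star> (g \<star> x) = g \<star> ((h [^] k) \<star> x)"
    using c gc hk by (simp add: smult_assoc1[symmetric] m_comm)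
  also have "\<dots> = g \<star> z \<boxplus> g \<star> w"
    unfolding x(4) using c gc by (simp add: smult_r_distr)
  finally have "(h [^] k) \<star> (g \<star> x) = g \<star> z \<boxplus> g \<star> w" .
  moreover have "g \<star> x \<in> N (Suc n)" using closed_familyD(2)[OF N g x(1)] .
  moreover have "g \<star> z \<in> K (Suc n + k)" using closed_familyD(2)[OF K _ x(2), of g] g by simp
  moreover have "g \<star> w \<in> W k (Suc n + k)"
    using power_filtration_smult[OF g _ x(3)] by simp
  ultimately show "g \<star> x \<in> leading k K (Suc n)" unfolding leading_iff by blast
qed

lemma leading_mono: "K \<le> K' \<Longrightarrow> leading k K \<le> leading k K'"
  unfolding leading_def set_add_def' le_fun_def by blast

lemma leading_Suc:
  assumes K: "closed_family (insert h H) K"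
  shows "leading k K \<le> leading (Suc k) K"
proof (rule le_funI, rule subsetI)
  fix n x assume "x \<in> leading k K n"
  then obtain z w where x: "x \<in> N n" "z \<in> K (n + k)" "w \<in> W k (n + k)"
    "(h [^] k) \<star> x = z \<boxplus> w" by (auto simp: leading_iff)
  have c: "x \<in> carrier M" "z \<in> carrier M" "w \<in> carrier M"
    using x N_carrier power_filtration_carrier submodule_carrier[OF closed_familyD(1)[OF K]]
    by blast+
  have "(h [^] Suc k) \<star> x = h \<star> ((h [^] k) \<star> x)"
    using c h by (simp add: smult_assoc1[symmetric] m_comm)
  also have "\<dots> = h \<star> z \<boxplus> h \<star> w"
    unfolding x(4) using c h by (simp add: smult_r_distr)
  finally have "(h [^] Suc k) \<star> x = h \<star> z \<boxplus> h \<star> w" .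
  moreover have "h \<star> z \<in> K (n + Suc k)" using closed_familyD(2)[OF K _ x(2), of h] by simp
  moreover have "h \<star> w \<in> W (Suc k) (n + Suc k)"
    using power_filtration_shift[OF _ x(3)] by simp
  ultimately show "x \<in> leading (Suc k) K n" using x(1) unfolding leading_iff by blast
qed

text \<open>Induction on the degree in \<open>h\<close>: subtracting from an element of \<open>K'\<close> an element of \<open>K\<close> with the
  same leading coefficient lowers the degree.\<close>

lemma leading_le_imp_le:
  assumes K: "closed_family (insert h H) K" and K': "closed_family (insert h H) K'"
    and le: "K \<le> K'" and K'N: "\<And>n. K' n \<subseteq> W (Suc n) n"
    and lead: "\<And>k. leading k K' \<le> leading k K"
  shows "K' \<le> K"
proof (rule le_funI)
  fix n
  note K'E = submoduleE[OF closed_familyD(1)[OF K', of n]]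
    and KE = submoduleE[OF closed_familyD(1)[OF K, of n]]
  have "k \<le> Suc n \<Longrightarrow> K' n \<inter> W k n \<subseteq> K n" for k
  proof (induction k)
    case 0 then show ?case using submodule_zero[OF closed_familyD(1)[OF K]] by auto
  next
    case (Suc k)
    note FE = submoduleE[OF power_filtration_submodule[of k n]]
    show ?case
    proof
      fix y assume y: "y \<in> K' n \<inter> W (Suc k) n"
      then obtain x w where x: "x \<in> N (n - k)" "w \<in> W k n"
        "y = (h [^] k) \<star> x \<boxplus> w" by auto
      have c: "x \<in> carrier M" "w \<in> carrier M" "y \<in> carrier M"
        using x y N_carrier power_filtration_carrier K'E(1) by blast+
      have kn: "n - k + k = n" using Suc.prems by simp
      have "(h [^] k) \<star> x = y \<boxplus> (\<ominus>\<^bsub>M\<^esub> w)"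
        unfolding x(3) using c h by (simp add: M.a_assoc M.r_neg)
      moreover have "\<ominus>\<^bsub>M\<^esub> w \<in> W k n" using x FE(3) by blast
      ultimately have "x \<in> leading k K' (n - k)"
        using x y unfolding leading_iff kn by blast
      then have "x \<in> leading k K (n - k)" using lead unfolding le_fun_def by blast
      then obtain z w' where z: "z \<in> K n" "w' \<in> W k n"
          "(h [^] k) \<star> x = z \<boxplus> w'"
        unfolding leading_iff kn by blast
      have zc: "z \<in> carrier M" "w' \<in> carrier M" using z KE(1) FE(1) by blast+
      have eq: "y \<ominus>\<^bsub>M\<^esub> z = w' \<boxplus> w"
        unfolding x(3) z(3) using zc c by (intro minus_cancel_left)
      have "z \<in> K' n" using z(1) le unfolding le_fun_def by blast
      then have "y \<ominus>\<^bsub>M\<^esub> z \<in> K' n" using y submodule_minus[OF closed_familyD(1)[OF K']] by blast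
      moreover have "w' \<boxplus> w \<in> W k n" using z x FE(5) by blast
      ultimately have "y \<ominus>\<^bsub>M\<^esub> z \<in> K n" using Suc eq by auto
      then have "z \<boxplus> (y \<ominus>\<^bsub>M\<^esub> z) \<in> K n" using z(1) KE(5) by blast
      then show "y \<in> K n" using add_minus_cancel[OF zc(1) c(3)] by simp
    qed
  qed
  from this[of "Suc n"] show "K' n \<subseteq> K n" using K'N by blast
qed

text \<open>The induction step of the basis theorem. For a chain \<open>C\<close>, the leading coefficient families
  increase both in the degree \<open>k\<close> and in the index \<open>i\<close>, so the diagonal family stabilizes and
  bounds all large \<open>k\<close> at once; the finitely many smaller \<open>k\<close> are treated one by one.\<close>

lemma acc_families_insert:
  assumes acc: "acc_families H N"
  shows "acc_families (insert h H) (\<lambda>n. W (Suc n) n)"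
  unfolding acc_families_def
proof (intro allI impI)
  fix C :: "nat \<Rightarrow> nat \<Rightarrow> 'c set"
  assume C: "mono C" and "\<forall>i. closed_family (insert h H) (C i) \<and> C i \<le> (\<lambda>n. W (Suc n) n)"
  then have CK: "\<And>i. closed_family (insert h H) (C i)"
    and CF: "\<And>i n. C i n \<subseteq> W (Suc n) n"
    by (auto simp: le_fun_def)
  have mono1: "leading k (C i) \<le> leading k' (C i)" if "k \<le> k'" for k k' i
    using that by (induction rule: dec_induct) (use leading_Suc[OF CK] in \<open>auto intro: order_trans\<close>)
  have mono2: "leading k (C i) \<le> leading k (C j)" if "i \<le> j" for k i j
    using that C leading_mono monoD by blast
  have chain: "\<exists>i0. \<forall>i\<ge>i0. L i = L i0"
    if L: "mono L" "\<And>i. \<exists>k j. L i = leading k (C j)" for L :: "nat \<Rightarrow> nat \<Rightarrow> 'c set"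
  proof -
    have "closed_family H (L i) \<and> L i \<le> N" for i
    proof -
      obtain k j where "L i = leading k (C j)" using L(2) by blast
      then show ?thesis
        using leading_closed_family[OF CK] by (auto simp: le_fun_def leading_def)
    qed
    then have "\<forall>i. closed_family H (L i) \<and> L i \<le> N" by blast
    then show ?thesis
      using acc[unfolded acc_families_def, THEN spec, THEN mp, OF L(1)] by (rule rev_mp)
  qed
  have "mono (\<lambda>i. leading i (C i))"
    using mono1 mono2 by (intro monoI) (meson order_trans)
  then obtain d where d: "\<And>i. i \<ge> d \<Longrightarrow> leading i (C i) = leading d (C d)"
    using chain[of "\<lambda>i. leading i (C i)"] by blast
  have "\<exists>j. \<forall>i\<ge>j. leading k (C i) = leading k (C j)" for k
    by (rule chain) (use mono2 in \<open>auto intro: monoI\<close>)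
  then obtain J where J: "\<And>k i. i \<ge> J k \<Longrightarrow> leading k (C i) = leading k (C (J k))" by metis
  define i0 where "i0 = Max (insert d (J ` {..<d}))"
  have i0: "d \<le> i0" "\<And>k. k < d \<Longrightarrow> J k \<le> i0" unfolding i0_def by auto
  have "C i = C i0" if i: "i \<ge> i0" for i
  proof (rule antisym)
    show "C i0 \<le> C i" using C i by (rule monoD)
    show "C i \<le> C i0"
    proof (rule leading_le_imp_le[OF CK CK \<open>C i0 \<le> C i\<close> CF])
      fix k
      show "leading k (C i) \<le> leading k (C i0)"
      proof (cases "k < d")
        case True
        then show ?thesis using J[of k i] J[of k i0] i0(2)[of k] i by auto
      next
        case False
        have "leading k (C i) \<le> leading (max k i) (C (max k i))"
          using mono1[of k "max k i" i] mono2[of i "max k i" "max k i"] by (meson max.cobounded1 max.cobounded2 order_trans)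
        also have "\<dots> = leading d (C d)" using False by (intro d) auto
        also have "\<dots> \<le> leading k (C i0)"
          using mono1[of d k d] mono2[of d i0 k] False i0(1) by (meson leI order_trans)
        finally show ?thesis .
      qed
    qed
  qed
  then show "\<exists>i0. \<forall>i\<ge>i0. C i = C i0" by blast
qed

lemma power_filtration_closed_family:
  "closed_family (insert h H) (\<lambda>n. W (Suc n) n)"
  unfolding closed_family_def
proof (intro conjI allI ballI)
  fix n g x assume g: "g \<in> insert h H" and x: "x \<in> W (Suc n) n"
  show "g \<star> x \<in> W (Suc (Suc n)) (Suc n)"
  proof (cases "g = h")
    case True then show ?thesis using power_filtration_shift[OF _ x] by simp
  next
    case False
    then have "g \<star> x \<in> W (Suc n) (Suc n)"
      using g power_filtration_smult[OF _ _ x] by auto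
    then show ?thesis using power_filtration_Suc_mono by blast
  qed
qed (rule power_filtration_submodule)

lemma power_filtration_degree_0: "W (Suc 0) 0 = N 0"
  using N_carrier by (force simp: h)

end

text \<open>The family generated from \<open>M\<close> in degree zero by the elements of \<open>H\<close>, built up one generator at a
  time as in the proof that a polynomial ring in several variables is noetherian.\<close>

lemma ex_acc_family:
  assumes acc: "acc_submodules (carrier M)" and H: "finite H" "H \<subseteq> carrier R"
  shows "\<exists>N. N 0 = carrier M \<and> closed_family H N \<and> acc_families H N"
  using H
proof (induction H rule: finite_induct)
  case empty
  define N :: "nat \<Rightarrow> 'c set" where "N n = (if n = 0 then carrier M else {\<zero>\<^bsub>M\<^esub>})" for n
  have "closed_family {} N"
    using carrier_is_submodule zero_submodule by (auto simp: closed_family_def N_def)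
  moreover have "acc_families {} N"
    unfolding acc_families_def
  proof (intro allI impI)
    fix C :: "nat \<Rightarrow> nat \<Rightarrow> 'c set"
    assume C: "mono C" and CN: "\<forall>i. closed_family {} (C i) \<and> C i \<le> N"
    have "mono (\<lambda>i. C i 0)" using C by (auto simp: mono_def le_fun_def)
    moreover have "submodule (C i 0) R M \<and> C i 0 \<subseteq> carrier M" for i
      using CN submoduleE(1) by (auto simp: closed_family_def)
    ultimately obtain i0 where i0: "\<forall>i\<ge>i0. C i 0 = C i0 0"
      using acc unfolding acc_submodules_def by meson
    have "C i (Suc n) = {\<zero>\<^bsub>M\<^esub>}" for i n
    proof -
      have "C i (Suc n) \<subseteq> N (Suc n)" using CN unfolding le_fun_def by blast
      moreover have "submodule (C i (Suc n)) R M" using CN by (auto simp: closed_family_def)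
      ultimately show ?thesis using submodule_zero[of "C i (Suc n)"] by (auto simp: N_def)
    qed
    have "C i n = C i0 n" if "i \<ge> i0" for i n
    proof (cases n)
      case 0 then show ?thesis using i0 that by blast
    next
      case (Suc m) then show ?thesis using \<open>\<And>i n. C i (Suc n) = {\<zero>\<^bsub>M\<^esub>}\<close> by simp
    qed
    then show "\<exists>i0. \<forall>i\<ge>i0. C i = C i0" by blast
  qed
  moreover have "N 0 = carrier M" by (simp add: N_def)
  ultimately show ?case by blast
next
  case (insert h H)
  then obtain N where N: "N 0 = carrier M" "closed_family H N" "acc_families H N" by auto
  have h: "h \<in> carrier R" "H \<subseteq> carrier R" using insert.prems by auto
  show ?case
    using power_filtration_degree_0[OF h N(2)] power_filtration_closed_family[OF h N(2)]
      acc_families_insert[OF h N(2,3)] N(1)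
    by (intro exI[of _ "\<lambda>n. power_filtration h N (Suc n) n"]) simp
qed

lemma module_span_least: "\<lbrakk>submodule N R M; A \<subseteq> N\<rbrakk> \<Longrightarrow> module_span R M A \<subseteq> N"
  by (auto simp: module_span_def)

lemma module_span_superset: "A \<subseteq> module_span R M A"
  by (auto simp: module_span_def)

lemma module_span_submodule:
  assumes "A \<subseteq> carrier M" shows "submodule (module_span R M A) R M"
proof (rule submoduleI)
  show "module_span R M A \<subseteq> carrier M"
    using module_span_least[OF carrier_is_submodule assms] .
qed (auto simp: module_span_def intro: submodule_zero submoduleE(3,4,5))

end

section \<open>Powers of an ideal and the adic filtration\<close>

lemma ideal_power_0 [simp]: "ideal_power R I 0 = carrier R"
  by (simp add: ideal_power_def nat_pow_def ideals_set_def)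

lemma ideal_power_Suc: "ideal_power R I (Suc n) = ideal_prod R (ideal_power R I n) I"
  by (simp add: ideal_power_def nat_pow_def ideals_set_def)

locale adic_module = module R M for R (structure) and M (structure) +
  fixes I :: "'a set"
  assumes ideal_I: "ideal I R"
begin

abbreviation P :: "nat \<Rightarrow> 'a set" where "P \<equiv> ideal_power R I"
abbreviation F :: "nat \<Rightarrow> 'c set" where "F \<equiv> adic_submodule R I M"

lemma P_ideal: "ideal (P n) R"
proof (induction n)
  case 0 show ?case by (simp add: R.oneideal)
next
  case (Suc n) then show ?case using R.ideal_prod_is_ideal[OF _ ideal_I] by (simp add: ideal_power_Suc)
qed

lemma P_carrier: "a \<in> P n \<Longrightarrow> a \<in> carrier R"
  using ideal.Icarr[OF P_ideal] .

lemma I_carrier: "a \<in> I \<Longrightarrow> a \<in> carrier R"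
  using ideal.Icarr[OF ideal_I] .

lemma P_Suc_subset: "P (Suc n) \<subseteq> P n"
  using R.ideal_prod_inter[OF P_ideal[of n] ideal_I] by (auto simp: ideal_power_Suc)

lemma P_1: "P (Suc 0) = I"
proof -
  have "ideal_prod R (carrier R) I = I"
  proof
    show "ideal_prod R (carrier R) I \<subseteq> I" using R.ideal_prod_inter[OF R.oneideal ideal_I] by blast
    show "I \<subseteq> ideal_prod R (carrier R) I"
    proof
      fix a assume a: "a \<in> I"
      then have "\<one> \<otimes> a \<in> ideal_prod R (carrier R) I" by (intro ideal_prod.prod) auto
      then show "a \<in> ideal_prod R (carrier R) I" using a I_carrier by simp
    qed
  qed
  then show ?thesis by (simp add: ideal_power_Suc)
qed

lemma P_mult: "\<lbrakk>a \<in> P i; b \<in> P j\<rbrakk> \<Longrightarrow> a \<otimes> b \<in> P (i + j)"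
proof (induction j arbitrary: b)
  case 0 then show ?case using ideal.I_r_closed[OF P_ideal] by simp
next
  case (Suc j)
  from Suc.prems(2) have "b \<in> ideal_prod R (P j) I" by (simp add: ideal_power_Suc)
  then show ?case
  proof (induction b rule: ideal_prod.induct)
    case (prod b c)
    have "(a \<otimes> b) \<otimes> c \<in> ideal_prod R (P (i + j)) I"
      using Suc.IH[OF Suc.prems(1) prod(1)] prod(2) by (rule ideal_prod.prod)
    then show ?case
      using P_carrier[OF Suc.prems(1)] P_carrier[OF prod(1)] I_carrier[OF prod(2)]
      by (simp add: ideal_power_Suc m_assoc)
  next
    case (sum b c)
    have "b \<in> carrier R" "c \<in> carrier R"
      using sum R.ideal_prod_in_carrier[OF P_ideal ideal_I] by blast+
    then have "a \<otimes> (b \<oplus> c) = a \<otimes> b \<oplus> a \<otimes> c"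
      using P_carrier[OF Suc.prems(1)] by (simp add: R.r_distr)
    then show ?case
      using sum ideal_add[OF P_ideal] by metis
  qed
qed

lemma F_submodule: "submodule (F n) R M"
  unfolding adic_submodule_def
  by (rule module_span_submodule) (use P_carrier in auto)

lemma F_carrier: "x \<in> F n \<Longrightarrow> x \<in> carrier M"
  using submodule_carrier[OF F_submodule] .

lemma F_least:
  assumes "submodule N R M" "\<And>a x. \<lbrakk>a \<in> P n; x \<in> carrier M\<rbrakk> \<Longrightarrow> a \<star> x \<in> N"
  shows "F n \<subseteq> N"
  unfolding adic_submodule_def using assms by (intro module_span_least) auto

lemma F_gen: "\<lbrakk>a \<in> P n; x \<in> carrier M\<rbrakk> \<Longrightarrow> a \<star> x \<in> F n"
  unfolding adic_submodule_def by (rule subsetD[OF module_span_superset]) blast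

lemma F_smult: "\<lbrakk>a \<in> P i; x \<in> F j\<rbrakk> \<Longrightarrow> a \<star> x \<in> F (i + j)"
proof -
  assume a: "a \<in> P i" and x: "x \<in> F j"
  have "F j \<subseteq> {x \<in> carrier M. a \<star> x \<in> F (i + j)}"
  proof (rule F_least[OF smult_vimage_submodule[OF F_submodule P_carrier[OF a]]])
    fix b y assume b: "b \<in> P j" and y: "y \<in> carrier M"
    have "a \<star> (b \<star> y) = (a \<otimes> b) \<star> y"
      using P_carrier[OF a] P_carrier[OF b] y by (simp add: smult_assoc1)
    then show "b \<star> y \<in> {x \<in> carrier M. a \<star> x \<in> F (i + j)}"
      using F_gen[OF P_mult[OF a b] y] P_carrier[OF b] y by simp
  qed
  then show ?thesis using x by blast
qed

lemma F_Suc_subset: "F (Suc n) \<subseteq> F n"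
  by (rule F_least[OF F_submodule]) (use P_Suc_subset F_gen in blast)

text \<open>The basis theorem for the Rees module of \<open>M\<close>. If \<open>A\<close> is a finite generating set of \<open>I\<close>, the family
  that \<open>A\<close> generates from \<open>M\<close> contains all \<open>I\<^sup>n M\<close>, and a family closed under \<open>I\<close> is closed under
  \<open>A\<close>.\<close>

theorem rees_acc:
  assumes noeth: "noetherian_ring R" and fg: "finitely_generated_module R M"
  shows "acc_families I F"
proof -
  obtain A where A: "A \<subseteq> carrier R" "finite A" "I = Idl A"
    using noetherian_ring.finetely_gen[OF noeth ideal_I] by blast
  have AI: "A \<subseteq> I" using A R.genideal_self by blast
  obtain N where N: "N 0 = carrier M" "closed_family A N" "acc_families A N"
    using ex_acc_family[OF acc_carrier[OF noeth fg] A(2,1)] by blast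
  note NE = submoduleE[OF closed_familyD(1)[OF N(2)]]
    and N0 = submodule_zero[OF closed_familyD(1)[OF N(2)]]
  let ?J = "{a \<in> carrier R. \<forall>n. \<forall>x\<in>N n. a \<star> x \<in> N (Suc n)}"
  have Nc: "\<And>x n. x \<in> N n \<Longrightarrow> x \<in> carrier M" using NE(1) by blast
  have "ideal ?J R"
  proof (rule R.ideal_if_closed)
    have "\<zero> \<in> ?J" using N0 Nc by auto
    then show "?J \<noteq> {}" by blast
  qed (use NE Nc in \<open>auto simp: smult_l_distr smult_assoc1\<close>)
  moreover have "A \<subseteq> ?J" using A(1) closed_familyD(2)[OF N(2)] by blast
  ultimately have IJ: "I \<subseteq> ?J" unfolding A(3) by (rule R.genideal_minimal)
  have PN: "a \<star> x \<in> N n" if "a \<in> P n" "x \<in> carrier M" for a x n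
    using that(1)
  proof (induction n arbitrary: a)
    case 0 then show ?case using that(2) N(1) by simp
  next
    case (Suc n)
    then have "a \<in> ideal_prod R (P n) I" by (simp add: ideal_power_Suc)
    then show ?case
    proof (induction a rule: ideal_prod.induct)
      case (prod a b)
      have "(a \<otimes> b) \<star> x = b \<star> (a \<star> x)"
        using P_carrier[OF prod(1)] I_carrier[OF prod(2)] that(2)
        by (simp add: smult_assoc1[symmetric] m_comm)
      moreover have "b \<star> (a \<star> x) \<in> N (Suc n)" using IJ prod(2) Suc.IH[OF prod(1)] by blast
      ultimately show ?case by simp
    next
      case (sum a b)
      have "a \<in> carrier R" "b \<in> carrier R"
        using sum R.ideal_prod_in_carrier[OF P_ideal ideal_I] by blast+
      then show ?case using sum NE(5) that(2) by (simp add: smult_l_distr)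
    qed
  qed
  have FN: "F n \<subseteq> N n" for n
    by (rule F_least[OF closed_familyD(1)[OF N(2)] PN])
  show ?thesis
    unfolding acc_families_def
  proof (intro allI impI)
    fix C :: "nat \<Rightarrow> nat \<Rightarrow> 'c set"
    assume C: "mono C" and CF: "\<forall>i. closed_family I (C i) \<and> C i \<le> F"
    have "\<forall>i. closed_family A (C i) \<and> C i \<le> N"
      using CF AI FN unfolding closed_family_def le_fun_def by blast
    then show "\<exists>i0. \<forall>i\<ge>i0. C i = C i0"
      using N(3) C unfolding acc_families_def by blast
  qed
qed

end

section \<open>Associated graded groups of filtrations\<close>

text \<open>Computations in an associated graded module are carried out on families of representatives.\<close>

definition coset_seq :: "('a, 'b, 'd) module_scheme \<Rightarrow> (nat \<Rightarrow> 'b set) \<Rightarrow> (nat \<Rightarrow> 'b) \<Rightarrow> nat \<Rightarrow> 'b set" where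
  "coset_seq M F x = (\<lambda>n. F (Suc n) +>\<^bsub>M\<^esub> x n)"

locale filtered_group = abelian_group M for M :: "('a, 'b, 'd) module_scheme" (structure) +
  fixes F :: "nat \<Rightarrow> 'b set"
  assumes F_additive: "additive_subgroup (F n) M"
    and F_Suc: "F (Suc n) \<subseteq> F n"
begin

lemma
  shows filt_carrier: "x \<in> F n \<Longrightarrow> x \<in> carrier M"
    and filt_zero: "\<zero> \<in> F n"
    and filt_add: "\<lbrakk>x \<in> F n; y \<in> F n\<rbrakk> \<Longrightarrow> x \<oplus> y \<in> F n"
    and filt_inv: "x \<in> F n \<Longrightarrow> \<ominus> x \<in> F n"
  using additive_subgroup.a_Hcarr[OF F_additive] additive_subgroup.zero_closed[OF F_additive]
    additive_subgroup.a_closed[OF F_additive] additive_subgroup.a_inv_closed[OF F_additive]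
  by auto

lemma minus_zero_eq: "\<ominus> \<zero> = \<zero>"
  using l_neg[OF zero_closed] by simp

lemma filt_minus: "\<lbrakk>x \<in> F n; y \<in> F n\<rbrakk> \<Longrightarrow> x \<ominus> y \<in> F n"
  unfolding a_minus_def using filt_add filt_inv by blast

lemma F_abelian_subgroup: "abelian_subgroup (F n) M"
  by (rule abelian_subgroupI3[OF F_additive abelian_group_axioms])

lemma coset_eq_iff:
  assumes "x \<in> carrier M" "y \<in> carrier M"
  shows "F n +> x = F n +> y \<longleftrightarrow> x \<ominus> y \<in> F n"
proof -
  interpret S: abelian_subgroup "F n" M by (rule F_abelian_subgroup)
  have "F n +> x = F n +> y \<longleftrightarrow> x \<in> F n +> y"
    using S.a_repr_independence'[of x y] S.a_rcos_self[of x] assms by blast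
  also have "\<dots> \<longleftrightarrow> x \<ominus> y \<in> F n"
    unfolding a_minus_def by (rule S.a_rcos_module[OF assms(2,1)])
  finally show ?thesis .
qed

lemma coset_eq_F_iff: "x \<in> carrier M \<Longrightarrow> F n +> x = F n \<longleftrightarrow> x \<in> F n"
proof -
  assume x: "x \<in> carrier M"
  have "F n \<subseteq> carrier M" using filt_carrier by blast
  then show ?thesis using coset_eq_iff[OF x zero_closed, of n] x by (simp add: a_minus_def minus_zero_eq)
qed

lemma coset_subset:
  assumes "x \<in> carrier M" "additive_subgroup H M" "F n \<subseteq> H"
  shows "F n +> x \<subseteq> H \<longleftrightarrow> x \<in> H"
proof
  assume "F n +> x \<subseteq> H"
  then show "x \<in> H"
    using abelian_subgroup.a_rcos_self[OF F_abelian_subgroup assms(1)] by blast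
next
  assume "x \<in> H"
  then show "F n +> x \<subseteq> H"
    using assms(3) additive_subgroup.a_closed[OF assms(2)] by (auto simp: a_r_coset_def')
qed

lemma gr_piece_carrier: "carrier (gr_piece M F n) = (\<lambda>x. F (Suc n) +> x) ` F n"
  by (auto simp: gr_piece_def A_FactGroup_def FactGroup_def RCOSETS_def a_r_coset_def r_coset_def)

lemma gr_piece_one [simp]: "\<one>\<^bsub>gr_piece M F n\<^esub> = F (Suc n)"
  by (simp add: gr_piece_def A_FactGroup_def FactGroup_def)

lemma gr_piece_mult: "X \<otimes>\<^bsub>gr_piece M F n\<^esub> Y = X <+> Y"
  by (simp add: gr_piece_def A_FactGroup_def FactGroup_def set_add_def set_mult_def)

lemma gr_piece_comm_group: "comm_group (gr_piece M F n)"
proof -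
  interpret A: abelian_group "M\<lparr>carrier := F n\<rparr>"
  proof (rule abelian_groupI)
    fix x assume "x \<in> carrier (M\<lparr>carrier := F n\<rparr>)"
    then have "\<ominus> x \<in> F n" "\<ominus> x \<oplus> x = \<zero>" using filt_inv filt_carrier l_neg by auto
    then show "\<exists>y\<in>carrier (M\<lparr>carrier := F n\<rparr>). y \<oplus>\<^bsub>M\<lparr>carrier := F n\<rparr>\<^esub> x = \<zero>\<^bsub>M\<lparr>carrier := F n\<rparr>\<^esub>"
      by auto
  qed (use filt_carrier in \<open>auto simp: filt_zero filt_add a_ac\<close>)
  have "additive_subgroup (F (Suc n)) (M\<lparr>carrier := F n\<rparr>)"
    using group.subgroup_incl[OF a_group additive_subgroup.a_subgroup[OF F_additive]
        additive_subgroup.a_subgroup[OF F_additive] F_Suc, of n]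
    by (simp add: additive_subgroup_def)
  then interpret S: abelian_subgroup "F (Suc n)" "M\<lparr>carrier := F n\<rparr>"
    using abelian_subgroupI3 A.abelian_group_axioms by blast
  show ?thesis unfolding gr_piece_def by (rule S.a_factorgroup_is_comm_group)
qed

lemma coset_add:
  assumes "x \<in> carrier M" "y \<in> carrier M"
  shows "(F n +> x) <+> (F n +> y) = F n +> (x \<oplus> y)"
  using abelian_subgroup.a_rcos_sum[OF F_abelian_subgroup assms] .

text \<open>Finiteness concerns the classes: a family whose classes almost all vanish may have infinitely many
  nonzero entries.\<close>

definition reps :: "(nat \<Rightarrow> 'b) set" where
  "reps = {x. (\<forall>n. x n \<in> F n) \<and> finite {n. x n \<notin> F (Suc n)}}"

abbreviation cls :: "(nat \<Rightarrow> 'b) \<Rightarrow> nat \<Rightarrow> 'b set" where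
  "cls \<equiv> coset_seq M F"

definition single :: "nat \<Rightarrow> 'b \<Rightarrow> nat \<Rightarrow> 'b" where
  "single d x = (\<lambda>n. if n = d then x else \<zero>)"

lemma reps_mem: "x \<in> reps \<Longrightarrow> x n \<in> F n"
  by (simp add: reps_def)

lemma reps_carrier: "x \<in> reps \<Longrightarrow> x n \<in> carrier M"
  using reps_mem filt_carrier by blast

lemma reps_bound: 
  assumes "x \<in> reps" shows "\<exists>N. \<forall>n\<ge>N. x n \<in> F (Suc n)"
proof -
  obtain N where "\<forall>n\<in>{n. x n \<notin> F (Suc n)}. n < N"
    using assms finite_nat_set_iff_bounded unfolding reps_def by blast
  then have "\<forall>n\<ge>N. x n \<in> F (Suc n)" by (meson leD mem_Collect_eq)
  then show ?thesis ..
qed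

lemma repsI:
  assumes "\<And>n. x n \<in> F n" "\<And>n. N \<le> n \<Longrightarrow> x n \<in> F (Suc n)" shows "x \<in> reps"
proof -
  have "{n. x n \<notin> F (Suc n)} \<subseteq> {..<N}" using assms(2) by (auto simp: not_le[symmetric])
  then show ?thesis using assms(1) finite_subset unfolding reps_def by blast
qed

lemma single_reps: "x \<in> F d \<Longrightarrow> single d x \<in> reps"
  by (rule repsI[of _ "Suc d"]) (auto simp: single_def filt_zero)

lemma zero_reps: "(\<lambda>n. \<zero>) \<in> reps"
  by (rule repsI[of _ 0]) (auto simp: filt_zero)

lemma add_reps:
  assumes "x \<in> reps" "y \<in> reps" shows "(\<lambda>n. x n \<oplus> y n) \<in> reps"
proof -
  obtain N where N: "\<forall>n\<ge>N. x n \<in> F (Suc n)" using reps_bound[OF assms(1)] by blast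
  obtain N' where N': "\<forall>n\<ge>N'. y n \<in> F (Suc n)" using reps_bound[OF assms(2)] by blast
  show ?thesis
    by (rule repsI[of _ "max N N'"]) (use assms reps_mem N N' filt_add in auto)
qed

lemma inv_reps: 
  assumes "x \<in> reps" shows "(\<lambda>n. \<ominus> x n) \<in> reps"
proof -
  obtain N where N: "\<forall>n\<ge>N. x n \<in> F (Suc n)" using reps_bound[OF assms] by blast
  show ?thesis
    by (rule repsI[of _ N]) (use assms reps_mem N filt_inv in auto)
qed

lemma gr_carrier: "carrier (gr M F) = cls ` reps"
proof (intro equalityI subsetI)
  fix u assume "u \<in> carrier (gr M F)"
  then have u: "\<forall>n. u n \<in> (\<lambda>x. F (Suc n) +> x) ` F n" "finite {n. u n \<noteq> F (Suc n)}"
    by (auto simp: gr_def gr_piece_carrier)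
  then have "\<forall>n. \<exists>x. x \<in> F n \<and> u n = F (Suc n) +> x" by blast
  then obtain x where x: "\<And>n. x n \<in> F n" "\<And>n. u n = F (Suc n) +> x n" by metis
  have "{n. x n \<notin> F (Suc n)} = {n. u n \<noteq> F (Suc n)}"
    unfolding x(2) using coset_eq_F_iff x(1) filt_carrier by blast
  then have "x \<in> reps" using x(1) u(2) by (simp add: reps_def)
  moreover have "u = cls x" using x(2) by (auto simp: coset_seq_def)
  ultimately show "u \<in> cls ` reps" by blast
next
  fix u assume "u \<in> cls ` reps"
  then obtain x where x: "x \<in> reps" "u = cls x" by blast
  have "{n. u n \<noteq> F (Suc n)} = {n. x n \<notin> F (Suc n)}"
    unfolding x(2) coset_seq_def using coset_eq_F_iff reps_carrier[OF x(1)] by blast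
  then show "u \<in> carrier (gr M F)"
    using x by (auto simp: gr_def gr_piece_carrier reps_def coset_seq_def)
qed

lemma gr_carrierE:
  assumes "u \<in> carrier (gr M F)" obtains x where "x \<in> reps" "u = cls x"
  using assms gr_carrier by blast

lemma cls_closed: "x \<in> reps \<Longrightarrow> cls x \<in> carrier (gr M F)"
  using gr_carrier by blast

lemma cls_eq_iff:
  assumes "x \<in> reps" "y \<in> reps"
  shows "cls x = cls y \<longleftrightarrow> (\<forall>n. x n \<ominus> y n \<in> F (Suc n))"
  unfolding coset_seq_def fun_eq_iff using coset_eq_iff reps_carrier assms by blast

lemma gr_zero: "\<zero>\<^bsub>gr M F\<^esub> = cls (\<lambda>n. \<zero>)"
  using coset_eq_F_iff[of \<zero>] filt_zero by (simp add: gr_def coset_seq_def)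

lemma gr_add:
  assumes "x \<in> reps" "y \<in> reps"
  shows "cls x \<oplus>\<^bsub>gr M F\<^esub> cls y = cls (\<lambda>n. x n \<oplus> y n)"
  using assms reps_carrier coset_add by (simp add: gr_def coset_seq_def gr_piece_mult)

lemma gr_abelian_group: "abelian_group (gr M F)"
proof (rule abelian_groupI)
  fix u v w assume "u \<in> carrier (gr M F)" "v \<in> carrier (gr M F)" "w \<in> carrier (gr M F)"
  then obtain x y z where x: "x \<in> reps" "u = cls x" and y: "y \<in> reps" "v = cls y"
    and z: "z \<in> reps" "w = cls z" using gr_carrierE by metis
  show "u \<oplus>\<^bsub>gr M F\<^esub> v \<in> carrier (gr M F)"
    using x y by (simp add: gr_add add_reps cls_closed)
  show "u \<oplus>\<^bsub>gr M F\<^esub> v \<oplus>\<^bsub>gr M F\<^esub> w = u \<oplus>\<^bsub>gr M F\<^esub> (v \<oplus>\<^bsub>gr M F\<^esub> w)"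
    using x y z by (simp add: gr_add add_reps a_assoc reps_carrier)
next
  fix u v assume "u \<in> carrier (gr M F)" "v \<in> carrier (gr M F)"
  then obtain x y where x: "x \<in> reps" "u = cls x" and y: "y \<in> reps" "v = cls y"
    using gr_carrierE by metis
  show "u \<oplus>\<^bsub>gr M F\<^esub> v = v \<oplus>\<^bsub>gr M F\<^esub> u"
    using x y by (simp add: gr_add a_comm reps_carrier)
next
  show "\<zero>\<^bsub>gr M F\<^esub> \<in> carrier (gr M F)" by (simp add: gr_zero cls_closed zero_reps)
next
  fix u assume "u \<in> carrier (gr M F)"
  then obtain x where x: "x \<in> reps" "u = cls x" using gr_carrierE by metis
  show "\<zero>\<^bsub>gr M F\<^esub> \<oplus>\<^bsub>gr M F\<^esub> u = u"
    using x by (simp add: gr_zero gr_add zero_reps reps_carrier)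
  show "\<exists>v\<in>carrier (gr M F). v \<oplus>\<^bsub>gr M F\<^esub> u = \<zero>\<^bsub>gr M F\<^esub>"
    using x by (intro bexI[of _ "cls (\<lambda>n. \<ominus> x n)"])
      (simp_all add: gr_zero gr_add inv_reps reps_carrier cls_closed l_neg)
qed

lemma gr_class_eq: "gr_class M F d x = cls (single d x)"
  using coset_eq_F_iff[of \<zero>] filt_zero by (intro ext) (simp add: gr_class_def coset_seq_def single_def)

lemma gr_degree_eq: "gr_degree M F d = gr_class M F d ` F d"
proof (intro equalityI subsetI)
  fix u assume "u \<in> gr_degree M F d"
  then have u: "u \<in> carrier (gr M F)" "\<And>n. n \<noteq> d \<Longrightarrow> u n = F (Suc n)"
    by (auto simp: gr_degree_def)
  obtain x where x: "x \<in> reps" "u = cls x" using gr_carrierE[OF u(1)] .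
  have "u = gr_class M F d (x d)"
    using u(2) unfolding x(2) by (intro ext) (simp add: gr_class_def coset_seq_def)
  then show "u \<in> gr_class M F d ` F d" using reps_mem[OF x(1)] by blast
next
  fix u assume "u \<in> gr_class M F d ` F d"
  then obtain x where x: "x \<in> F d" "u = gr_class M F d x" by blast
  then have "u \<in> carrier (gr M F)" using gr_class_eq single_reps cls_closed by metis
  then show "u \<in> gr_degree M F d" using x by (auto simp: gr_degree_def gr_class_def)
qed

lemma gr_class_closed: "x \<in> F d \<Longrightarrow> gr_class M F d x \<in> carrier (gr M F)"
  by (simp add: gr_class_eq single_reps cls_closed)

lemma gr_class_eq_iff:
  assumes "x \<in> F d" "y \<in> F d"
  shows "gr_class M F d x = gr_class M F d y \<longleftrightarrow> x \<ominus> y \<in> F (Suc d)"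
  unfolding gr_class_eq cls_eq_iff[OF single_reps[OF assms(1)] single_reps[OF assms(2)]]
  using filt_zero by (auto simp: single_def a_minus_def minus_zero_eq)

lemma gr_class_zero_iff:
  assumes "x \<in> F d" shows "gr_class M F d x = \<zero>\<^bsub>gr M F\<^esub> \<longleftrightarrow> x \<in> F (Suc d)"
proof -
  have "\<zero>\<^bsub>gr M F\<^esub> = gr_class M F d \<zero>"
    unfolding gr_zero gr_class_eq by (rule arg_cong[of _ _ cls]) (auto simp: single_def)
  then show ?thesis
    using gr_class_eq_iff[OF assms filt_zero] filt_carrier[OF assms] by (simp add: a_minus_def minus_zero_eq)
qed

lemma gr_class_add:
  assumes "x \<in> F d" "y \<in> F d"
  shows "gr_class M F d x \<oplus>\<^bsub>gr M F\<^esub> gr_class M F d y = gr_class M F d (x \<oplus> y)"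
proof -
  have "(\<lambda>n. single d x n \<oplus> single d y n) = single d (x \<oplus> y)" by (auto simp: single_def)
  then show ?thesis using gr_add[OF single_reps[OF assms(1)] single_reps[OF assms(2)]]
    by (simp add: gr_class_eq)
qed

lemma gr_piece_finprod:
  assumes "\<And>i. i \<le> (k::nat) \<Longrightarrow> t i \<in> F n"
  shows "finprod (gr_piece M F n) (\<lambda>i. F (Suc n) +> t i) {..k} = F (Suc n) +> (\<Oplus>i\<in>{..k}. t i)"
  using assms
proof (induction k)
  interpret G: comm_group "gr_piece M F n" by (rule gr_piece_comm_group)
  {
    case 0
    then have "F (Suc n) +> t 0 \<in> carrier (gr_piece M F n)" by (simp add: gr_piece_carrier)
    then show ?case using 0 filt_carrier G.r_one by (simp del: gr_piece_one)
  next
    case (Suc k)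
    have c: "(\<lambda>i. F (Suc n) +> t i) \<in> {..Suc k} \<rightarrow> carrier (gr_piece M F n)"
      using Suc.prems by (auto simp: gr_piece_carrier)
    have t: "t \<in> {..Suc k} \<rightarrow> carrier M" using Suc.prems filt_carrier by auto
    then have s: "(\<Oplus>i\<in>{..k}. t i) \<in> carrier M" by (intro finsum_closed) auto
    have "finprod (gr_piece M F n) (\<lambda>i. F (Suc n) +> t i) {..Suc k} =
      (F (Suc n) +> t (Suc k)) <+> (F (Suc n) +> (\<Oplus>i\<in>{..k}. t i))"
      using c Suc by (simp add: atMost_Suc gr_piece_mult Pi_def)
    also have "\<dots> = F (Suc n) +> (t (Suc k) \<oplus> (\<Oplus>i\<in>{..k}. t i))"
      using t s by (intro coset_add) auto
    finally show ?case using t by simp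
  }
qed

lemma finsum_mem:
  assumes "\<And>i. i \<le> (k::nat) \<Longrightarrow> t i \<in> F n" shows "(\<Oplus>i\<in>{..k}. t i) \<in> F n"
  using assms
proof (induction k)
  case 0 then show ?case using filt_carrier by simp
next
  case (Suc k)
  have "t \<in> {..Suc k} \<rightarrow> carrier M" using Suc.prems filt_carrier by auto
  then show ?case using Suc filt_add by simp
qed

end

lemma (in cring) ideal_power_as_adic:
  assumes "ideal I R"
  shows "adic_submodule R I (regular_module R) = ideal_power R I"
proof
  fix n
  interpret reg: adic_module R "regular_module R" I
    using regular_module_is_module assms by (intro adic_module.intro adic_module_axioms.intro)
  have "submodule (ideal_power R I n) R (regular_module R)"
  proof (rule reg.submoduleI)
    fix a assume "a \<in> ideal_power R I n"
    moreover have "\<ominus>\<^bsub>regular_module R\<^esub> a = \<ominus> a" by (simp add: a_inv_def m_inv_def)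
    ultimately show "\<ominus>\<^bsub>regular_module R\<^esub> a \<in> ideal_power R I n"
      using ideal_neg[OF reg.P_ideal] by simp
  qed (use reg.P_carrier ideal_zero[OF reg.P_ideal]
      ideal_add[OF reg.P_ideal] ideal.I_l_closed[OF reg.P_ideal] in auto)
  then have "reg.F n \<subseteq> ideal_power R I n"
    by (rule reg.F_least) (use ideal.I_r_closed[OF reg.P_ideal] in auto)
  moreover have "ideal_power R I n \<subseteq> reg.F n"
  proof
    fix a assume a: "a \<in> ideal_power R I n"
    show "a \<in> reg.F n" using reg.F_gen[OF a, of \<one>] reg.P_carrier[OF a] by simp
  qed
  ultimately show "reg.F n = ideal_power R I n" by blast
qed

sublocale adic_module \<subseteq> fil: filtered_group M F
proof (intro filtered_group.intro M.abelian_group_axioms filtered_group_axioms.intro)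
  show "additive_subgroup (F n) M" for n
    using F_submodule[of n] by (simp add: submodule_def additive_subgroup_def)
qed (rule F_Suc_subset)

lemma (in adic_module) regular_adic: "adic_module R (regular_module R) I"
  by (intro adic_module.intro adic_module_axioms.intro R.regular_module_is_module ideal_I)

lemma (in adic_module) P_filtered: "filtered_group (regular_module R) P"
proof -
  interpret reg: adic_module R "regular_module R" I by (rule regular_adic)
  show ?thesis
    using reg.fil.filtered_group_axioms by (simp add: R.ideal_power_as_adic[OF ideal_I])
qed

sublocale adic_module \<subseteq> pow: filtered_group "regular_module R" P
  by (rule P_filtered)


section \<open>The associated graded ring and module\<close>

lemma regular_module_derived [simp]:
  "finsum (regular_module R) = finsum R"
  "a_inv (regular_module R) = a_inv R"
  "a_minus (regular_module R) = a_minus R"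
  "a_r_coset (regular_module R) = a_r_coset R"
  by (simp_all add: fun_eq_iff finsum_def finprod_def a_inv_def m_inv_def a_minus_def a_r_coset_def
      r_coset_def)

context module
begin

text \<open>On representatives, the product of associated graded objects is the convolution \<open>conv\<close>, as for
  polynomials.\<close>

definition conv :: "(nat \<Rightarrow> 'a) \<Rightarrow> (nat \<Rightarrow> 'c) \<Rightarrow> nat \<Rightarrow> 'c" where
  "conv a x = (\<lambda>n. \<Oplus>\<^bsub>M\<^esub>i\<in>{..n}. a i \<star> x (n - i))"

lemma finsum_smult_rdistr:
  assumes "finite A" "f \<in> A \<rightarrow> carrier R" "x \<in> carrier M"
  shows "(\<Oplus>i\<in>A. f i) \<star> x = (\<Oplus>\<^bsub>M\<^esub>i\<in>A. f i \<star> x)"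
  using assms by (induction set: finite) (simp_all add: Pi_def smult_l_distr)

lemma conv_add_left:
  assumes "\<And>n. a n \<in> carrier R" "\<And>n. b n \<in> carrier R" "\<And>n. x n \<in> carrier M"
  shows "conv (\<lambda>n. a n \<oplus> b n) x = (\<lambda>n. conv a x n \<boxplus> conv b x n)"
  unfolding conv_def using assms by (simp add: smult_l_distr M.finsum_addf Pi_def)

lemma conv_add_right:
  assumes "\<And>n. a n \<in> carrier R" "\<And>n. x n \<in> carrier M" "\<And>n. y n \<in> carrier M"
  shows "conv a (\<lambda>n. x n \<boxplus> y n) = (\<lambda>n. conv a x n \<boxplus> conv a y n)"
  unfolding conv_def using assms by (simp add: smult_r_distr M.finsum_addf Pi_def)

lemma conv_single_left:
  assumes a: "a \<in> carrier R" and x: "\<And>n. x n \<in> carrier M"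
  shows "conv (\<lambda>n. if n = i then a else \<zero>) x n = (if i \<le> n then a \<star> x (n - i) else \<zero>\<^bsub>M\<^esub>)"
proof -
  have "conv (\<lambda>n. if n = i then a else \<zero>) x n =
      (\<Oplus>\<^bsub>M\<^esub>k\<in>{..n}. if i = k then a \<star> x (n - k) else \<zero>\<^bsub>M\<^esub>)"
    unfolding conv_def using a x by (intro M.finsum_cong') auto
  also have "\<dots> = (if i \<le> n then a \<star> x (n - i) else \<zero>\<^bsub>M\<^esub>)"
  proof (cases "i \<le> n")
    case True
    then show ?thesis using M.finsum_singleton[of i "{..n}" "\<lambda>k. a \<star> x (n - k)"] a x by simp
  next
    case False
    then have "(\<Oplus>\<^bsub>M\<^esub>k\<in>{..n}. if i = k then a \<star> x (n - k) else \<zero>\<^bsub>M\<^esub>) = (\<Oplus>\<^bsub>M\<^esub>k\<in>{..n}. \<zero>\<^bsub>M\<^esub>)"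
      by (intro M.finsum_cong') auto
    then show ?thesis using False by simp
  qed
  finally show ?thesis .
qed

text \<open>Both sides sum \<open>a i b j x k\<close> over \<open>i + j + k = n\<close>; restricting the sum to \<open>i + j \<le> k\<close>
  allows an induction on \<open>k\<close>.\<close>

lemma conv_assoc:
  assumes a: "\<And>n. a n \<in> carrier R" and b: "\<And>n. b n \<in> carrier R" and x: "\<And>n. x n \<in> carrier M"
  shows "conv (\<lambda>n. \<Oplus>i\<in>{..n}. a i \<otimes> b (n - i)) x n = conv a (conv b x) n"
proof -
  have "k \<le> n \<Longrightarrow>
      (\<Oplus>\<^bsub>M\<^esub>j\<in>{..k}. (\<Oplus>i\<in>{..j}. a i \<otimes> b (j - i)) \<star> x (n - j)) =
      (\<Oplus>\<^bsub>M\<^esub>j\<in>{..k}. a j \<star> (\<Oplus>\<^bsub>M\<^esub>i\<in>{..k - j}. b i \<star> x (n - j - i)))" for k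
  proof (induction k)
    case 0 then show ?case using a b x by (simp add: smult_assoc1)
  next
    case (Suc k)
    define y where "y j = (\<Oplus>\<^bsub>M\<^esub>i\<in>{..k - j}. b i \<star> x (n - j - i))" for j
    define z where "z j = b (Suc k - j) \<star> x (n - Suc k)" for j
    have y: "y j \<in> carrier M" for j unfolding y_def using b x by (intro M.finsum_closed) auto
    have z: "z j \<in> carrier M" for j unfolding z_def using b x by auto
    have step: "(\<Oplus>\<^bsub>M\<^esub>i\<in>{..Suc k - j}. b i \<star> x (n - j - i)) = z j \<boxplus> y j" if "j \<le> k" for j
    proof -
      have "n - j - Suc (k - j) = n - Suc k" "Suc k - j = Suc (k - j)" using that by auto
      then show ?thesis unfolding y_def z_def using b x by (simp add: Pi_def)
    qed
    have last: "(\<Oplus>\<^bsub>M\<^esub>i\<in>{..Suc k - Suc k}. b i \<star> x (n - Suc k - i)) = z (Suc k)"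
      unfolding z_def using b x by simp
    have "(\<Oplus>\<^bsub>M\<^esub>j\<in>{..Suc k}. a j \<star> (\<Oplus>\<^bsub>M\<^esub>i\<in>{..Suc k - j}. b i \<star> x (n - j - i))) =
      a (Suc k) \<star> z (Suc k) \<boxplus>
        (\<Oplus>\<^bsub>M\<^esub>j\<in>{..k}. a j \<star> (\<Oplus>\<^bsub>M\<^esub>i\<in>{..Suc k - j}. b i \<star> x (n - j - i)))"
      unfolding last[symmetric] using a b x by (subst M.finsum_Suc) (auto intro!: M.finsum_closed)
    also have "(\<Oplus>\<^bsub>M\<^esub>j\<in>{..k}. a j \<star> (\<Oplus>\<^bsub>M\<^esub>i\<in>{..Suc k - j}. b i \<star> x (n - j - i))) =
        (\<Oplus>\<^bsub>M\<^esub>j\<in>{..k}. a j \<star> z j \<boxplus> a j \<star> y j)"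
      using a y z step by (intro M.finsum_cong') (auto simp: smult_r_distr)
    also have "\<dots> = (\<Oplus>\<^bsub>M\<^esub>j\<in>{..k}. a j \<star> z j) \<boxplus> (\<Oplus>\<^bsub>M\<^esub>j\<in>{..k}. a j \<star> y j)"
      using a y z by (intro M.finsum_addf) auto
    also have "a (Suc k) \<star> z (Suc k) \<boxplus> \<dots> =
      (\<Oplus>\<^bsub>M\<^esub>j\<in>{..Suc k}. a j \<star> z j) \<boxplus> (\<Oplus>\<^bsub>M\<^esub>j\<in>{..k}. a j \<star> y j)"
      using a y z by (simp add: Pi_def M.a_assoc)
    also have "(\<Oplus>\<^bsub>M\<^esub>j\<in>{..Suc k}. a j \<star> z j) =
        (\<Oplus>\<^bsub>M\<^esub>j\<in>{..Suc k}. (a j \<otimes> b (Suc k - j)) \<star> x (n - Suc k))"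
      unfolding z_def using a b x by (intro M.finsum_cong') (auto simp: smult_assoc1)
    also have "\<dots> = (\<Oplus>j\<in>{..Suc k}. a j \<otimes> b (Suc k - j)) \<star> x (n - Suc k)"
      using a b x by (intro finsum_smult_rdistr[symmetric]) auto
    also have "(\<Oplus>\<^bsub>M\<^esub>j\<in>{..k}. a j \<star> y j) =
        (\<Oplus>\<^bsub>M\<^esub>j\<in>{..k}. (\<Oplus>i\<in>{..j}. a i \<otimes> b (j - i)) \<star> x (n - j))"
      unfolding y_def using Suc by simp
    finally show ?case
      using a b x by (subst M.finsum_Suc) (auto intro!: R.finsum_closed)
  qed
  from this[of n] show ?thesis unfolding conv_def by simp
qed

end

lemma (in cring) conv_comm:
  assumes "\<And>n. a n \<in> carrier R" "\<And>n. b n \<in> carrier R"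
  shows "(\<Oplus>i\<in>{..n::nat}. a i \<otimes> b (n - i)) = (\<Oplus>i\<in>{..n}. b i \<otimes> a (n - i))"
proof -
  have im: "(\<lambda>i. n - i) ` {..n} = {..n}"
  proof (intro equalityI subsetI)
    fix i assume "i \<in> {..n}"
    then show "i \<in> (\<lambda>i. n - i) ` {..n}" by (intro image_eqI[of _ _ "n - i"]) auto
  qed auto
  have "(\<Oplus>i\<in>{..n}. b i \<otimes> a (n - i)) = (\<Oplus>i\<in>(\<lambda>i. n - i) ` {..n}. b i \<otimes> a (n - i))"
    by (simp only: im)
  also have "\<dots> = (\<Oplus>i\<in>{..n}. b (n - i) \<otimes> a (n - (n - i)))"
    using assms by (intro add.finprod_reindex) (auto simp: inj_on_def)
  also have "\<dots> = (\<Oplus>i\<in>{..n}. a i \<otimes> b (n - i))"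
    using assms by (intro finsum_cong') (auto simp: m_comm)
  finally show ?thesis by simp
qed

context adic_module
begin

lemma conv_mem:
  assumes "\<And>i. a i \<in> P i" "\<And>i. x i \<in> F i" shows "conv a x n \<in> F n"
  unfolding conv_def
proof (rule fil.finsum_mem)
  fix i assume "i \<le> n"
  then show "a i \<star> x (n - i) \<in> F n" using F_smult[OF assms(1)[of i] assms(2)[of "n - i"]] by simp
qed

lemma conv_reps:
  assumes a: "a \<in> pow.reps" and x: "x \<in> fil.reps" shows "conv a x \<in> fil.reps"
proof -
  obtain A where A: "\<forall>n\<ge>A. a n \<in> P (Suc n)" using pow.reps_bound[OF a] by blast
  obtain B where B: "\<forall>n\<ge>B. x n \<in> F (Suc n)" using fil.reps_bound[OF x] by blast
  show ?thesis
  proof (rule fil.repsI[of _ "A + B"])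
    show "conv a x n \<in> F n" for n
      using conv_mem pow.reps_mem[OF a] fil.reps_mem[OF x] by blast
    fix n assume n: "A + B \<le> n"
    show "conv a x n \<in> F (Suc n)"
      unfolding conv_def
    proof (rule fil.finsum_mem)
      fix i assume i: "i \<le> n"
      show "a i \<star> x (n - i) \<in> F (Suc n)"
      proof (cases "A \<le> i")
        case True
        then show ?thesis
          using F_smult[of "a i" "Suc i" "x (n - i)" "n - i"] A fil.reps_mem[OF x] i by simp
      next
        case False
        then have "x (n - i) \<in> F (Suc (n - i))" using B n by simp
        then show ?thesis
          using F_smult[of "a i" i "x (n - i)" "Suc (n - i)"] pow.reps_mem[OF a] i by simp
      qed
    qed
  qed
qed

text \<open>Changing the scalar by \<open>I^(i + 1)\<close> or the vector by \<open>I^(j + 1) M\<close> changes the product by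
  \<open>I^(i + j + 1) M\<close>.\<close>

lemma coset_smult:
  assumes a: "a \<in> P i" and x: "x \<in> F j"
  shows "(\<Union>r\<in>P (Suc i) +> a. \<Union>y\<in>F (Suc j) +>\<^bsub>M\<^esub> x. F (Suc (i + j)) +>\<^bsub>M\<^esub> r \<star> y) =
    F (Suc (i + j)) +>\<^bsub>M\<^esub> a \<star> x"
proof -
  have eq: "F (Suc (i + j)) +>\<^bsub>M\<^esub> r \<star> y = F (Suc (i + j)) +>\<^bsub>M\<^esub> a \<star> x"
    if r: "r \<in> P (Suc i) +> a" and y: "y \<in> F (Suc j) +>\<^bsub>M\<^esub> x" for r y
  proof -
    obtain b where b: "b \<in> P (Suc i)" "r = b \<oplus> a" using r by (auto simp: a_r_coset_def')
    obtain z where z: "z \<in> F (Suc j)" "y = z \<boxplus> x" using y by (auto simp: a_r_coset_def')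
    have c: "a \<in> carrier R" "b \<in> carrier R" "x \<in> carrier M" "z \<in> carrier M"
      using a x b z P_carrier F_carrier by blast+
    have "r \<star> y \<ominus>\<^bsub>M\<^esub> a \<star> x = b \<star> y \<boxplus> a \<star> z"
    proof -
      have yc: "y \<in> carrier M" using z c by simp
      have "r \<star> y = b \<star> y \<boxplus> (a \<star> z \<boxplus> a \<star> x)"
        unfolding b(2) smult_l_distr[OF c(2,1) yc] by (simp add: z(2) c smult_r_distr)
      then show ?thesis using c yc by (simp add: a_minus_def M.a_assoc M.r_neg)
    qed
    moreover have "b \<star> y \<in> F (Suc (i + j))"
    proof -
      have "z \<in> F j" using z(1) F_Suc_subset by blast
      then have "y \<in> F j" unfolding z(2) using x fil.filt_add by blast
      then show ?thesis using F_smult[OF b(1)] by fastforce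
    qed
    moreover have "a \<star> z \<in> F (Suc (i + j))" using F_smult[OF a z(1)] by simp
    ultimately have "r \<star> y \<ominus>\<^bsub>M\<^esub> a \<star> x \<in> F (Suc (i + j))" using fil.filt_add by simp
    then show ?thesis using fil.coset_eq_iff[of "r \<star> y" "a \<star> x"] c b z by simp
  qed
  have "a \<in> P (Suc i) +> a" "x \<in> F (Suc j) +>\<^bsub>M\<^esub> x"
    using abelian_subgroup.a_rcos_self[OF pow.F_abelian_subgroup, of a "Suc i"] P_carrier[OF a]
      abelian_subgroup.a_rcos_self[OF fil.F_abelian_subgroup F_carrier[OF x]] by auto
  then show ?thesis using eq by blast
qed

lemma gr_smult:
  assumes a: "a \<in> pow.reps" and x: "x \<in> fil.reps"
  shows "pow.cls a \<odot>\<^bsub>gr M F\<^esub> fil.cls x = fil.cls (conv a x)"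
proof
  fix n
  interpret G: comm_group "gr_piece M F n" by (rule fil.gr_piece_comm_group)
  have t: "a i \<star> x (n - i) \<in> F n" if "i \<le> n" for i
    using F_smult[OF pow.reps_mem[OF a, of i] fil.reps_mem[OF x, of "n - i"]] that by simp
  have c: "(\<Union>r\<in>pow.cls a i. \<Union>y\<in>fil.cls x (n - i). F (Suc n) +>\<^bsub>M\<^esub> r \<star> y) =
      F (Suc n) +>\<^bsub>M\<^esub> a i \<star> x (n - i)" if "i \<le> n" for i
    using coset_smult[OF pow.reps_mem[OF a, of i] fil.reps_mem[OF x, of "n - i"]] that
    by (simp add: coset_seq_def)
  have "(pow.cls a \<odot>\<^bsub>gr M F\<^esub> fil.cls x) n = finprod (gr_piece M F n)
      (\<lambda>i. \<Union>r\<in>pow.cls a i. \<Union>y\<in>fil.cls x (n - i). F (Suc n) +>\<^bsub>M\<^esub> r \<star> y) {..n}"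
    by (simp add: gr_def gr_prod_def)
  also have "\<dots> = finprod (gr_piece M F n) (\<lambda>i. F (Suc n) +>\<^bsub>M\<^esub> a i \<star> x (n - i)) {..n}"
    using t c by (intro G.finprod_cong') (auto simp: fil.gr_piece_carrier)
  also have "\<dots> = fil.cls (conv a x) n"
    using t by (simp add: fil.gr_piece_finprod coset_seq_def conv_def)
  finally show "(pow.cls a \<odot>\<^bsub>gr M F\<^esub> fil.cls x) n = fil.cls (conv a x) n" .
qed

abbreviation "G \<equiv> gr (regular_module R) P"
abbreviation "GM \<equiv> gr M F"

lemma gr_mult:
  assumes "a \<in> pow.reps" "b \<in> pow.reps"
  shows "pow.cls a \<otimes>\<^bsub>G\<^esub> pow.cls b = pow.cls (\<lambda>n. \<Oplus>i\<in>{..n}. a i \<otimes> b (n - i))"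
    "(\<lambda>n. \<Oplus>i\<in>{..n}. a i \<otimes> b (n - i)) \<in> pow.reps"
proof -
  interpret reg: adic_module R "regular_module R" I
    rewrites "adic_submodule R I (regular_module R) = ideal_power R I"
    using regular_adic R.ideal_power_as_adic[OF ideal_I] by simp_all
  have "reg.conv a b = (\<lambda>n. \<Oplus>i\<in>{..n}. a i \<otimes> b (n - i))" by (simp add: reg.conv_def)
  moreover have "pow.cls a \<otimes>\<^bsub>G\<^esub> pow.cls b = pow.cls a \<odot>\<^bsub>G\<^esub> pow.cls b"
    by (simp add: gr_def)
  ultimately show "pow.cls a \<otimes>\<^bsub>G\<^esub> pow.cls b = pow.cls (\<lambda>n. \<Oplus>i\<in>{..n}. a i \<otimes> b (n - i))"
    "(\<lambda>n. \<Oplus>i\<in>{..n}. a i \<otimes> b (n - i)) \<in> pow.reps"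
    using reg.gr_smult[OF assms] reg.conv_reps[OF assms] by simp_all
qed

lemma gr_one: "\<one>\<^bsub>G\<^esub> = pow.cls (pow.single 0 \<one>)" "pow.single 0 \<one> \<in> pow.reps"
proof -
  show "\<one>\<^bsub>G\<^esub> = pow.cls (pow.single 0 \<one>)"
    using pow.gr_class_eq[of 0 \<one>] by (simp add: gr_def)
  show "pow.single 0 \<one> \<in> pow.reps" by (rule pow.single_reps) simp
qed

lemma pow_reps_carrier: "a \<in> pow.reps \<Longrightarrow> a n \<in> carrier R"
  using pow.reps_carrier by simp

lemma pow_single: "pow.single d a = (\<lambda>n. if n = d then a else \<zero>)"
  by (rule ext) (simp add: pow.single_def)

lemma gr_smult_one:
  assumes "x \<in> fil.reps" shows "\<one>\<^bsub>G\<^esub> \<odot>\<^bsub>GM\<^esub> fil.cls x = fil.cls x"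
proof -
  have "conv (pow.single 0 \<one>) x = x"
    unfolding pow_single using assms by (intro ext) (simp add: conv_single_left fil.reps_carrier)
  then show ?thesis using gr_smult[OF gr_one(2) assms] by (simp add: gr_one(1))
qed

lemma gr_smult_l_distr:
  assumes "a \<in> pow.reps" "b \<in> pow.reps" "x \<in> fil.reps"
  shows "(pow.cls a \<oplus>\<^bsub>G\<^esub> pow.cls b) \<odot>\<^bsub>GM\<^esub> fil.cls x =
    (pow.cls a \<odot>\<^bsub>GM\<^esub> fil.cls x) \<oplus>\<^bsub>GM\<^esub> (pow.cls b \<odot>\<^bsub>GM\<^esub> fil.cls x)"
  using assms pow.gr_add[OF assms(1,2)] pow.add_reps[OF assms(1,2)]
  by (simp add: gr_smult fil.gr_add conv_reps conv_add_left pow_reps_carrier fil.reps_carrier)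

lemma gr_smult_r_distr:
  assumes "a \<in> pow.reps" "x \<in> fil.reps" "y \<in> fil.reps"
  shows "pow.cls a \<odot>\<^bsub>GM\<^esub> (fil.cls x \<oplus>\<^bsub>GM\<^esub> fil.cls y) =
    (pow.cls a \<odot>\<^bsub>GM\<^esub> fil.cls x) \<oplus>\<^bsub>GM\<^esub> (pow.cls a \<odot>\<^bsub>GM\<^esub> fil.cls y)"
  using assms
  by (simp add: gr_smult fil.gr_add fil.add_reps conv_reps conv_add_right pow_reps_carrier fil.reps_carrier)

lemma gr_smult_assoc:
  assumes "a \<in> pow.reps" "b \<in> pow.reps" "x \<in> fil.reps"
  shows "(pow.cls a \<otimes>\<^bsub>G\<^esub> pow.cls b) \<odot>\<^bsub>GM\<^esub> fil.cls x =
    pow.cls a \<odot>\<^bsub>GM\<^esub> (pow.cls b \<odot>\<^bsub>GM\<^esub> fil.cls x)"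
proof -
  have "conv (\<lambda>n. \<Oplus>i\<in>{..n}. a i \<otimes> b (n - i)) x = conv a (conv b x)"
    by (rule ext) (use assms conv_assoc pow_reps_carrier fil.reps_carrier in blast)
  then show ?thesis using assms by (simp add: gr_smult gr_mult conv_reps)
qed

text \<open>The associated graded ring is the associated graded module of \<open>R\<close> over itself, so most ring
  laws are instances of the module laws; commutativity is that of convolution.\<close>

lemma gr_cring: "cring G"
proof -
  interpret reg: adic_module R "regular_module R" I
    rewrites "adic_submodule R I (regular_module R) = ideal_power R I"
    using regular_adic R.ideal_power_as_adic[OF ideal_I] by simp_all
  interpret A: abelian_group G by (rule pow.gr_abelian_group)
  have sm: "smult G = monoid.mult G" by (simp add: gr_def)
  have comm: "u \<otimes>\<^bsub>G\<^esub> v = v \<otimes>\<^bsub>G\<^esub> u" if uv: "u \<in> carrier G" "v \<in> carrier G" for u v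
  proof -
    obtain a where a: "a \<in> pow.reps" "u = pow.cls a" using pow.gr_carrierE[OF uv(1)] by blast
    obtain b where b: "b \<in> pow.reps" "v = pow.cls b" using pow.gr_carrierE[OF uv(2)] by blast
    have "(\<Oplus>i\<in>{..n}. a i \<otimes> b (n - i)) = (\<Oplus>i\<in>{..n}. b i \<otimes> a (n - i))" for n
      using a b by (intro R.conv_comm) (auto simp: pow_reps_carrier)
    then show ?thesis using a b by (simp add: gr_mult(1))
  qed
  have one: "\<one>\<^bsub>G\<^esub> \<otimes>\<^bsub>G\<^esub> u = u" if u: "u \<in> carrier G" for u
  proof -
    obtain a where a: "a \<in> pow.reps" "u = pow.cls a" using pow.gr_carrierE[OF u] by blast
    show ?thesis using reg.gr_smult_one[OF a(1)] a(2) by (simp add: sm)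
  qed
  have closed: "u \<otimes>\<^bsub>G\<^esub> v \<in> carrier G" if uv: "u \<in> carrier G" "v \<in> carrier G" for u v
  proof -
    obtain a where a: "a \<in> pow.reps" "u = pow.cls a" using pow.gr_carrierE[OF uv(1)] by blast
    obtain b where b: "b \<in> pow.reps" "v = pow.cls b" using pow.gr_carrierE[OF uv(2)] by blast
    show ?thesis using gr_mult[OF a(1) b(1)] a(2) b(2) pow.cls_closed by simp
  qed
  have one_closed: "\<one>\<^bsub>G\<^esub> \<in> carrier G" using gr_one pow.cls_closed by simp
  show ?thesis
  proof (rule cringI)
    show "abelian_group G" ..
    show "Group.comm_monoid G"
    proof (rule comm_monoidI)
      fix u v w assume "u \<in> carrier G" "v \<in> carrier G" "w \<in> carrier G"
      then obtain a b c where "a \<in> pow.reps" "u = pow.cls a" "b \<in> pow.reps" "v = pow.cls b"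
        "c \<in> pow.reps" "w = pow.cls c" using pow.gr_carrierE by metis
      then show "u \<otimes>\<^bsub>G\<^esub> v \<otimes>\<^bsub>G\<^esub> w = u \<otimes>\<^bsub>G\<^esub> (v \<otimes>\<^bsub>G\<^esub> w)"
        using reg.gr_smult_assoc[of a b c] by (simp add: sm)
    qed (use closed one one_closed comm in auto)
    fix u v w assume "u \<in> carrier G" "v \<in> carrier G" "w \<in> carrier G"
    then obtain a b c where "a \<in> pow.reps" "u = pow.cls a" "b \<in> pow.reps" "v = pow.cls b"
      "c \<in> pow.reps" "w = pow.cls c" using pow.gr_carrierE by metis
    then show "(u \<oplus>\<^bsub>G\<^esub> v) \<otimes>\<^bsub>G\<^esub> w = u \<otimes>\<^bsub>G\<^esub> w \<oplus>\<^bsub>G\<^esub> v \<otimes>\<^bsub>G\<^esub> w"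
      using reg.gr_smult_l_distr[of a b c] by (simp add: sm)
  qed
qed

lemma gr_is_module: "module G GM"
proof (rule moduleI)
  show "cring G" by (rule gr_cring)
  show "abelian_group GM" by (rule fil.gr_abelian_group)
next
  fix u x assume "u \<in> carrier G" "x \<in> carrier GM"
  then obtain a y where "a \<in> pow.reps" "u = pow.cls a" "y \<in> fil.reps" "x = fil.cls y"
    using pow.gr_carrierE fil.gr_carrierE by metis
  then show "u \<odot>\<^bsub>GM\<^esub> x \<in> carrier GM"
    by (simp add: gr_smult conv_reps fil.cls_closed)
next
  fix u v x assume "u \<in> carrier G" "v \<in> carrier G" "x \<in> carrier GM"
  then obtain a b y where r: "a \<in> pow.reps" "u = pow.cls a" "b \<in> pow.reps" "v = pow.cls b"
      "y \<in> fil.reps" "x = fil.cls y"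
    using pow.gr_carrierE fil.gr_carrierE by metis
  show "(u \<oplus>\<^bsub>G\<^esub> v) \<odot>\<^bsub>GM\<^esub> x = u \<odot>\<^bsub>GM\<^esub> x \<oplus>\<^bsub>GM\<^esub> v \<odot>\<^bsub>GM\<^esub> x"
    using r gr_smult_l_distr by simp
  show "(u \<otimes>\<^bsub>G\<^esub> v) \<odot>\<^bsub>GM\<^esub> x = u \<odot>\<^bsub>GM\<^esub> (v \<odot>\<^bsub>GM\<^esub> x)"
    using r gr_smult_assoc by simp
next
  fix u x y assume "u \<in> carrier G" "x \<in> carrier GM" "y \<in> carrier GM"
  then obtain a x' y' where "a \<in> pow.reps" "u = pow.cls a" "x' \<in> fil.reps" "x = fil.cls x'"
      "y' \<in> fil.reps" "y = fil.cls y'"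
    using pow.gr_carrierE fil.gr_carrierE by metis
  then show "u \<odot>\<^bsub>GM\<^esub> (x \<oplus>\<^bsub>GM\<^esub> y) = u \<odot>\<^bsub>GM\<^esub> x \<oplus>\<^bsub>GM\<^esub> u \<odot>\<^bsub>GM\<^esub> y"
    using gr_smult_r_distr by simp
next
  fix x assume "x \<in> carrier GM"
  then show "\<one>\<^bsub>G\<^esub> \<odot>\<^bsub>GM\<^esub> x = x" using fil.gr_carrierE gr_smult_one by metis
qed

abbreviation "gR \<equiv> gr_class (regular_module R) P"
abbreviation "gM \<equiv> gr_class M F"

lemma gr_class_smult:
  assumes "a \<in> P i" "x \<in> F j"
  shows "gR i a \<odot>\<^bsub>GM\<^esub> gM j x = gM (i + j) (a \<star> x)"
proof -
  have "conv (pow.single i a) (fil.single j x) = fil.single (i + j) (a \<star> x)"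
    unfolding pow_single using P_carrier[OF assms(1)] F_carrier[OF assms(2)]
    by (intro ext) (auto simp: conv_single_left fil.single_def)
  then show ?thesis
    using gr_smult[OF pow.single_reps[OF assms(1)] fil.single_reps[OF assms(2)]]
    by (simp add: pow.gr_class_eq fil.gr_class_eq)
qed

lemma gr_class_mult:
  assumes "a \<in> P i" "b \<in> P j"
  shows "gR i a \<otimes>\<^bsub>G\<^esub> gR j b = gR (i + j) (a \<otimes> b)"
proof -
  interpret reg: adic_module R "regular_module R" I
    rewrites "adic_submodule R I (regular_module R) = ideal_power R I"
    using regular_adic R.ideal_power_as_adic[OF ideal_I] by simp_all
  show ?thesis using reg.gr_class_smult[OF assms] by (simp add: gr_def)
qed

abbreviation "DG \<equiv> gr_degree (regular_module R) P"
abbreviation "DM \<equiv> gr_degree M F"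

lemma gr_graded_pair: "graded_pair G (DG) GM (DM)"
proof -
  interpret GMod: module G GM by (rule gr_is_module)
  show ?thesis
  proof (intro graded_pair.intro graded_scalars.intro graded_pair_axioms.intro graded_scalars_axioms.intro)
    show "cring G" by (rule gr_cring)
    show "module G GM" by (rule gr_is_module)
    show "a \<in> carrier G" if "a \<in> DG i" for a i
      using that by (simp add: gr_degree_def)
    show "m \<in> carrier GM" if "m \<in> DM i" for m i
      using that by (simp add: gr_degree_def)
    show "a \<otimes>\<^bsub>G\<^esub> b \<in> DG (i + j)"
      if "a \<in> DG i" "b \<in> DG j" for a b i j
      using that P_mult by (auto simp: pow.gr_degree_eq gr_class_mult)
    show "a \<odot>\<^bsub>GM\<^esub> m \<in> DM (i + j)"
      if "a \<in> DG i" "m \<in> DM j" for a m i j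
      using that F_smult by (auto simp: pow.gr_degree_eq fil.gr_degree_eq gr_class_smult)
    show "\<one>\<^bsub>G\<^esub> \<in> DG 0"
      unfolding pow.gr_degree_eq by (auto simp: gr_def)
    show "\<zero>\<^bsub>G\<^esub> \<in> DG i" for i
      using GMod.R.zero_closed by (simp add: gr_degree_def) (simp add: gr_def)
    show "\<zero>\<^bsub>GM\<^esub> \<in> DM i" for i
      using GMod.M.zero_closed by (simp add: gr_degree_def) (simp add: gr_def)
  qed
qed

end

section \<open>Homogeneous primes of the associated graded ring and the blowup\<close>

context adic_module
begin

lemma DG_subset: "(\<Union>n. DG n) \<subseteq> carrier G"
  by (auto simp: gr_degree_def)

lemma gR_mem_DG: "a \<in> P n \<Longrightarrow> gR n a \<in> DG n"
  by (simp add: pow.gr_degree_eq)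

lemma cls_upd:
  assumes "a \<in> pow.reps"
  shows "a(N := \<zero>) \<in> pow.reps" "pow.cls a = pow.cls (a(N := \<zero>)) \<oplus>\<^bsub>G\<^esub> gR N (a N)"
proof -
  obtain B where B: "\<forall>n\<ge>B. a n \<in> P (Suc n)" using pow.reps_bound[OF assms] by blast
  show r: "a(N := \<zero>) \<in> pow.reps"
    by (rule pow.repsI[of _ B]) (use B pow.reps_mem[OF assms] pow.filt_zero in auto)
  have "(\<lambda>n. (a(N := \<zero>)) n \<oplus> pow.single N (a N) n) = a"
    using pow_reps_carrier[OF assms] by (auto simp: pow_single)
  then show "pow.cls a = pow.cls (a(N := \<zero>)) \<oplus>\<^bsub>G\<^esub> gR N (a N)"
    using pow.gr_add[OF r pow.single_reps[OF pow.reps_mem[OF assms, of N]]]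
    by (simp add: pow.gr_class_eq)
qed

lemma gR_zero_eq: "gR n \<zero> = \<zero>\<^bsub>G\<^esub>"
  using pow.gr_class_zero_iff[of \<zero> n] pow.filt_zero by simp

lemma cls_mem_if_components:
  assumes z: "\<zero>\<^bsub>G\<^esub> \<in> J" and add: "\<And>u v. \<lbrakk>u \<in> J; v \<in> J\<rbrakk> \<Longrightarrow> u \<oplus>\<^bsub>G\<^esub> v \<in> J"
    and a: "a \<in> pow.reps" "\<And>n. gR n (a n) \<in> J"
  shows "pow.cls a \<in> J"
proof -
  obtain B where "\<forall>n\<ge>B. a n \<in> P (Suc n)" using pow.reps_bound[OF a(1)] by blast
  then show ?thesis using a
  proof (induction B arbitrary: a)
    case 0
    then have "pow.cls a = \<zero>\<^bsub>G\<^esub>"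
      using pow.cls_eq_iff[OF 0(2) pow.zero_reps] pow_reps_carrier[OF 0(2)] R.minus_zero
      by (simp add: pow.gr_zero a_minus_def)
    then show ?case using z by simp
  next
    case (Suc B)
    have "(a(B := \<zero>)) n \<in> P (Suc n)" if "n \<ge> B" for n
      using Suc.prems(1)[rule_format, of n] that pow.filt_zero by (cases "n = B") auto
    moreover have "gR n ((a(B := \<zero>)) n) \<in> J" for n using Suc.prems(3) gR_zero_eq z by simp
    ultimately have "pow.cls (a(B := \<zero>)) \<in> J" using Suc.IH[OF _ cls_upd(1)[OF Suc.prems(2)]] by blast
    then show ?case using cls_upd(2)[OF Suc.prems(2)] add Suc.prems(3) by metis
  qed
qed

text \<open>The elements all of whose components lie in a homogeneous ideal form an ideal; it contains the
  homogeneous generators, hence the whole ideal.\<close>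

lemma homogeneous_cls_mem_iff:
  assumes p: "homogeneous_ideal G DG p" and a: "a \<in> pow.reps"
  shows "pow.cls a \<in> p \<longleftrightarrow> (\<forall>n. gR n (a n) \<in> p)"
proof
  interpret GR: cring G by (rule gr_cring)
  have id: "ideal p G" using p by (simp add: homogeneous_ideal_def)
  note zp = ideal_zero[OF id]
    and ap = ideal_add[OF id]
  {
    assume "\<forall>n. gR n (a n) \<in> p"
    then show "pow.cls a \<in> p" using cls_mem_if_components[of p a] zp ap a by blast
  }
  define cmp where "cmp n u = (\<lambda>k. if k = n then u k else P (Suc k))" for n and u :: "nat \<Rightarrow> 'a set"
  have cmp: "cmp n (pow.cls a) = gR n (a n)" for n a
    by (rule ext) (simp add: cmp_def gr_class_def coset_seq_def)
  have sum: "gR n (\<Oplus>i\<in>{..k}. t i) \<in> p"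
    if "\<And>i. i \<le> k \<Longrightarrow> t i \<in> P n" "\<And>i. i \<le> k \<Longrightarrow> gR n (t i) \<in> p" for n t and k :: nat
    using that
  proof (induction k)
    case 0 then show ?case using P_carrier by simp
  next
    case (Suc k)
    have tc: "t \<in> {..Suc k} \<rightarrow> carrier R" using Suc.prems P_carrier by auto
    have "(\<Oplus>i\<in>{..k}. t i) \<in> P n" using pow.finsum_mem[of k t n] Suc.prems(1) by simp
    then have "gR n (t (Suc k) \<oplus> (\<Oplus>i\<in>{..k}. t i)) = gR n (t (Suc k)) \<oplus>\<^bsub>G\<^esub> gR n (\<Oplus>i\<in>{..k}. t i)"
      using pow.gr_class_add Suc.prems(1) by simp
    then show ?case using tc Suc ap by simp
  qed
  define J where "J = {u \<in> carrier G. \<forall>n. cmp n u \<in> p}"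
  have J: "pow.cls a \<in> J \<longleftrightarrow> (\<forall>n. gR n (a n) \<in> p)" if "a \<in> pow.reps" for a
    using that pow.cls_closed by (simp add: J_def cmp)
  have "ideal J G"
  proof (rule GR.ideal_if_closed)
    show "J \<subseteq> carrier G" by (simp add: J_def)
    have "pow.cls (\<lambda>n. \<zero>) \<in> J" using J[of "\<lambda>n. \<zero>"] pow.zero_reps gR_zero_eq zp by simp
    then show "J \<noteq> {}" by blast
  next
    fix u v assume "u \<in> J" "v \<in> J"
    then obtain a b where a: "a \<in> pow.reps" "u = pow.cls a" and b: "b \<in> pow.reps" "v = pow.cls b"
      using pow.gr_carrierE unfolding J_def by (metis (no_types, lifting) mem_Collect_eq)
    have "gR n (a n \<oplus> b n) \<in> p" for n
    proof -
      have "gR n (a n) \<oplus>\<^bsub>G\<^esub> gR n (b n) \<in> p"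
        using J[OF a(1)] J[OF b(1)] \<open>u \<in> J\<close> \<open>v \<in> J\<close> unfolding a(2) b(2) by (blast intro: ap)
      then show ?thesis
        using pow.gr_class_add[OF pow.reps_mem[OF a(1)] pow.reps_mem[OF b(1)]] by simp
    qed
    then show "u \<oplus>\<^bsub>G\<^esub> v \<in> J"
      using pow.gr_add[OF a(1) b(1)] pow.add_reps[OF a(1) b(1)] J a b by simp
  next
    fix u r assume "u \<in> J" "r \<in> carrier G"
    then obtain a b where a: "a \<in> pow.reps" "u = pow.cls a" and b: "b \<in> pow.reps" "r = pow.cls b"
      using pow.gr_carrierE unfolding J_def by (metis (no_types, lifting) mem_Collect_eq)
    have "gR n (\<Oplus>i\<in>{..n}. b i \<otimes> a (n - i)) \<in> p" for n
    proof (rule sum)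
      fix i assume i: "i \<le> n"
      show "b i \<otimes> a (n - i) \<in> P n"
        using P_mult[OF pow.reps_mem[OF b(1), of i] pow.reps_mem[OF a(1), of "n - i"]] i by simp
      have "gR (n - i) (a (n - i)) \<in> p" using \<open>u \<in> J\<close> J a by simp
      then have "gR i (b i) \<otimes>\<^bsub>G\<^esub> gR (n - i) (a (n - i)) \<in> p"
        using ideal.I_l_closed[OF id] pow.gr_class_closed pow.reps_mem[OF b(1)] by blast
      then show "gR n (b i \<otimes> a (n - i)) \<in> p"
        using gr_class_mult[OF pow.reps_mem[OF b(1), of i] pow.reps_mem[OF a(1), of "n - i"]] i by simp
    qed
    then show "r \<otimes>\<^bsub>G\<^esub> u \<in> J"
      using gr_mult[OF b(1) a(1)] J a b by simp
  qed
  moreover have "p \<inter> (\<Union>n. DG n) \<subseteq> J"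
  proof
    fix u assume u: "u \<in> p \<inter> (\<Union>n. DG n)"
    then obtain d a where a: "a \<in> P d" "u = gR d a" by (auto simp: pow.gr_degree_eq)
    have "gR n (pow.single d a n) \<in> p" for n
      using u a gR_zero_eq zp by (simp add: pow_single)
    then show "u \<in> J" using J[OF pow.single_reps[OF a(1)]] a(2) by (simp add: pow.gr_class_eq)
  qed
  ultimately have "p \<subseteq> J"
    using GR.genideal_minimal p unfolding homogeneous_ideal_def by blast
  then show "pow.cls a \<in> p \<Longrightarrow> \<forall>n. gR n (a n) \<in> p" using J[OF a] by blast
qed

abbreviation "B \<equiv> rees R I"

lemma UP_cring_R: "UP_cring R"
  by (rule UP_cring.intro) (rule R.is_cring)

lemma UP_coeff: "b \<in> carrier (UP R) \<Longrightarrow> coeff (UP R) b n = b n"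
  by (simp add: UP_def)

lemma rees_carrier: "b \<in> carrier B \<longleftrightarrow> b \<in> carrier (UP R) \<and> (\<forall>n. b n \<in> P n)"
  by (auto simp: rees_def UP_coeff)

lemma rees_reps: assumes "b \<in> carrier B" shows "b \<in> pow.reps"
proof -
  have b: "b \<in> up R" "\<And>n. b n \<in> P n" using assms by (auto simp: rees_carrier UP_def)
  then obtain N where "\<And>n. N < n \<Longrightarrow> b n = \<zero>" by (auto simp: up_def bound_def)
  then show ?thesis using b(2) pow.filt_zero by (intro pow.repsI[of _ "Suc N"]) auto
qed

lemma rees_to_gr_cls: "b \<in> carrier B \<Longrightarrow> rees_to_gr R I b = pow.cls b"
  by (rule ext) (simp add: rees_to_gr_def rees_carrier UP_coeff coset_seq_def)

lemma rees_mult: "\<lbrakk>b \<in> carrier B; c \<in> carrier B\<rbrakk> \<Longrightarrow> b \<otimes>\<^bsub>B\<^esub> c = (\<lambda>n. \<Oplus>i\<in>{..n}. b i \<otimes> c (n - i))"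
  by (simp add: rees_carrier) (simp add: rees_def UP_def)

lemma rees_add: "\<lbrakk>b \<in> carrier B; c \<in> carrier B\<rbrakk> \<Longrightarrow> b \<oplus>\<^bsub>B\<^esub> c = (\<lambda>n. b n \<oplus> c n)"
  by (simp add: rees_carrier) (simp add: rees_def UP_def)

lemma rees_one: "\<one>\<^bsub>B\<^esub> = pow.single 0 \<one>"
  by (simp add: rees_def UP_def pow_single)

lemma rees_monom: "a \<in> P d \<Longrightarrow> monom (UP R) a d = pow.single d a \<and> pow.single d a \<in> carrier B"
proof -
  assume a: "a \<in> P d"
  have "pow.single d a \<in> up R" using P_carrier[OF a] by (auto simp: up_def pow_single)
  then show ?thesis
    using P_carrier[OF a] a pow.filt_zero
    by (auto simp: rees_carrier UP_def pow_single)
qed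

lemma rees_cring: "cring B"
proof -
  interpret U: UP_cring R "UP R" by (rule UP_cring_R)
  let ?H = "{b \<in> carrier (UP R). \<forall>n. coeff (UP R) b n \<in> P n}"
  have "subring ?H (UP R)"
  proof (rule U.P.subringI)
    show "\<one>\<^bsub>UP R\<^esub> \<in> ?H" using pow.filt_zero by simp
    show "\<ominus>\<^bsub>UP R\<^esub> h \<in> ?H" if "h \<in> ?H" for h using that pow.filt_inv by simp
    show "h1 \<oplus>\<^bsub>UP R\<^esub> h2 \<in> ?H" if "h1 \<in> ?H" "h2 \<in> ?H" for h1 h2 using that pow.filt_add by simp
    show "h1 \<otimes>\<^bsub>UP R\<^esub> h2 \<in> ?H" if h: "h1 \<in> ?H" "h2 \<in> ?H" for h1 h2
    proof -
      have "(\<Oplus>i\<in>{..n}. coeff (UP R) h1 i \<otimes> coeff (UP R) h2 (n - i)) \<in> P n" for n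
      proof -
        have "coeff (UP R) h1 i \<otimes> coeff (UP R) h2 (n - i) \<in> P n" if "i \<le> n" for i
          using P_mult[of "coeff (UP R) h1 i" i "coeff (UP R) h2 (n - i)" "n - i"] h that by simp
        then show ?thesis using pow.finsum_mem[of n _ n] by simp
      qed
      then show ?thesis using h by simp
    qed
  qed auto
  then have "subcring ?H (UP R)" by (rule U.P.subcringI')
  then show ?thesis unfolding rees_def using U.P.subcring_iff[of ?H] by auto
qed

text \<open>An element of the Rees algebra is itself a family of representatives, and both products are
  convolutions.\<close>

lemma rees_to_gr_hom: "ring_hom_ring B G (rees_to_gr R I)"
proof (rule ring_hom_ringI)
  show "ring B" using rees_cring by (rule cring.axioms)
  show "ring G" using gr_cring by (rule cring.axioms)
  interpret BR: cring B by (rule rees_cring)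
  show "rees_to_gr R I b \<in> carrier G" if "b \<in> carrier B" for b
    using that by (simp add: rees_to_gr_cls rees_reps pow.cls_closed)
  show "rees_to_gr R I (b \<otimes>\<^bsub>B\<^esub> c) = rees_to_gr R I b \<otimes>\<^bsub>G\<^esub> rees_to_gr R I c"
    if "b \<in> carrier B" "c \<in> carrier B" for b c
    using that BR.m_closed[OF that] by (simp add: rees_to_gr_cls gr_mult rees_reps) (simp add: rees_mult)
  show "rees_to_gr R I (b \<oplus>\<^bsub>B\<^esub> c) = rees_to_gr R I b \<oplus>\<^bsub>G\<^esub> rees_to_gr R I c"
    if "b \<in> carrier B" "c \<in> carrier B" for b c
    using that BR.a_closed[OF that] by (simp add: rees_to_gr_cls pow.gr_add rees_reps) (simp add: rees_add)
  show "rees_to_gr R I \<one>\<^bsub>B\<^esub> = \<one>\<^bsub>G\<^esub>"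
    using BR.one_closed by (simp add: rees_to_gr_cls gr_one) (simp add: rees_one)
qed

lemma monom_mem_exc_embedding:
  "a \<in> P d \<Longrightarrow> monom (UP R) a d \<in> exc_embedding R I p \<longleftrightarrow> gR d a \<in> p"
  using rees_monom by (simp add: exc_embedding_def rees_to_gr_cls pow.gr_class_eq)

lemma not_irrelevantE:
  assumes "p \<in> Proj G DG"
  obtains e h where "e \<ge> 1" "h \<in> P e" "gR e h \<notin> p"
proof -
  interpret GR: cring G by (rule gr_cring)
  have id: "ideal p G" and n: "\<not> irrelevant_ideal G DG \<subseteq> p"
    using assms by (auto simp: Proj_def primeideal.axioms)
  have "\<not> (\<Union>n\<in>{1..}. DG n) \<subseteq> p"
    using n GR.genideal_minimal[OF id] unfolding irrelevant_ideal_def by blast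
  then show thesis using that by (auto simp: pow.gr_degree_eq)
qed

text \<open>Only homogeneity takes an argument: the elements of the inverse image are sums of monomials, and these
  lie in it because a homogeneous ideal contains the components of its elements.\<close>

lemma exc_embedding_Proj:
  assumes p: "p \<in> Proj G DG"
  shows "exc_embedding R I p \<in> Proj B (rees_degree R I)"
proof -
  interpret BR: cring B by (rule rees_cring)
  have pr: "primeideal p G" and hom: "homogeneous_ideal G DG p"
    using p by (auto simp: Proj_def)
  have pr': "primeideal (exc_embedding R I p) B"
    unfolding exc_embedding_def
    by (rule ring_hom_ring.primeideal_vimage[OF rees_to_gr_hom rees_cring pr])
  then have id': "ideal (exc_embedding R I p) B" by (rule primeideal.axioms)
  have zp: "\<zero>\<^bsub>G\<^esub> \<in> p"
    using ideal_zero[OF primeideal.axioms(1)[OF pr]] .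
  define A where "A = exc_embedding R I p \<inter> (\<Union>n. rees_degree R I n)"
  have Ac: "A \<subseteq> carrier B" by (auto simp: A_def exc_embedding_def)
  have idA: "ideal (Idl\<^bsub>B\<^esub> A) B" using Ac by (rule BR.genideal_ideal)
  have step: "b \<in> Idl\<^bsub>B\<^esub> A"
    if "b \<in> carrier B" "\<forall>n\<ge>N. b n = \<zero>" "\<forall>n. gR n (b n) \<in> p" for b N
    using that
  proof (induction N arbitrary: b)
    case 0
    then have "b = \<zero>\<^bsub>B\<^esub>" by (auto simp: rees_def UP_def)
    then show ?case using ideal_zero[OF idA] by simp
  next
    case (Suc N)
    have bN: "b N \<in> P N" using Suc.prems(1) by (simp add: rees_carrier)
    have b': "b(N := \<zero>) \<in> carrier B"
    proof -
      have "bound \<zero> N (b(N := \<zero>))" using Suc.prems(2) by (auto simp: bound_def)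
      then have "b(N := \<zero>) \<in> up R"
        using Suc.prems(1) by (auto simp: rees_carrier UP_def up_def)
      then show ?thesis using Suc.prems(1) pow.filt_zero by (auto simp: rees_carrier UP_def)
    qed
    have "(b(N := \<zero>)) n = \<zero>" if "n \<ge> N" for n
      using Suc.prems(2)[rule_format, of n] that by (cases "n = N") auto
    then have "b(N := \<zero>) \<in> Idl\<^bsub>B\<^esub> A"
      by (intro Suc.IH[OF b']) (use Suc.prems(3) gR_zero_eq zp in auto)
    moreover have "monom (UP R) (b N) N \<in> A"
      using monom_mem_exc_embedding[OF bN] Suc.prems(3) bN by (auto simp: A_def rees_degree_def)
    then have "monom (UP R) (b N) N \<in> Idl\<^bsub>B\<^esub> A" using BR.genideal_self[OF Ac] by blast
    moreover have "b = b(N := \<zero>) \<oplus>\<^bsub>B\<^esub> monom (UP R) (b N) N"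
      using rees_monom[OF bN] b' pow_reps_carrier[OF rees_reps[OF Suc.prems(1)]]
      by (intro ext) (simp add: rees_add pow_single)
    ultimately show ?case
      using ideal_add[OF idA] by metis
  qed
  have "exc_embedding R I p \<subseteq> Idl\<^bsub>B\<^esub> A"
  proof
    fix b assume "b \<in> exc_embedding R I p"
    then have b: "b \<in> carrier B" "pow.cls b \<in> p" by (auto simp: exc_embedding_def rees_to_gr_cls)
    then have "b \<in> up R" by (simp add: rees_carrier UP_def)
    then obtain N where "\<And>n. N < n \<Longrightarrow> b n = \<zero>" by (auto simp: up_def bound_def)
    then show "b \<in> Idl\<^bsub>B\<^esub> A"
      using step[of b "Suc N"] b homogeneous_cls_mem_iff[OF hom rees_reps[OF b(1)]]
      by (simp add: Suc_le_eq)
  qed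
  moreover have "Idl\<^bsub>B\<^esub> A \<subseteq> exc_embedding R I p"
    by (rule BR.genideal_minimal[OF id']) (auto simp: A_def)
  ultimately have hom': "homogeneous_ideal B (rees_degree R I) (exc_embedding R I p)"
    using id' unfolding homogeneous_ideal_def A_def by blast
  obtain e h where h: "e \<ge> 1" "h \<in> P e" "gR e h \<notin> p" using not_irrelevantE[OF p] .
  have "rees_degree R I n \<subseteq> carrier B" for n
    using rees_monom by (auto simp: rees_degree_def)
  then have "(\<Union>n\<in>{1..}. rees_degree R I n) \<subseteq> irrelevant_ideal B (rees_degree R I)"
    unfolding irrelevant_ideal_def by (intro BR.genideal_self) blast
  moreover have "monom (UP R) h e \<in> rees_degree R I e" using h by (auto simp: rees_degree_def)
  ultimately have "monom (UP R) h e \<in> irrelevant_ideal B (rees_degree R I)" using h(1) by auto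
  then have "\<not> irrelevant_ideal B (rees_degree R I) \<subseteq> exc_embedding R I p"
    using monom_mem_exc_embedding[OF h(2), of p] h(3) by blast
  then show ?thesis using pr' hom' by (simp add: Proj_def)
qed

lemma exc_embedding_weak_transform_iff:
  assumes p: "p \<in> Proj G DG" and f: "f \<in> P s"
  shows "exc_embedding R I p \<in> weak_transform_supp R I s f \<longleftrightarrow> gR s f \<in> p"
proof -
  interpret BR: cring B by (rule rees_cring)
  have pr': "exc_embedding R I p \<in> Proj B (rees_degree R I)" by (rule exc_embedding_Proj[OF p])
  then have "ideal (exc_embedding R I p) B" by (simp add: Proj_def primeideal.axioms)
  moreover have "monom (UP R) f s \<in> carrier B" using rees_monom[OF f] by simp
  ultimately have "PIdl\<^bsub>B\<^esub> (monom (UP R) f s) \<subseteq> exc_embedding R I p \<longleftrightarrow>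
      monom (UP R) f s \<in> exc_embedding R I p"
    using BR.cgenideal_minimal BR.cgenideal_self by blast
  then show ?thesis
    using pr' monom_mem_exc_embedding[OF f] by (simp add: weak_transform_supp_def Proj_zeros_def)
qed

abbreviation "Ass_points \<equiv> associated_points (Proj G DG) (Proj_opens G DG)
  (proj_structure_sheaf G DG) (proj_sheaf G DG GM DM)"

lemma weak_transform_disjoint_iff:
  assumes "f \<in> P s"
  shows "weak_transform_supp R I s f \<inter> Ass_gr_sheaf R I M = {} \<longleftrightarrow> (\<forall>p\<in>Ass_points. gR s f \<notin> p)"
proof -
  have "Ass_points \<subseteq> Proj G DG" by (auto simp: associated_points_def)
  then show ?thesis
    using exc_embedding_weak_transform_iff[OF _ assms]
    unfolding Ass_gr_sheaf_def exc_associated_points_def by blast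
qed

text \<open>The homogeneous elements of \<open>G\<close> and \<open>GM\<close> are the classes of elements of \<open>I^n\<close> and of \<open>I^n M\<close>, so
  the criterion for associated points descends to \<open>R\<close> and \<open>M\<close>.\<close>

lemma Ass_points_iff:
  "p \<in> Ass_points \<longleftrightarrow> p \<in> Proj G DG \<and> (\<exists>d. \<exists>x\<in>F d. (\<exists>g\<in>P d. gR d g \<notin> p) \<and>
    (\<forall>e. \<forall>a\<in>P e. (\<exists>b\<in>P e. gR e b \<notin> p) \<longrightarrow>
      ((\<exists>j. \<exists>h\<in>P j. gR j h \<notin> p \<and> h \<star> (a \<star> x) \<in> F (Suc (j + (e + d)))) \<longleftrightarrow> gR e a \<in> p)))"
proof -
  interpret GP: graded_pair G DG GM DM by (rule gr_graded_pair)
  have D: "DG e - p \<noteq> {} \<longleftrightarrow> (\<exists>b\<in>P e. gR e b \<notin> p)" for e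
    by (auto simp: pow.gr_degree_eq)
  have H: "(\<exists>h\<in>(\<Union>n. DG n) - p. h \<odot>\<^bsub>GM\<^esub> (gR e a \<odot>\<^bsub>GM\<^esub> gM d x) = \<zero>\<^bsub>GM\<^esub>) \<longleftrightarrow>
      (\<exists>j. \<exists>h\<in>P j. gR j h \<notin> p \<and> h \<star> (a \<star> x) \<in> F (Suc (j + (e + d))))"
    if "a \<in> P e" "x \<in> F d" for a e x d
  proof -
    have "gR j h \<odot>\<^bsub>GM\<^esub> (gR e a \<odot>\<^bsub>GM\<^esub> gM d x) = \<zero>\<^bsub>GM\<^esub> \<longleftrightarrow>
        h \<star> (a \<star> x) \<in> F (Suc (j + (e + d)))" if h: "h \<in> P j" for h j
    proof -
      have ax: "a \<star> x \<in> F (e + d)" using F_smult \<open>a \<in> P e\<close> \<open>x \<in> F d\<close> .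
      show ?thesis
        using fil.gr_class_zero_iff[OF F_smult[OF h ax]]
        by (simp add: gr_class_smult \<open>a \<in> P e\<close> \<open>x \<in> F d\<close> h ax)
    qed
    then show ?thesis unfolding pow.gr_degree_eq by blast
  qed
  have ball: "(\<forall>a\<in>DG e. X a) \<longleftrightarrow> (\<forall>a\<in>P e. X (gR e a))" for X e
    by (simp add: pow.gr_degree_eq)
  have bex: "(\<exists>m\<in>DM d. X m) \<longleftrightarrow> (\<exists>x\<in>F d. X (gM d x))" for X d
    by (simp add: fil.gr_degree_eq)
  show ?thesis
    unfolding GP.associated_points_iff D ball bex
    by (intro conj_cong refl ex_cong1 bex_cong all_cong1 ball_cong imp_cong) (simp add: H)
qed

text \<open>Multiplication by the initial form is additive, so injectivity is a statement about its kernel;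
  \<open>d\<close> is the degree of the source.\<close>

lemma superficial_iff:
  assumes f: "f \<in> P s"
  shows "superficial R I M s f \<longleftrightarrow>
    (\<exists>n0. \<forall>d\<ge>n0. \<forall>x\<in>F d. f \<star> x \<in> F (Suc (s + d)) \<longrightarrow> x \<in> F (Suc d))"
proof -
  have inj: "inj_on (\<lambda>u. initial_form R I s f \<odot>\<^bsub>GM\<^esub> u) (DM d) \<longleftrightarrow>
     (\<forall>x\<in>F d. f \<star> x \<in> F (Suc (s + d)) \<longrightarrow> x \<in> F (Suc d))" (is "?L \<longleftrightarrow> ?Rt") for d
  proof -
    have fc: "f \<in> carrier R" using P_carrier[OF f] .
    have eq: "initial_form R I s f \<odot>\<^bsub>GM\<^esub> gM d x = gM (s + d) (f \<star> x)" if "x \<in> F d" for x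
      using gr_class_smult[OF f that] by (simp add: initial_form_def)
    have "?L \<longleftrightarrow> (\<forall>x\<in>F d. \<forall>y\<in>F d. gM (s + d) (f \<star> x) = gM (s + d) (f \<star> y) \<longrightarrow> gM d x = gM d y)"
      unfolding inj_on_def fil.gr_degree_eq by (auto simp: eq)
    also have "\<dots> \<longleftrightarrow> (\<forall>x\<in>F d. \<forall>y\<in>F d. f \<star> (x \<ominus>\<^bsub>M\<^esub> y) \<in> F (Suc (s + d)) \<longrightarrow> x \<ominus>\<^bsub>M\<^esub> y \<in> F (Suc d))"
    proof -
      have "gM (s + d) (f \<star> x) = gM (s + d) (f \<star> y) \<longleftrightarrow> f \<star> (x \<ominus>\<^bsub>M\<^esub> y) \<in> F (Suc (s + d))"
        if "x \<in> F d" "y \<in> F d" for x y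
      proof -
        have "f \<star> x \<ominus>\<^bsub>M\<^esub> f \<star> y = f \<star> (x \<ominus>\<^bsub>M\<^esub> y)"
          using that[THEN F_carrier] fc by (simp add: a_minus_def smult_r_distr smult_r_minus)
        then show ?thesis
          using fil.gr_class_eq_iff[OF F_smult[OF f that(1)] F_smult[OF f that(2)]] by simp
      qed
      then show ?thesis by (simp add: fil.gr_class_eq_iff)
    qed
    also have "\<dots> \<longleftrightarrow> ?Rt"
    proof
      assume A: "\<forall>x\<in>F d. \<forall>y\<in>F d. f \<star> (x \<ominus>\<^bsub>M\<^esub> y) \<in> F (Suc (s + d)) \<longrightarrow> x \<ominus>\<^bsub>M\<^esub> y \<in> F (Suc d)"
      have "x \<ominus>\<^bsub>M\<^esub> \<zero>\<^bsub>M\<^esub> = x" if "x \<in> F d" for x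
        using F_carrier[OF that] by (simp add: a_minus_def fil.minus_zero_eq)
      then show ?Rt using A fil.filt_zero by metis
    qed (use fil.filt_minus in blast)
    finally show ?thesis .
  qed
  have "superficial R I M s f \<longleftrightarrow> (\<exists>n0. \<forall>n\<ge>n0. s \<le> n \<longrightarrow>
     (\<forall>x\<in>F (n - s). f \<star> x \<in> F (Suc (s + (n - s))) \<longrightarrow> x \<in> F (Suc (n - s))))"
    unfolding superficial_def inj ..
  also have "\<dots> \<longleftrightarrow> (\<exists>n0. \<forall>d\<ge>n0. \<forall>x\<in>F d. f \<star> x \<in> F (Suc (s + d)) \<longrightarrow> x \<in> F (Suc d))"
    (is "(\<exists>n0. \<forall>n\<ge>n0. s \<le> n \<longrightarrow> ?Q (n - s)) \<longleftrightarrow> _")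
  proof (intro iffI; elim exE)
    fix n0 assume A: "\<forall>n\<ge>n0. s \<le> n \<longrightarrow> ?Q (n - s)"
    have "?Q d" if "d \<ge> n0" for d
      using A[rule_format, of "d + s"] that by simp
    then show "\<exists>n0. \<forall>d\<ge>n0. ?Q d" by blast
  next
    fix n0 assume A: "\<forall>d\<ge>n0. ?Q d"
    then have "\<forall>n\<ge>n0 + s. s \<le> n \<longrightarrow> ?Q (n - s)" by simp
    then show "\<exists>n0. \<forall>n\<ge>n0. s \<le> n \<longrightarrow> ?Q (n - s)" by blast
  qed
  finally show ?thesis .
qed


lemma gR_prime_mult_iff:
  assumes p: "primeideal p G" and a: "a \<in> P i" and b: "b \<in> P j"
  shows "gR (i + j) (a \<otimes> b) \<in> p \<longleftrightarrow> gR i a \<in> p \<or> gR j b \<in> p"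
proof -
  have c: "gR i a \<in> carrier G" "gR j b \<in> carrier G"
    using pow.gr_class_closed a b by blast+
  have id: "ideal p G" using p by (rule primeideal.axioms)
  have "gR i a \<otimes>\<^bsub>G\<^esub> gR j b \<in> p \<longleftrightarrow> gR i a \<in> p \<or> gR j b \<in> p"
    using primeideal.I_prime[OF p c] ideal.I_r_closed[OF id] ideal.I_l_closed[OF id] c by blast
  then show ?thesis by (simp add: gr_class_mult a b)
qed

lemma gR_one_not_mem: "primeideal p G \<Longrightarrow> gR 0 \<one> \<notin> p"
proof
  assume p: "primeideal p G" and "gR 0 \<one> \<in> p"
  then have "\<one>\<^bsub>G\<^esub> \<in> p" by (simp add: gr_one(1) pow.gr_class_eq)
  then show False
    using ideal.one_imp_carrier[OF primeideal.axioms(1)[OF p]] primeideal.I_notcarr[OF p] by blast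
qed

lemma P_pow: "a \<in> P i \<Longrightarrow> a [^] (k::nat) \<in> P (k * i)"
proof (induction k)
  case 0 then show ?case by simp
next
  case (Suc k)
  then have "a [^] k \<otimes> a \<in> P (k * i + i)" by (intro P_mult) auto
  then show ?case by (simp add: add.commute)
qed

lemma gR_pow_mem_iff:
  assumes p: "primeideal p G" and a: "a \<in> P i" and k: "k > 0"
  shows "gR (k * i) (a [^] (k::nat)) \<in> p \<longleftrightarrow> gR i a \<in> p"
  using k
proof (induction k rule: nat_induct_non_zero)
  case 1 then show ?case using P_carrier[OF a] by simp
next
  case (Suc k)
  then show ?case
    using gR_prime_mult_iff[OF p P_pow[OF a] a, of k] by (simp add: add.commute)
qed

lemma gR_pow_not_mem:
  "\<lbrakk>primeideal p G; a \<in> P i; gR i a \<notin> p\<rbrakk> \<Longrightarrow> gR (k * i) (a [^] (k::nat)) \<notin> p"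
  using gR_pow_mem_iff[of p a i k] gR_one_not_mem[of p] by (cases k) auto

section \<open>Superficial elements avoid the associated points\<close>

text \<open>Let \<open>x\<close> be an element of degree \<open>d\<close> whose annihilator near \<open>p\<close> is \<open>p\<close>, and \<open>h\<close> homogeneous of
  positive degree \<open>e\<close> outside \<open>p\<close>. If the initial form of \<open>f\<close> lay in \<open>p\<close>, some \<open>h'\<close> outside
  \<open>p\<close> would satisfy \<open>h' f^e x = 0\<close> in the associated graded module; the exponent \<open>e\<close> makes the
  fraction \<open>f^e / h^s\<close> homogeneous of degree zero. After multiplication by a power of \<open>h\<close> the
  degree is so large that \<open>f\<close> acts injectively, and already \<open>h^k h' x = 0\<close>, so \<open>x\<close> is zero
  near \<open>p\<close>.\<close>

lemma superficial_imp_not_mem: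
  assumes f: "f \<in> P s"
    and n0: "\<And>d x. \<lbrakk>d \<ge> n0; x \<in> F d; f \<star> x \<in> F (Suc (s + d))\<rbrakk> \<Longrightarrow> x \<in> F (Suc d)"
    and p: "p \<in> Ass_points"
  shows "gR s f \<notin> p"
proof
  assume fp: "gR s f \<in> p"
  have pP: "p \<in> Proj G DG" using p Ass_points_iff by blast
  then have pr: "primeideal p G" by (simp add: Proj_def)
  obtain d x where x: "x \<in> F d" and ann: "\<And>e a b. \<lbrakk>a \<in> P e; b \<in> P e; gR e b \<notin> p\<rbrakk> \<Longrightarrow>
      (\<exists>j. \<exists>h\<in>P j. gR j h \<notin> p \<and> h \<star> (a \<star> x) \<in> F (Suc (j + (e + d)))) \<longleftrightarrow> gR e a \<in> p"
    using p unfolding Ass_points_iff by blast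
  obtain e h where h: "e \<ge> 1" "h \<in> P e" "gR e h \<notin> p" using not_irrelevantE[OF pP] .
  have fc: "f \<in> carrier R" and hc: "h \<in> carrier R" and xc: "x \<in> carrier M"
    using f h x P_carrier F_carrier by blast+
  have "gR (e * s) (f [^] e) \<in> p" using gR_pow_mem_iff[OF pr f, of e] fp h(1) by simp
  moreover have "h [^] s \<in> P (e * s)" "gR (e * s) (h [^] s) \<notin> p"
    using P_pow[OF h(2), of s] gR_pow_not_mem[OF pr h(2,3), of s] by (simp_all add: mult.commute)
  ultimately obtain j h' where h': "h' \<in> P j" "gR j h' \<notin> p"
      and z: "h' \<star> ((f [^] e) \<star> x) \<in> F (Suc (j + (e * s + d)))"
    using ann[OF P_pow[OF f, of e], of "h [^] s"] by blast
  have h'c: "h' \<in> carrier R" using h' P_carrier by blast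
  define g where "g = (h [^] n0) \<otimes> h'"
  define D where "D = n0 * e + j + d"
  have g: "g \<in> P (n0 * e + j)" "gR (n0 * e + j) g \<notin> p"
    unfolding g_def
    using P_mult[OF P_pow[OF h(2)] h'(1)] gR_prime_mult_iff[OF pr P_pow[OF h(2)] h'(1)]
      gR_pow_not_mem[OF pr h(2,3)] h'(2) by blast+
  have gx: "g \<star> x \<in> F D" using F_smult[OF g(1) x] by (simp add: D_def)
  \<comment> \<open>the power of \<open>h\<close> was chosen as \<open>n0\<close> because \<open>h\<close> has positive degree\<close>
  have D: "D \<ge> n0" using h(1) by (simp add: D_def trans_le_add1)
  have "(f [^] e) \<star> (g \<star> x) = (h [^] n0) \<star> (h' \<star> ((f [^] e) \<star> x))"
    unfolding g_def using fc hc h'c xc by (simp add: smult_assoc1[symmetric] m_ac)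
  moreover have "\<dots> \<in> F (n0 * e + Suc (j + (e * s + d)))"
    by (rule F_smult[OF P_pow[OF h(2)] z])
  ultimately have fe: "(f [^] e) \<star> (g \<star> x) \<in> F (Suc (e * s + D))"
    by (simp add: D_def algebra_simps)
  have "(f [^] i) \<star> (g \<star> x) \<in> F (Suc (i * s + D)) \<Longrightarrow> g \<star> x \<in> F (Suc D)" for i :: nat
  proof (induction i)
    case 0 then show ?case using F_carrier[OF gx] by simp
  next
    case (Suc i)
    have y: "(f [^] i) \<star> (g \<star> x) \<in> F (i * s + D)" using F_smult[OF P_pow[OF f] gx] .
    have "(f [^] Suc i) \<star> (g \<star> x) = f \<star> ((f [^] i) \<star> (g \<star> x))"
      using fc F_carrier[OF gx] by (simp add: smult_assoc1[symmetric] m_comm)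
    then have "f \<star> ((f [^] i) \<star> (g \<star> x)) \<in> F (Suc (s + (i * s + D)))"
      using Suc.prems by (simp add: algebra_simps)
    then have "(f [^] i) \<star> (g \<star> x) \<in> F (Suc (i * s + D))"
      using n0[OF _ y] D by simp
    then show ?case by (rule Suc.IH)
  qed
  then have "g \<star> x \<in> F (Suc D)" using fe by blast
  then have "g \<star> (\<one> \<star> x) \<in> F (Suc ((n0 * e + j) + (0 + d)))" using xc by (simp add: D_def)
  then have "gR 0 \<one> \<in> p" using ann[of \<one> 0 \<one>] gR_one_not_mem[OF pr] g by auto
  then show False using gR_one_not_mem[OF pr] by blast
qed

section \<open>Torsion with respect to the irrelevant ideal\<close>

text \<open>The representatives of degree \<open>n\<close> that are annihilated by the component of degree \<open>k\<close> of
  the associated graded ring.\<close>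

definition tors :: "nat \<Rightarrow> nat \<Rightarrow> 'c set" where
  "tors k n = {x \<in> F n. \<forall>a\<in>P k. a \<star> x \<in> F (Suc (k + n))}"

lemma tors_0: "tors 0 n = F (Suc n)"
proof
  show "tors 0 n \<subseteq> F (Suc n)"
  proof
    fix x assume "x \<in> tors 0 n"
    then have "\<one> \<star> x \<in> F (Suc n)" "x \<in> carrier M" using F_carrier by (auto simp: tors_def)
    then show "x \<in> F (Suc n)" by simp
  qed
  show "F (Suc n) \<subseteq> tors 0 n"
    using F_Suc_subset submoduleE(4)[OF F_submodule] by (auto simp: tors_def)
qed

text \<open>The products of elements of \<open>I^k\<close> and of \<open>I\<close> generate \<open>I^(k + 1)\<close>.\<close>

lemma tors_SucI:
  assumes x: "x \<in> F n" and a: "\<And>a b. \<lbrakk>a \<in> P k; b \<in> I\<rbrakk> \<Longrightarrow> (a \<otimes> b) \<star> x \<in> F (Suc (Suc k + n))"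
  shows "x \<in> tors (Suc k) n"
proof -
  have "c \<star> x \<in> F (Suc (Suc k + n))" if "c \<in> ideal_prod R (P k) I" for c
    using that
  proof (induction c rule: ideal_prod.induct)
    case (sum b c)
    have "b \<in> carrier R" "c \<in> carrier R"
      using sum R.ideal_prod_in_carrier[OF P_ideal ideal_I] by blast+
    then show ?case using sum fil.filt_add F_carrier[OF x] by (simp add: smult_l_distr)
  qed (rule a)
  then show ?thesis using x by (simp add: tors_def ideal_power_Suc)
qed

lemma tors_mono: "k \<le> l \<Longrightarrow> tors k n \<subseteq> tors l n"
proof (induction rule: dec_induct)
  case (step l)
  have "tors l n \<subseteq> tors (Suc l) n"
  proof
    fix x assume x: "x \<in> tors l n"
    then have xF: "x \<in> F n" by (simp add: tors_def)
    show "x \<in> tors (Suc l) n"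
    proof (rule tors_SucI[OF xF])
      fix a b assume a: "a \<in> P l" and b: "b \<in> I"
      have "(a \<otimes> b) \<star> x = b \<star> (a \<star> x)"
        using P_carrier[OF a] I_carrier[OF b] F_carrier[OF xF] by (simp add: smult_assoc1[symmetric] m_comm)
      moreover have "b \<star> (a \<star> x) \<in> F (Suc 0 + Suc (l + n))"
        using x a b by (intro F_smult) (auto simp: tors_def P_1)
      ultimately show "(a \<otimes> b) \<star> x \<in> F (Suc (Suc l + n))" by simp
    qed
  qed
  then show ?case using step.IH by blast
qed simp

lemma tors_smult:
  assumes a: "a \<in> P i" and x: "x \<in> tors k n" shows "a \<star> x \<in> tors k (i + n)"
proof -
  have xF: "x \<in> F n" and xk: "\<And>b. b \<in> P k \<Longrightarrow> b \<star> x \<in> F (Suc (k + n))"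
    using x by (auto simp: tors_def)
  have "b \<star> (a \<star> x) \<in> F (Suc (k + (i + n)))" if b: "b \<in> P k" for b
  proof -
    have "b \<star> (a \<star> x) = a \<star> (b \<star> x)"
      using P_carrier[OF a] P_carrier[OF b] F_carrier[OF xF] by (simp add: smult_assoc1[symmetric] m_comm)
    then show ?thesis using F_smult[OF a xk[OF b]] by (simp add: algebra_simps)
  qed
  then show ?thesis using F_smult[OF a xF] by (simp add: tors_def)
qed

lemma tors_submodule: "submodule (tors k n) R M"
proof (rule submoduleI)
  note FE = submoduleE[OF F_submodule]
  show "tors k n \<subseteq> carrier M" using F_carrier by (auto simp: tors_def)
  show "\<zero>\<^bsub>M\<^esub> \<in> tors k n" using P_carrier fil.filt_zero by (simp add: tors_def)
  show "\<ominus>\<^bsub>M\<^esub> x \<in> tors k n" if "x \<in> tors k n" for x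
    using that FE(3) P_carrier F_carrier by (auto simp: tors_def smult_r_minus)
  show "x \<boxplus> y \<in> tors k n" if "x \<in> tors k n" "y \<in> tors k n" for x y
    using that FE(5) P_carrier F_carrier by (auto simp: tors_def smult_r_distr)
  show "a \<star> x \<in> tors k n" if "a \<in> carrier R" "x \<in> tors k n" for a x
    using tors_smult[of a 0 x k n] that by simp
qed

text \<open>In the associated graded module, the elements that vanish when they are multiplied into degree \<open>j\<close>
  form a graded submodule, which grows with \<open>j\<close>. When this chain is stationary from \<open>j0\<close> on, torsion
  elements are killed by a power of the irrelevant ideal that does not depend on the element, and
  those of degree at least \<open>j0\<close> are zero, since \<open>j0 - n\<close> is then \<open>0\<close>.\<close>

lemma uniform_torsion:
  assumes acc: "acc_families I F"
  shows "\<exists>j0. \<forall>k n. tors k n \<subseteq> tors (j0 - n) n"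
proof -
  define C where "C j n = tors (j - n) n" for j n
  have "C j \<le> C (Suc j)" for j
    unfolding le_fun_def C_def using tors_mono by (simp add: diff_le_mono)
  then have mono: "mono C" by (simp add: mono_iff_le_Suc)
  have "closed_family I (C j) \<and> C j \<le> F" for j
  proof
    show "C j \<le> F" by (auto simp: le_fun_def C_def tors_def)
    show "closed_family I (C j)"
      unfolding closed_family_def C_def
    proof (intro conjI allI ballI)
      fix n a x assume a: "a \<in> I" and x: "x \<in> tors (j - n) n"
      have a1: "a \<in> P (Suc 0)" using a P_1 by simp
      have xF: "x \<in> F n" using x by (simp add: tors_def)
      have aF: "a \<star> x \<in> F (Suc n)" using F_smult[OF a1 xF] by simp
      show "a \<star> x \<in> tors (j - Suc n) (Suc n)"
      proof (cases "n < j")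
        case True
        then have k: "j - n = Suc (j - Suc n)" by simp
        have "b \<star> (a \<star> x) \<in> F (Suc (j - Suc n + Suc n))" if b: "b \<in> P (j - Suc n)" for b
        proof -
          have "b \<otimes> a \<in> P (j - n)" using P_mult[OF b a1] k by simp
          then have "(b \<otimes> a) \<star> x \<in> F (Suc (j - n + n))" using x by (simp add: tors_def)
          then show ?thesis
            using P_carrier[OF b] I_carrier[OF a] F_carrier[OF xF] k by (simp add: smult_assoc1)
        qed
        then show ?thesis using aF by (simp add: tors_def)
      next
        case False
        then have "x \<in> F (Suc n)" using x tors_0 by simp
        then show ?thesis using F_smult[OF a1, of x "Suc n"] False by (simp add: tors_0)
      qed
    qed (rule tors_submodule)
  qed
  then obtain j0 where j0: "\<forall>j\<ge>j0. C j = C j0"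
    using acc mono unfolding acc_families_def by blast
  have "tors k n \<subseteq> tors (j0 - n) n" for k n
  proof -
    have "tors k n \<subseteq> C (max j0 (k + n)) n" unfolding C_def by (rule tors_mono) simp
    also have "\<dots> = C j0 n" using j0[rule_format, of "max j0 (k + n)"] by simp
    finally show ?thesis by (simp add: C_def)
  qed
  then show ?thesis by blast
qed

section \<open>Existence of associated points\<close>

lemma ideal_finsum_closed:
  assumes J: "ideal J R" and A: "finite A" "\<And>i. i \<in> A \<Longrightarrow> t i \<in> J"
  shows "(\<Oplus>i\<in>A. t i) \<in> J"
  using A
proof (induction rule: finite_induct)
  case empty
  then show ?case using ideal_zero[OF J] by simp
next
  case (insert i A)
  then show ?case
    using ideal_add[OF J] ideal.Icarr[OF J]
    by (subst R.finsum_insert) auto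
qed

text \<open>In a product of two elements outside the ideal, the product of their lowest components outside it
  survives modulo the ideal. So primality can be tested on homogeneous elements, where it is a
  condition on the components \<open>Q n\<close>.\<close>

lemma prime_family_Proj:
  assumes Q: "\<And>n. ideal (Q n) R" and PQ: "\<And>n. P (Suc n) \<subseteq> Q n" and QP: "\<And>n. Q n \<subseteq> P n"
    and mult: "\<And>a b i j. \<lbrakk>a \<in> P i; b \<in> Q j\<rbrakk> \<Longrightarrow> a \<otimes> b \<in> Q (i + j)"
    and prime: "\<And>a b i j. \<lbrakk>a \<in> P i; b \<in> P j; a \<otimes> b \<in> Q (i + j); a \<notin> Q i\<rbrakk> \<Longrightarrow> b \<in> Q j"
    and h: "h \<in> I" "h \<notin> Q (Suc 0)"
  defines "p \<equiv> {u \<in> carrier G. \<forall>n. u n \<subseteq> Q n}"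
  shows "p \<in> Proj G DG" and "a \<in> P n \<Longrightarrow> gR n a \<in> p \<longleftrightarrow> a \<in> Q n"
proof -
  interpret GR: cring G by (rule gr_cring)
  have Q0: "\<zero> \<in> Q n" for n using ideal_zero[OF Q] .
  have Qadd: "a \<in> Q n \<Longrightarrow> b \<in> Q n \<Longrightarrow> a \<oplus> b \<in> Q n" for a b n
    using ideal_add[OF Q] .
  have Qinv: "a \<in> Q n \<Longrightarrow> \<ominus> a \<in> Q n" for a n
    using ideal_neg[OF Q] .
  have Qc: "a \<in> Q n \<Longrightarrow> a \<in> carrier R" for a n using ideal.Icarr[OF Q] .
  have cls: "pow.cls a \<in> p \<longleftrightarrow> (\<forall>n. a n \<in> Q n)" if a: "a \<in> pow.reps" for a
  proof -
    have "P (Suc n) +> a n \<subseteq> Q n \<longleftrightarrow> a n \<in> Q n" for n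
    proof -
      have "additive_subgroup (Q n) (regular_module R)"
        using ideal.axioms(1)[OF Q, of n] by (simp add: additive_subgroup_def subgroup_def m_inv_def)
      then show ?thesis using pow.coset_subset[of "a n" "Q n" "Suc n"] pow_reps_carrier[OF a] PQ by simp
    qed
    then show ?thesis using pow.cls_closed[OF a] by (simp add: p_def coset_seq_def)
  qed
  show gR: "gR n a \<in> p \<longleftrightarrow> a \<in> Q n" if a: "a \<in> P n" for n a
  proof -
    have "gR n a \<in> p \<longleftrightarrow> (\<forall>k. pow.single n a k \<in> Q k)"
      unfolding pow.gr_class_eq by (rule cls[OF pow.single_reps[OF a]])
    then show ?thesis using Q0 by (auto simp: pow_single)
  qed
  have pc: "p \<subseteq> carrier G" by (auto simp: p_def)
  have pz: "\<zero>\<^bsub>G\<^esub> \<in> p" using cls[OF pow.zero_reps] Q0 by (simp add: pow.gr_zero)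
  have id: "ideal p G"
  proof (rule GR.ideal_if_closed[OF pc])
    show "p \<noteq> {}" using pz by blast
  next
    fix u v assume uv: "u \<in> p" "v \<in> p"
    obtain a where a: "a \<in> pow.reps" "u = pow.cls a" using uv pc pow.gr_carrierE by blast
    obtain b where b: "b \<in> pow.reps" "v = pow.cls b" using uv pc pow.gr_carrierE by blast
    show "u \<oplus>\<^bsub>G\<^esub> v \<in> p"
      using uv cls[OF a(1)] cls[OF b(1)] cls[OF pow.add_reps[OF a(1) b(1)]] Qadd
        pow.gr_add[OF a(1) b(1)] a(2) b(2) by simp
  next
    fix u r assume u: "u \<in> p" and r: "r \<in> carrier G"
    obtain a where a: "a \<in> pow.reps" "u = pow.cls a" using u pc pow.gr_carrierE by blast
    obtain b where b: "b \<in> pow.reps" "r = pow.cls b" using r pow.gr_carrierE by blast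
    have "(\<Oplus>i\<in>{..n}. b i \<otimes> a (n - i)) \<in> Q n" for n
    proof (rule ideal_finsum_closed[OF Q])
      fix i assume "i \<in> {..n}"
      moreover have "a (n - i) \<in> Q (n - i)" using u cls[OF a(1)] a(2) by simp
      ultimately show "b i \<otimes> a (n - i) \<in> Q n"
        using mult[of "b i" i "a (n - i)" "n - i"] pow.reps_mem[OF b(1)] by simp
    qed simp
    then show "r \<otimes>\<^bsub>G\<^esub> u \<in> p"
      using gr_mult[OF b(1) a(1)] cls a(2) b(2) by simp
  qed
  have h1: "h \<in> P (Suc 0)" "gR (Suc 0) h \<notin> p" using h gR[of h "Suc 0"] P_1 by auto
  have pr: "primeideal p G"
  proof (rule primeidealI[OF id gr_cring])
    show "carrier G \<noteq> p" using h1 pow.gr_class_closed by blast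
    fix u v assume u: "u \<in> carrier G" and v: "v \<in> carrier G" and uv: "u \<otimes>\<^bsub>G\<^esub> v \<in> p"
    obtain a where a: "a \<in> pow.reps" "u = pow.cls a" using u pow.gr_carrierE by blast
    obtain b where b: "b \<in> pow.reps" "v = pow.cls b" using v pow.gr_carrierE by blast
    have ac: "a n \<in> carrier R" "b n \<in> carrier R" for n using a b pow_reps_carrier by blast+
    have conv: "(\<Oplus>k\<in>{..n}. a k \<otimes> b (n - k)) \<in> Q n" for n
      using uv gr_mult[OF a(1) b(1)] cls a(2) b(2) by simp
    show "u \<in> p \<or> v \<in> p"
    proof (rule ccontr)
      assume "\<not> (u \<in> p \<or> v \<in> p)"
      then have ex: "\<exists>i. a i \<notin> Q i" "\<exists>j. b j \<notin> Q j" using cls a b by auto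
      define i where "i = (LEAST i. a i \<notin> Q i)"
      define j where "j = (LEAST j. b j \<notin> Q j)"
      have i: "a i \<notin> Q i" "\<And>k. k < i \<Longrightarrow> a k \<in> Q k"
        using LeastI_ex[OF ex(1)] not_less_Least unfolding i_def by blast+
      have j: "b j \<notin> Q j" "\<And>k. k < j \<Longrightarrow> b k \<in> Q k"
        using LeastI_ex[OF ex(2)] not_less_Least unfolding j_def by blast+
      define r where "r = (\<Oplus>k\<in>{..i + j} - {i}. a k \<otimes> b (i + j - k))"
      have r: "r \<in> Q (i + j)"
        unfolding r_def
      proof (rule ideal_finsum_closed[OF Q])
        fix k assume k: "k \<in> {..i + j} - {i}"
        show "a k \<otimes> b (i + j - k) \<in> Q (i + j)"
        proof (cases "k < i")
          case True
          then have "b (i + j - k) \<otimes> a k \<in> Q (i + j - k + k)"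
            using mult[OF pow.reps_mem[OF b(1)] i(2)] by blast
          then show ?thesis using True ac by (simp add: m_comm)
        next
          case False
          then have "i + j - k < j" "k \<le> i + j" using k by auto
          then show ?thesis using mult[OF pow.reps_mem[OF a(1), of k] j(2)] by fastforce
        qed
      qed simp
      have "(\<Oplus>k\<in>insert i ({..i + j} - {i}). a k \<otimes> b (i + j - k)) = a i \<otimes> b (i + j - i) \<oplus> r"
        unfolding r_def using ac by (intro R.finsum_insert) auto
      moreover have "insert i ({..i + j} - {i}) = {..i + j}" by auto
      ultimately have s: "a i \<otimes> b j \<oplus> r \<in> Q (i + j)" using conv[of "i + j"] by simp
      have "a i \<otimes> b j = (a i \<otimes> b j \<oplus> r) \<oplus> \<ominus> r"
        using ac Qc[OF r] by (simp add: R.a_assoc R.r_neg)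
      then have "a i \<otimes> b j \<in> Q (i + j)" using Qadd[OF s Qinv[OF r]] by simp
      then show False
        using prime[OF pow.reps_mem[OF a(1)] pow.reps_mem[OF b(1)]] i(1) j(1) by blast
    qed
  qed
  have DGp: "p \<inter> (\<Union>n. DG n) \<subseteq> carrier G" using pc by blast
  have "p \<subseteq> Idl\<^bsub>G\<^esub> (p \<inter> (\<Union>n. DG n))"
  proof
    fix u assume u: "u \<in> p"
    obtain a where a: "a \<in> pow.reps" "u = pow.cls a" using u pc pow.gr_carrierE by blast
    have idI: "ideal (Idl\<^bsub>G\<^esub> (p \<inter> (\<Union>n. DG n))) G" using DGp by (rule GR.genideal_ideal)
    have "gR n (a n) \<in> p \<inter> (\<Union>n. DG n)" for n
      using u cls[OF a(1)] a gR[OF pow.reps_mem[OF a(1)]] gR_mem_DG[OF pow.reps_mem[OF a(1)]] by auto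
    then have "gR n (a n) \<in> Idl\<^bsub>G\<^esub> (p \<inter> (\<Union>n. DG n))" for n
      using GR.genideal_self[OF DGp] by blast
    then show "u \<in> Idl\<^bsub>G\<^esub> (p \<inter> (\<Union>n. DG n))"
      unfolding a(2)
      by (intro cls_mem_if_components[OF _ _ a(1)])
        (use ideal_zero[OF idI]
          ideal_add[OF idI] in auto)
  qed
  moreover have "Idl\<^bsub>G\<^esub> (p \<inter> (\<Union>n. DG n)) \<subseteq> p" by (rule GR.genideal_minimal[OF id]) auto
  ultimately have hom: "homogeneous_ideal G DG p" using id by (auto simp: homogeneous_ideal_def)
  have "(\<Union>n\<in>{1..}. DG n) \<subseteq> irrelevant_ideal G DG"
    unfolding irrelevant_ideal_def using DG_subset by (intro GR.genideal_self) blast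
  then have "gR (Suc 0) h \<in> irrelevant_ideal G DG" using gR_mem_DG[OF h1(1)] by auto
  then show "p \<in> Proj G DG" using pr hom h1(2) by (auto simp: Proj_def)
qed

lemma ex_maximal_family:
  assumes acc: "acc_families I F" and X: "X \<noteq> {}"
    and X': "\<And>K. K \<in> X \<Longrightarrow> closed_family I K \<and> K \<le> F"
  shows "\<exists>K\<in>X. \<forall>K'\<in>X. K \<le> K' \<longrightarrow> K' = K"
proof (rule ccontr)
  assume "\<not> ?thesis"
  then have "\<forall>K\<in>X. \<exists>K'\<in>X. K < K'" by (metis order_le_less)
  then obtain nxt where nxt: "\<And>K. K \<in> X \<Longrightarrow> nxt K \<in> X \<and> K < nxt K" by metis
  obtain K0 where K0: "K0 \<in> X" using X by blast
  define C where "C i = (nxt ^^ i) K0" for i :: nat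
  have CX: "C i \<in> X" for i by (induction i) (auto simp: C_def K0 nxt)
  have lt: "C i < C (Suc i)" for i using nxt[OF CX[of i]] by (simp add: C_def)
  then have "mono C" by (simp add: mono_iff_le_Suc less_imp_le)
  then obtain i0 where "\<forall>i\<ge>i0. C i = C i0" using acc X'[OF CX] unfolding acc_families_def by blast
  then have "C (Suc i0) = C i0" by (rule allE[of _ "Suc i0"]) simp
  then show False using lt[of i0] by (metis less_irrefl)
qed

lemma regular_fg: "finitely_generated_module R (regular_module R)"
proof -
  interpret reg: adic_module R "regular_module R" I by (rule regular_adic)
  have "carrier R \<subseteq> module_span R (regular_module R) {\<one>}"
  proof
    fix a assume a: "a \<in> carrier R"
    have "submodule (module_span R (regular_module R) {\<one>}) R (regular_module R)"
      by (rule reg.module_span_submodule) simp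
    moreover have "\<one> \<in> module_span R (regular_module R) {\<one>}" using reg.module_span_superset by blast
    ultimately have "a \<odot>\<^bsub>regular_module R\<^esub> \<one> \<in> module_span R (regular_module R) {\<one>}"
      using reg.submoduleE(4) a by blast
    then show "a \<in> module_span R (regular_module R) {\<one>}" using a by simp
  qed
  moreover have "module_span R (regular_module R) {\<one>} \<subseteq> carrier R"
    using reg.module_span_least[OF reg.carrier_is_submodule, of "{\<one>}"] by simp
  ultimately show ?thesis
    unfolding finitely_generated_module_def by (intro exI[of _ "{\<one>}"]) auto
qed

lemma regular_acc:
  assumes noeth: "noetherian_ring R"
  shows "module.acc_families R (regular_module R) I P"
proof -
  interpret reg: adic_module R "regular_module R" I
    rewrites "adic_submodule R I (regular_module R) = ideal_power R I"
    using regular_adic R.ideal_power_as_adic[OF ideal_I] by simp_all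
  show ?thesis by (rule reg.rees_acc[OF noeth regular_fg])
qed

text \<open>The component of degree \<open>n\<close> of the homogeneous ideal of all elements that send the class of \<open>x\<close> in
  degree \<open>d\<close> to a torsion element, by representatives.\<close>

definition ann_tors :: "nat \<Rightarrow> 'c \<Rightarrow> nat \<Rightarrow> 'a set" where
  "ann_tors d x n = {a \<in> P n. \<exists>k. a \<star> x \<in> tors k (n + d)}"

lemma ann_tors_ideal:
  assumes x: "x \<in> F d" shows "ideal (ann_tors d x n) R"
proof (rule R.ideal_if_closed)
  have xc: "x \<in> carrier M" using F_carrier[OF x] .
  show "ann_tors d x n \<subseteq> carrier R" using P_carrier by (auto simp: ann_tors_def)
  have "\<zero> \<in> ann_tors d x n"
    using pow.filt_zero submodule_zero[OF tors_submodule] xc by (simp add: ann_tors_def)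
  then show "ann_tors d x n \<noteq> {}" by blast
  fix a assume "a \<in> ann_tors d x n"
  then obtain k where a: "a \<in> P n" "a \<star> x \<in> tors k (n + d)" by (auto simp: ann_tors_def)
  {
    fix b assume "b \<in> ann_tors d x n"
    then obtain l where b: "b \<in> P n" "b \<star> x \<in> tors l (n + d)" by (auto simp: ann_tors_def)
    have "a \<star> x \<boxplus> b \<star> x \<in> tors (max k l) (n + d)"
      using submoduleE(5)[OF tors_submodule] a(2) b(2) tors_mono[of k "max k l"] tors_mono[of l "max k l"]
      by (meson max.cobounded1 max.cobounded2 subsetD)
    then have "(a \<oplus> b) \<star> x \<in> tors (max k l) (n + d)"
      using P_carrier[OF a(1)] P_carrier[OF b(1)] xc by (simp add: smult_l_distr)
    then show "a \<oplus> b \<in> ann_tors d x n"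
      using pow.filt_add[of a n b] a b by (auto simp: ann_tors_def)
  }
  fix r assume r: "r \<in> carrier R"
  have "r \<star> (a \<star> x) \<in> tors k (n + d)" using submoduleE(4)[OF tors_submodule r a(2)] .
  then show "r \<otimes> a \<in> ann_tors d x n"
    using r a(1) P_carrier[OF a(1)] xc ideal.I_l_closed[OF P_ideal] by (auto simp: ann_tors_def smult_assoc1)
qed

lemma ann_tors_mult:
  assumes x: "x \<in> F d" and a: "a \<in> P i" and b: "b \<in> ann_tors d x j"
  shows "a \<otimes> b \<in> ann_tors d x (i + j)"
proof -
  obtain k where b: "b \<in> P j" "b \<star> x \<in> tors k (j + d)" using b by (auto simp: ann_tors_def)
  have "(a \<otimes> b) \<star> x = a \<star> (b \<star> x)"
    using P_carrier[OF a] P_carrier[OF b(1)] F_carrier[OF x] by (simp add: smult_assoc1)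
  then show ?thesis
    using tors_smult[OF a b(2)] P_mult[OF a b(1)] by (auto simp: ann_tors_def add.assoc)
qed

lemma ann_tors_closed_family:
  assumes x: "x \<in> F d"
  shows "module.closed_family R (regular_module R) I (ann_tors d x)"
proof -
  interpret reg: adic_module R "regular_module R" I by (rule regular_adic)
  have "submodule (ann_tors d x n) R (regular_module R)" for n
  proof (rule reg.submoduleI)
    note J = ann_tors_ideal[OF x, of n]
    show "ann_tors d x n \<subseteq> carrier (regular_module R)" using ideal.Icarr[OF J] by auto
  qed (use ideal_zero[OF ann_tors_ideal[OF x, of n]]
      ideal_add[OF ann_tors_ideal[OF x, of n]]
      ideal_neg[OF ann_tors_ideal[OF x, of n]]
      ideal.I_l_closed[OF ann_tors_ideal[OF x, of n]] in auto)
  moreover have "a \<otimes> b \<in> ann_tors d x (Suc n)" if "a \<in> I" "b \<in> ann_tors d x n" for a b n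
    using ann_tors_mult[OF x, of a "Suc 0" b n] that P_1 by simp
  ultimately show ?thesis by (simp add: reg.closed_family_def)
qed

text \<open>A maximal ideal among the \<^const>\<open>ann_tors\<close> of non-torsion elements killed by the initial form
  of \<open>f\<close> is prime, by the usual argument for maximal annihilators. Working modulo torsion keeps
  it away from the irrelevant ideal, so it is a point of \<^term>\<open>Proj G DG\<close>, and it is associated.\<close>

lemma ex_Ass_point:
  assumes noeth: "noetherian_ring R" and fg: "finitely_generated_module R M" and f: "f \<in> P s"
    and x0: "x0 \<in> F d0" "f \<star> x0 \<in> F (Suc (s + d0))" "\<And>k. x0 \<notin> tors k d0"
  shows "\<exists>p\<in>Ass_points. gR s f \<in> p"
proof -
  interpret reg: adic_module R "regular_module R" I
    rewrites "adic_submodule R I (regular_module R) = ideal_power R I"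
    using regular_adic R.ideal_power_as_adic[OF ideal_I] by simp_all
  define U where "U = {(d, x). x \<in> F d \<and> f \<star> x \<in> F (Suc (s + d)) \<and> (\<forall>k. x \<notin> tors k d)}"
  have "\<exists>K\<in>(\<lambda>(d, x). ann_tors d x) ` U. \<forall>K'\<in>(\<lambda>(d, x). ann_tors d x) ` U. K \<le> K' \<longrightarrow> K' = K"
  proof (rule reg.ex_maximal_family[OF regular_acc[OF noeth]])
    show "(\<lambda>(d, x). ann_tors d x) ` U \<noteq> {}" using x0 by (auto simp: U_def)
    fix K assume "K \<in> (\<lambda>(d, x). ann_tors d x) ` U"
    then show "reg.closed_family I K \<and> K \<le> ideal_power R I"
      using ann_tors_closed_family by (auto simp: U_def le_fun_def ann_tors_def)
  qed
  then obtain d x where x: "x \<in> F d" "f \<star> x \<in> F (Suc (s + d))" "\<And>k. x \<notin> tors k d"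
    and max: "\<And>d' x'. \<lbrakk>x' \<in> F d'; f \<star> x' \<in> F (Suc (s + d')); \<And>k. x' \<notin> tors k d';
       ann_tors d x \<le> ann_tors d' x'\<rbrakk> \<Longrightarrow> ann_tors d' x' = ann_tors d x"
    by (auto simp: U_def)
  let ?Q = "ann_tors d x"
  have fc: "f \<in> carrier R" and xc: "x \<in> carrier M" using P_carrier[OF f] F_carrier[OF x(1)] .
  have PQ: "P (Suc n) \<subseteq> ?Q n" for n
  proof
    fix a assume a: "a \<in> P (Suc n)"
    then have "a \<star> x \<in> tors 0 (n + d)" using F_smult[OF a x(1)] by (simp add: tors_0)
    then show "a \<in> ?Q n" using a P_Suc_subset by (auto simp: ann_tors_def)
  qed
  have prime: "b \<in> ?Q j" if a: "a \<in> P i" and b: "b \<in> P j" and ab: "a \<otimes> b \<in> ?Q (i + j)" and na: "a \<notin> ?Q i"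
    for a b i j
  proof -
    have ac: "a \<in> carrier R" "b \<in> carrier R" using P_carrier a b by blast+
    have "?Q \<le> ann_tors (i + d) (a \<star> x)"
    proof (rule le_funI, rule subsetI)
      fix n c assume "c \<in> ?Q n"
      then obtain k where c: "c \<in> P n" "c \<star> x \<in> tors k (n + d)" by (auto simp: ann_tors_def)
      have "c \<star> (a \<star> x) = a \<star> (c \<star> x)"
        using P_carrier[OF c(1)] ac xc by (simp add: smult_assoc1[symmetric] m_comm)
      moreover have "a \<star> (c \<star> x) \<in> tors k (n + (i + d))"
        using tors_smult[OF a c(2)] by (simp add: add.left_commute)
      ultimately show "c \<in> ann_tors (i + d) (a \<star> x) n" using c(1) by (auto simp: ann_tors_def)
    qed
    moreover have "a \<star> x \<in> F (i + d)" using F_smult[OF a x(1)] .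
    moreover have "f \<star> (a \<star> x) \<in> F (Suc (s + (i + d)))"
    proof -
      have "f \<star> (a \<star> x) = a \<star> (f \<star> x)"
        using ac fc xc by (simp add: smult_assoc1[symmetric] m_comm)
      then show ?thesis using F_smult[OF a x(2)] by (simp add: add.left_commute)
    qed
    moreover have "a \<star> x \<notin> tors k (i + d)" for k using na a by (auto simp: ann_tors_def)
    ultimately have eq: "ann_tors (i + d) (a \<star> x) = ?Q" by (intro max)
    obtain k where "(a \<otimes> b) \<star> x \<in> tors k (i + j + d)" using ab by (auto simp: ann_tors_def)
    then have "b \<star> (a \<star> x) \<in> tors k (j + (i + d))"
      using ac xc by (simp add: smult_assoc1[symmetric] m_comm add_ac)
    then have "b \<in> ann_tors (i + d) (a \<star> x) j" using b by (auto simp: ann_tors_def)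
    then show ?thesis using eq by simp
  qed
  obtain j0 where j0: "\<And>k n. tors k n \<subseteq> tors (j0 - n) n"
    using uniform_torsion[OF rees_acc[OF noeth fg]] by blast
  have "\<not> I \<subseteq> ?Q (Suc 0)"
  proof
    assume IQ: "I \<subseteq> ?Q (Suc 0)"
    have "x \<in> tors (Suc j0) d"
    proof (rule tors_SucI[OF x(1)])
      fix a b assume a: "a \<in> P j0" and b: "b \<in> I"
      obtain k where "b \<star> x \<in> tors k (Suc d)" using IQ b by (auto simp: ann_tors_def)
      then have "b \<star> x \<in> tors j0 (Suc d)"
        using j0[of k "Suc d"] tors_mono[of "j0 - Suc d" j0 "Suc d"] by auto
      then have "a \<star> (b \<star> x) \<in> F (Suc (j0 + Suc d))" using a by (simp add: tors_def)
      then show "(a \<otimes> b) \<star> x \<in> F (Suc (Suc j0 + d))"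
        using P_carrier[OF a] I_carrier[OF b] xc by (simp add: smult_assoc1)
    qed
    then show False using x(3) by blast
  qed
  then obtain h where h: "h \<in> I" "h \<notin> ?Q (Suc 0)" by blast
  define p where "p = {u \<in> carrier G. \<forall>n. u n \<subseteq> ?Q n}"
  have QP: "?Q n \<subseteq> P n" for n by (auto simp: ann_tors_def)
  have pP: "p \<in> Proj G DG"
    unfolding p_def by (rule prime_family_Proj(1)[of ?Q h])
      (fact ann_tors_ideal[OF x(1)] PQ QP ann_tors_mult[OF x(1)] prime h)+
  have gR: "gR n a \<in> p \<longleftrightarrow> a \<in> ?Q n" if "a \<in> P n" for a n
    unfolding p_def by (rule prime_family_Proj(2)[of ?Q h])
      (fact ann_tors_ideal[OF x(1)] PQ QP ann_tors_mult[OF x(1)] prime h that)+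
  have pr: "primeideal p G" using pP by (simp add: Proj_def)
  have h1: "h \<in> P (Suc 0)" "gR (Suc 0) h \<notin> p" using h P_1 gR by auto
  have hk: "h [^] k \<in> P k" "gR k (h [^] k) \<notin> p" for k :: nat
    using P_pow[OF h1(1), of k] gR_pow_not_mem[OF pr h1, of k] by simp_all
  have "(\<exists>j. \<exists>g\<in>P j. gR j g \<notin> p \<and> g \<star> (a \<star> x) \<in> F (Suc (j + (e + d)))) \<longleftrightarrow> gR e a \<in> p"
    if a: "a \<in> P e" for a e
  proof
    assume "\<exists>j. \<exists>g\<in>P j. gR j g \<notin> p \<and> g \<star> (a \<star> x) \<in> F (Suc (j + (e + d)))"
    then obtain j g where g: "g \<in> P j" "gR j g \<notin> p" "g \<star> (a \<star> x) \<in> F (Suc (j + (e + d)))"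
      by blast
    have "(g \<otimes> a) \<star> x \<in> tors 0 (j + e + d)"
      using g(3) P_carrier[OF g(1)] P_carrier[OF a] xc by (simp add: tors_0 smult_assoc1 add.assoc)
    then have "g \<otimes> a \<in> ?Q (j + e)" using P_mult[OF g(1) a] by (auto simp: ann_tors_def)
    then have "a \<in> ?Q e" using prime[OF g(1) a] g gR by blast
    then show "gR e a \<in> p" using gR[OF a] by blast
  next
    assume "gR e a \<in> p"
    then obtain k where "a \<star> x \<in> tors k (e + d)" using gR[OF a] by (auto simp: ann_tors_def)
    then have "(h [^] k) \<star> (a \<star> x) \<in> F (Suc (k + (e + d)))" using hk(1) by (simp add: tors_def)
    then show "\<exists>j. \<exists>g\<in>P j. gR j g \<notin> p \<and> g \<star> (a \<star> x) \<in> F (Suc (j + (e + d)))"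
      using hk by blast
  qed
  then have "p \<in> Ass_points"
    unfolding Ass_points_iff using pP x(1) hk[of d] by blast
  moreover have "f \<star> x \<in> tors 0 (s + d)" using x(2) by (simp add: tors_0)
  then have "f \<in> ?Q s" using f by (auto simp: ann_tors_def)
  then have "gR s f \<in> p" using gR[OF f] by blast
  ultimately show ?thesis by blast
qed

text \<open>If no associated point contains the initial form of \<open>f\<close>, the kernel of multiplication by it consists
  of torsion elements, and there is no torsion in large degrees.\<close>

theorem superficial_iff_disjoint:
  assumes noeth: "noetherian_ring R" and fg: "finitely_generated_module R M" and f: "f \<in> P s"
  shows "superficial R I M s f \<longleftrightarrow> weak_transform_supp R I s f \<inter> Ass_gr_sheaf R I M = {}"
proof
  assume "superficial R I M s f"
  then obtain n0 where n0: "\<And>d x. \<lbrakk>d \<ge> n0; x \<in> F d; f \<star> x \<in> F (Suc (s + d))\<rbrakk> \<Longrightarrow> x \<in> F (Suc d)"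
    unfolding superficial_iff[OF f] by blast
  then show "weak_transform_supp R I s f \<inter> Ass_gr_sheaf R I M = {}"
    unfolding weak_transform_disjoint_iff[OF f] using superficial_imp_not_mem[OF f] by blast
next
  assume "weak_transform_supp R I s f \<inter> Ass_gr_sheaf R I M = {}"
  then have "\<forall>p\<in>Ass_points. gR s f \<notin> p" by (simp add: weak_transform_disjoint_iff[OF f])
  then have torsion: "\<exists>k. x \<in> tors k d" if "x \<in> F d" "f \<star> x \<in> F (Suc (s + d))" for x d
    using ex_Ass_point[OF noeth fg f that] by blast
  obtain j0 where j0: "\<And>k n. tors k n \<subseteq> tors (j0 - n) n"
    using uniform_torsion[OF rees_acc[OF noeth fg]] by blast
  have "x \<in> F (Suc d)" if "d \<ge> j0" "x \<in> F d" "f \<star> x \<in> F (Suc (s + d))" for d x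
    using torsion[OF that(2,3)] j0[of _ d] that(1) tors_0 by force
  then show "superficial R I M s f" unfolding superficial_iff[OF f] by blast
qed

end

section \<open>Superficial elements and the weak transform\<close>

theorem proposition2p6:
  fixes R :: "('a, 'c) ring_scheme" and M :: "('a, 'b, 'd) module_scheme"
    and I :: "'a set" and f :: 'a and s :: nat
  assumes "cring R" and "noetherian_ring R"
    and "ideal I R"
    and "module R M" and "finitely_generated_module R M"
    and "f \<in> ideal_power R I s - ideal_power R I (Suc s)"
  shows "(superficial R I M s f \<longleftrightarrow>
            weak_transform_supp R I s f \<inter> Ass_gr_sheaf R I M = {})
       \<and> (weak_transform_supp R I s f \<inter> Ass_gr_sheaf R I (regular_module R) = {} \<longleftrightarrow>
            weak_transform_supp R I s f \<inter> Ass_exc_divisor R I = {})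
       \<and> (superficial R I (regular_module R) s f \<longleftrightarrow>
            weak_transform_supp R I s f \<inter> Ass_exc_divisor R I = {})"
proof -
  interpret cring R by fact
  interpret M: adic_module R M I
    using assms(3,4) by (intro adic_module.intro adic_module_axioms.intro)
  interpret reg: adic_module R "regular_module R" I by (rule M.regular_adic)
  have f: "f \<in> ideal_power R I s" using assms(6) by blast
  (* For the ring itself the two sheaves are equal, not only isomorphic: the scalar
     multiplication of the associated graded module is the multiplication of the ring. *)
  have "Ass_gr_sheaf R I (regular_module R) = Ass_exc_divisor R I"
  proof -
    have "regular_module (gr_ring R I) = gr_module R I (regular_module R)"
      unfolding ideal_power_as_adic[OF assms(3)] by (simp add: regular_module_def gr_def)
    then show ?thesis
      by (simp add: Ass_gr_sheaf_def Ass_exc_divisor_def ideal_power_as_adic[OF assms(3)])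
  qed
  then show ?thesis
    using M.superficial_iff_disjoint[OF assms(2,5) f]
      reg.superficial_iff_disjoint[OF assms(2) M.regular_fg f] by simp
qed

end
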